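(* Fix $k\ge2$, $c>0$ and $\zeta=\zeta_n\in(0,1]$ with $\limsup_n\zeta_n(k-1)c^{k-1}<e$. Let $G=G_n=(V,E)$ be a sequence of asymptotically tree-like $k$-uniform hypergraphs on $N$ vertices with maximum degree $\Delta$, and let $\lambda\sim c\Delta^{-\frac1{k-1}}$. Let $\mathbf x^\ast$ be the unique fixed point of $F^G_{c,\zeta}$ and, for $t\in(0,c]$, $\mathbf x^\ast(t)$ the unique fixed point of $F^G_{t,\zeta}$. Then: (i) for each $v\in V$, $\mu_{G,\lambda,\zeta}(v\in\mathbf S)\sim x_v^\ast\Delta^{-\frac1{k-1}}$; (ii) for each $e\in E$, $\mu_{G,\lambda,\zeta}(e\subseteq\mathbf S)\sim(1-\zeta)\prod_{v\in e}\left(x_v^\ast\Delta^{-\frac1{k-1}}\right)$; (iii) $\Delta^{\frac1{k-1}}\log Z_G(\lambda,\zeta)\sim\sum_{v\in V}\int_0^c\frac{x_v^\ast(t)}{t}\,dt$; (iv) $\Delta^{\frac1{k-1}}N^{-1}\log Z_G(\lambda,\zeta)=N^{-1}\mathcal B^G_{c,\zeta}(\mathbf x^\ast)+o(1)$; (v) $\mathrm{var}_{G,\lambda,\zeta}(|\mathbf S|)=o(N^2\Delta^{-\frac2{k-1}})$ and $\mathrm{var}_{G,\lambda,\zeta}(|E(\mathbf S)|)=o(N^2\Delta^{-\frac2{k-1}})$.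
   Context: Hypergraphs are simple. For a hypergraph $G$ and $S\subseteq V(G)$, $d_G(S)=|\{e\in E(G):S\subseteq e\}|$, $\Delta_\ell(G)=\max_{|S|=\ell}d_G(S)$, $\Delta(G)=\Delta_1(G)$ the maximum degree, and $\Gamma(G)$ is the maximum over distinct $v,v'$ of the number of $(k-1)$-sets $S$ with $S\cup\{v\},S\cup\{v'\}\in E(G)$. A sequence $(G_n)$ of $k$-uniform hypergraphs is asymptotically tree-like if, with $G=G_n$, $\Delta=\Delta(G)$, as $n\to\infty$: (1) $\Delta\to\infty$; (2) $\Delta_\ell(G)=o(\Delta^{\frac{k-\ell}{k-1}})$ for each $\ell\in\{2,\dots,k-1\}$; (3) $\Gamma(G)=o(\Delta)$; (4) $|E(G)|/|V(G)|=\Omega(\Delta)$. The edge-penalty model $\mu_{G,\lambda,\zeta}(S)=\lambda^{|S|}(1-\zeta)^{|E(S)|}/Z_G(\lambda,\zeta)$ for $S\subseteq V$, $E(S)=\{e\in E:e\subseteq S\}$, $Z_G(\lambda,\zeta)=\sum_{S\subseteq V}\lambda^{|S|}(1-\zeta)^{|E(S)|}$; $\mathbf S$ is a sample. $(F^G_{c,\zeta}(\mathbf x))_v=c\exp\left(-\frac{\zeta}{\Delta}\sum_{e\ni v}\prod_{u\in e\setminus\{v\}}x_u\right)$, and $\mathcal B^G_{c,\zeta}(\mathbf x)=-\frac{\zeta}{\Delta}\sum_{e\in E}\prod_{u\in e}x_u-\sum_{v\in V}x_v\left[\log\frac{x_v}c-1\right]$. *)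

theory Defs
  imports "HOL-Analysis.Analysis" "HOL-Library.Landau_Symbols"
begin

definition k_uniform :: "nat \<Rightarrow> 'a set \<Rightarrow> 'a set set \<Rightarrow> bool" where
  "k_uniform k V E \<longleftrightarrow> finite V \<and> (\<forall>e\<in>E. e \<subseteq> V \<and> card e = k)"

definition hdeg :: "'a set set \<Rightarrow> 'a set \<Rightarrow> nat" where
  "hdeg E S = card {e\<in>E. S \<subseteq> e}"

definition Delta_l :: "'a set \<Rightarrow> 'a set set \<Rightarrow> nat \<Rightarrow> nat" where
  "Delta_l V E l = Max (insert 0 (hdeg E ` {S. S \<subseteq> V \<and> card S = l}))"

definition max_deg :: "'a set \<Rightarrow> 'a set set \<Rightarrow> nat" where
  "max_deg V E = Delta_l V E 1"

definition Gamma :: "nat \<Rightarrow> 'a set \<Rightarrow> 'a set set \<Rightarrow> nat" where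
  "Gamma k V E = Max (insert 0 ((\<lambda>(v, v'). card {S. card S = k - 1 \<and> insert v S \<in> E \<and> insert v' S \<in> E})
       ` {(v, v'). v \<in> V \<and> v' \<in> V \<and> v \<noteq> v'}))"

definition asymp_tree_like :: "nat \<Rightarrow> (nat \<Rightarrow> 'a set) \<Rightarrow> (nat \<Rightarrow> 'a set set) \<Rightarrow> bool" where
  "asymp_tree_like k V E \<longleftrightarrow>
     (\<forall>n. k_uniform k (V n) (E n)) \<and>
     filterlim (\<lambda>n. real (max_deg (V n) (E n))) at_top sequentially \<and>
     (\<forall>l\<in>{2..k-1}. (\<lambda>n. real (Delta_l (V n) (E n) l))
        \<in> o(\<lambda>n. real (max_deg (V n) (E n)) powr ((real k - real l) / (real k - 1)))) \<and>
     (\<lambda>n. real (Gamma k (V n) (E n))) \<in> o(\<lambda>n. real (max_deg (V n) (E n))) \<and>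
     (\<lambda>n. real (card (E n)) / real (card (V n))) \<in> \<Omega>(\<lambda>n. real (max_deg (V n) (E n)))"

definition edges_in :: "'a set set \<Rightarrow> 'a set \<Rightarrow> 'a set set" where
  "edges_in E S = {e\<in>E. e \<subseteq> S}"

definition ep_weight :: "'a set set \<Rightarrow> real \<Rightarrow> real \<Rightarrow> 'a set \<Rightarrow> real" where
  "ep_weight E lam \<zeta> S = lam ^ card S * (1 - \<zeta>) ^ card (edges_in E S)"

definition part_fun :: "'a set \<Rightarrow> 'a set set \<Rightarrow> real \<Rightarrow> real \<Rightarrow> real" where
  "part_fun V E lam \<zeta> = (\<Sum>S\<in>Pow V. ep_weight E lam \<zeta> S)"

definition ep_mu :: "'a set \<Rightarrow> 'a set set \<Rightarrow> real \<Rightarrow> real \<Rightarrow> 'a set \<Rightarrow> real" where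
  "ep_mu V E lam \<zeta> S = ep_weight E lam \<zeta> S / part_fun V E lam \<zeta>"

definition ep_prob :: "'a set \<Rightarrow> 'a set set \<Rightarrow> real \<Rightarrow> real \<Rightarrow> ('a set \<Rightarrow> bool) \<Rightarrow> real" where
  "ep_prob V E lam \<zeta> P = (\<Sum>S\<in>{S\<in>Pow V. P S}. ep_mu V E lam \<zeta> S)"

definition ep_expect :: "'a set \<Rightarrow> 'a set set \<Rightarrow> real \<Rightarrow> real \<Rightarrow> ('a set \<Rightarrow> real) \<Rightarrow> real" where
  "ep_expect V E lam \<zeta> f = (\<Sum>S\<in>Pow V. ep_mu V E lam \<zeta> S * f S)"

definition ep_var :: "'a set \<Rightarrow> 'a set set \<Rightarrow> real \<Rightarrow> real \<Rightarrow> ('a set \<Rightarrow> real) \<Rightarrow> real" where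
  "ep_var V E lam \<zeta> f = ep_expect V E lam \<zeta> (\<lambda>S. (f S - ep_expect V E lam \<zeta> f)\<^sup>2)"

definition Fmap :: "'a set \<Rightarrow> 'a set set \<Rightarrow> real \<Rightarrow> real \<Rightarrow> ('a \<Rightarrow> real) \<Rightarrow> 'a \<Rightarrow> real" where
  "Fmap V E c \<zeta> x v = c * exp (- (\<zeta> / real (max_deg V E)) *
      (\<Sum>e\<in>{e\<in>E. v \<in> e}. \<Prod>u\<in>e - {v}. x u))"

definition is_fixpoint :: "'a set \<Rightarrow> 'a set set \<Rightarrow> real \<Rightarrow> real \<Rightarrow> ('a \<Rightarrow> real) \<Rightarrow> bool" where
  "is_fixpoint V E c \<zeta> x \<longleftrightarrow> (\<forall>v\<in>V. x v = Fmap V E c \<zeta> x v)"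

definition is_unique_fixpoint :: "'a set \<Rightarrow> 'a set set \<Rightarrow> real \<Rightarrow> real \<Rightarrow> ('a \<Rightarrow> real) \<Rightarrow> bool" where
  "is_unique_fixpoint V E c \<zeta> x \<longleftrightarrow> is_fixpoint V E c \<zeta> x \<and>
     (\<forall>y. is_fixpoint V E c \<zeta> y \<longrightarrow> (\<forall>v\<in>V. y v = x v))"

definition bethe_fun :: "'a set \<Rightarrow> 'a set set \<Rightarrow> real \<Rightarrow> real \<Rightarrow> ('a \<Rightarrow> real) \<Rightarrow> real" where
  "bethe_fun V E c \<zeta> x = - (\<zeta> / real (max_deg V E)) * (\<Sum>e\<in>E. \<Prod>u\<in>e. x u)
      - (\<Sum>v\<in>V. x v * (ln (x v / c) - 1))"

end

theory Submission
  imports Defs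
begin

text \<open>
  Conditioning on vertices being occupied and revealing edges one at a time writes the odds of a
  vertex \<open>v\<close> as \<open>\<lambda> \<Prod>\<^sub>e (1 - \<zeta> \<Prod>\<^sub>u p\<^sub>u)\<close> over the edges \<open>e\<close> at \<open>v\<close> and the other vertices \<open>u\<close> of \<open>e\<close>,
  where each \<open>p\<^sub>u\<close> is an occupation probability in a model with boundedly many more pinned vertices.
  The conditions on \<open>\<Delta>\<^sub>l\<close> and \<open>\<Gamma>\<close> say exactly that the pinned vertices disturb only a negligible
  share of the edges at \<open>v\<close>, so up to \<open>o(1)\<close> this is one step of the map \<open>F\<close>.
  With \<open>x\<^sub>v = c exp (- s\<^sub>v)\<close>, the map \<open>F\<close> is a contraction in the coordinates \<open>ln (1 + (k - 1) s\<^sub>v)\<close> as long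
  as \<open>\<zeta> (k - 1) c\<^sup>k\<^sup>-\<^sup>1\<close> stays below \<open>e\<close>, so boundedly many steps bring every
  occupation probability close to the fixed point, uniformly over the bounded sets of pinned vertices.
  This gives the inclusion probabilities of all bounded sets and hence the variances.
  Finally \<open>ln Z\<close> is compared with the Bethe functional along \<open>t \<in> [0, c]\<close>: their \<open>t\<close>-derivatives agree
  up to \<open>o(1)\<close>, because the functional is stationary at the fixed point.
\<close>

subsection \<open>The model with pinned vertices\<close>

text \<open>A vacant vertex disables its edges, so vacancy amounts to pinning the vertex and no
  longer penalising its edges. Only occupied pins are therefore needed, at the price of carrying an
  edge set \<open>D\<close> next to the pinned set \<open>T\<close>. Edges dropped from
  \<open>D\<close> could accumulate along the recursion; but an edge dropped while expanding at
  \<open>v\<close> contains \<open>v\<close>, which is pinned from then on. Counting only the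
  dropped edges disjoint from \<open>T\<close> gives a number \<open>M\<close> that never grows.
  Uniformity rests on the order of choices: the target error fixes the depth, the depth fixes how
  many vertices get pinned, and only then is the admissible error of the hypergraph chosen. It
  depends neither on the hypergraph nor on \<open>t\<close>, so the whole interval of
  \<open>t\<close> is handled at once. No fixed point is differentiated in \<open>t\<close>: a
  Lipschitz bound suffices, since stationarity leaves a remainder quadratic in
  \<open>t - t\<^sub>0\<close>. The variances need a further fact: \<open>N\<close> outgrows the
  power \<open>1 / (k - 1)\<close> of the maximum degree, which makes \<open>N * lam\<close>
  negligible against its square.\<close>

locale penalty_hypergraph =
  fixes V :: "'a set" and E :: "'a set set" and k :: nat and lam z :: real
  assumes uniform: "k_uniform k V E" and k_ge_2: "2 \<le> k"
    and lam_pos: "0 < lam" and z_nonneg: "0 \<le> z" and z_le_1: "z \<le> 1"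
begin

lemma finite_V: "finite V"
  using uniform by (simp add: k_uniform_def)

lemma edge_subset: "e \<in> E \<Longrightarrow> e \<subseteq> V"
  using uniform by (auto simp: k_uniform_def)

lemma edge_card: "e \<in> E \<Longrightarrow> card e = k"
  using uniform by (auto simp: k_uniform_def)

lemma edge_finite: "e \<in> E \<Longrightarrow> finite e"
  using edge_subset finite_V finite_subset by blast

lemma finite_E: "finite E"
  by (rule finite_subset[of _ "Pow V"]) (use edge_subset finite_V in auto)

lemma finite_subE: "D \<subseteq> E \<Longrightarrow> finite D"
  using finite_E finite_subset by blast

text \<open>The vertices of \<open>T\<close> are pinned to be occupied, at no cost in \<open>lam\<close>; only edges in \<open>D\<close> are penalised.\<close>

definition Z :: "'a set \<Rightarrow> 'a set set \<Rightarrow> real" where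
  "Z T D = (\<Sum>S\<in>Pow (V - T). lam ^ card S * (1 - z) ^ card {f\<in>D. f \<subseteq> S \<union> T})"

lemma Z_ge_1:
  assumes "D \<subseteq> E" "\<forall>f\<in>D. \<not> f \<subseteq> T"
  shows "1 \<le> Z T D"
proof -
  have "lam ^ card ({} :: 'a set) * (1 - z) ^ card {f\<in>D. f \<subseteq> {} \<union> T} \<le> Z T D"
    unfolding Z_def
    by (rule member_le_sum[of "{}" _ "\<lambda>S. lam ^ card S * (1 - z) ^ card {f\<in>D. f \<subseteq> S \<union> T}"])
      (use finite_V lam_pos z_le_1 in auto)
  moreover have "{f\<in>D. f \<subseteq> {} \<union> T} = {}" using assms by auto
  ultimately show ?thesis by (metis card.empty mult_1 power_0)
qed

text \<open>Pinning deletes summands and can only complete more edges. As pins carry no factor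
  \<open>lam\<close>, this is the form taken here by the fact that \<open>A\<close> is occupied with
  probability at most \<open>lam ^ card A\<close>.\<close>

lemma Z_pin_le:
  assumes "D \<subseteq> E"
  shows "Z (T \<union> A) D \<le> Z T D"
proof -
  have "Z (T \<union> A) D \<le> (\<Sum>S\<in>Pow (V - (T \<union> A)). lam ^ card S * (1 - z) ^ card {f\<in>D. f \<subseteq> S \<union> T})"
    unfolding Z_def
  proof (intro sum_mono mult_left_mono power_decreasing card_mono)
    show "finite {f \<in> D. f \<subseteq> S \<union> (T \<union> A)}" for S using finite_subE[OF assms] by auto
  qed (use z_nonneg z_le_1 lam_pos in auto)
  also have "\<dots> \<le> Z T D"
    unfolding Z_def by (intro sum_mono2) (use finite_V lam_pos z_le_1 in auto)
  finally show ?thesis .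
qed

text \<open>If \<open>v\<close> is vacant, no edge through \<open>v\<close> is complete, so the
  vacant part is the sum with \<open>v\<close> pinned and its edges unpenalised. Both parts then
  refer to the same pinned set and differ only in their edge sets.\<close>

lemma Z_split:
  assumes "v \<in> V - T"
  shows "Z T D = lam * Z (insert v T) D + Z (insert v T) {f\<in>D. v \<notin> f}"
proof -
  let ?X = "V - insert v T"
  let ?w = "\<lambda>S. lam ^ card S * (1 - z) ^ card {f\<in>D. f \<subseteq> S \<union> T}"
  have fin: "finite ?X" using finite_V by auto
  have "V - T = insert v ?X" using assms by auto
  then have "Z T D = sum ?w (Pow ?X \<union> insert v ` Pow ?X)"
    unfolding Z_def by (metis Pow_insert)
  also have "\<dots> = sum ?w (Pow ?X) + sum ?w (insert v ` Pow ?X)"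
    by (rule sum.union_disjoint) (use fin in auto)
  also have "sum ?w (insert v ` Pow ?X) = (\<Sum>S\<in>Pow ?X. ?w (insert v S))"
    by (rule sum.reindex_cong[where l = "insert v"]) (auto simp: inj_on_def)
  also have "\<dots> = lam * Z (insert v T) D"
    unfolding Z_def sum_distrib_left
  proof (rule sum.cong[OF refl])
    fix S assume S: "S \<in> Pow ?X"
    then have "finite S" "v \<notin> S" using fin finite_subset by auto
    then show "?w (insert v S) = lam * (lam ^ card S * (1 - z) ^ card {f \<in> D. f \<subseteq> S \<union> insert v T})"
      by simp
  qed
  also have "sum ?w (Pow ?X) = Z (insert v T) {f\<in>D. v \<notin> f}"
    unfolding Z_def
  proof (rule sum.cong[OF refl])
    fix S assume S: "S \<in> Pow ?X"
    then have "{f\<in>D. f \<subseteq> S \<union> T} = {f \<in> {f \<in> D. v \<notin> f}. f \<subseteq> S \<union> insert v T}"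
      using assms by auto
    then show "?w S = lam ^ card S * (1 - z) ^ card {f \<in> {f \<in> D. v \<notin> f}. f \<subseteq> S \<union> insert v T}"
      by simp
  qed
  finally show ?thesis by simp
qed

lemma Z_supersets:
  assumes "A \<subseteq> V - T"
  shows "(\<Sum>S\<in>{S\<in>Pow (V - T). A \<subseteq> S}. lam ^ card S * (1 - z) ^ card {f\<in>D. f \<subseteq> S \<union> T})
    = lam ^ card A * Z (T \<union> A) D"
proof -
  let ?w = "\<lambda>S. lam ^ card S * (1 - z) ^ card {f\<in>D. f \<subseteq> S \<union> T}"
  have fin: "finite (V - (T \<union> A))" "finite A" using finite_V assms finite_subset by auto
  have "sum ?w {S\<in>Pow (V - T). A \<subseteq> S} = (\<Sum>S\<in>Pow (V - (T \<union> A)). ?w (S \<union> A))"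
  proof (rule sum.reindex_cong[where l = "\<lambda>S. S \<union> A"])
    show "inj_on (\<lambda>S. S \<union> A) (Pow (V - (T \<union> A)))" by (auto simp: inj_on_def)
    show "{S \<in> Pow (V - T). A \<subseteq> S} = (\<lambda>S. S \<union> A) ` Pow (V - (T \<union> A))" (is "?L = ?R")
    proof
      show "?L \<subseteq> ?R"
      proof
        fix S assume "S \<in> ?L"
        then have "S = (S - A) \<union> A" "S - A \<in> Pow (V - (T \<union> A))" by auto
        then show "S \<in> ?R" by blast
      qed
      show "?R \<subseteq> ?L" using assms by auto
    qed
  qed simp
  also have "\<dots> = lam ^ card A * Z (T \<union> A) D"
    unfolding Z_def sum_distrib_left
  proof (rule sum.cong[OF refl])
    fix S assume S: "S \<in> Pow (V - (T \<union> A))"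
    then have "card (S \<union> A) = card S + card A"
      using fin finite_subset by (intro card_Un_disjoint) auto
    moreover have "S \<union> A \<union> T = S \<union> (T \<union> A)" by auto
    ultimately show "?w (S \<union> A) = lam ^ card A * (lam ^ card S * (1 - z) ^ card {f \<in> D. f \<subseteq> S \<union> (T \<union> A)})"
      by (simp add: power_add)
  qed
  finally show ?thesis .
qed

text \<open>Penalising \<open>e\<close> multiplies by \<open>1 - z\<close> exactly the summands in
  which \<open>e\<close> is complete. After division by \<open>Z T D\<close> the loss is
  \<open>z\<close> times the probability that \<open>e\<close> is fully occupied.\<close>

lemma Z_insert_edge:
  assumes "e \<in> E" "e \<notin> D" "D \<subseteq> E"
  shows "Z T (insert e D) = Z T D - z * (lam ^ card (e - T) * Z (T \<union> e) D)"
proof -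
  let ?w = "\<lambda>S. lam ^ card S * (1 - z) ^ card {f\<in>D. f \<subseteq> S \<union> T}"
  have "Z T (insert e D) = (\<Sum>S\<in>Pow (V - T). ?w S - z * (if e - T \<subseteq> S then ?w S else 0))"
    unfolding Z_def
  proof (rule sum.cong[OF refl])
    fix S assume S: "S \<in> Pow (V - T)"
    show "lam ^ card S * (1 - z) ^ card {f \<in> insert e D. f \<subseteq> S \<union> T} = ?w S - z * (if e - T \<subseteq> S then ?w S else 0)"
    proof (cases "e - T \<subseteq> S")
      case True
      then have "{f \<in> insert e D. f \<subseteq> S \<union> T} = insert e {f\<in>D. f \<subseteq> S \<union> T}" by auto
      then have "card {f \<in> insert e D. f \<subseteq> S \<union> T} = Suc (card {f\<in>D. f \<subseteq> S \<union> T})"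
        using assms finite_subE[of D] by simp
      then show ?thesis using True by (simp add: algebra_simps)
    next
      case False
      then have "{f \<in> insert e D. f \<subseteq> S \<union> T} = {f\<in>D. f \<subseteq> S \<union> T}" by auto
      then show ?thesis using False by simp
    qed
  qed
  also have "\<dots> = Z T D - z * (\<Sum>S\<in>Pow (V - T). if e - T \<subseteq> S then ?w S else 0)"
    by (simp add: sum_subtractf sum_distrib_left Z_def)
  also have "(\<Sum>S\<in>Pow (V - T). if e - T \<subseteq> S then ?w S else 0) = sum ?w {S\<in>Pow (V - T). e - T \<subseteq> S}"
    using finite_V by (subst sum.inter_filter) auto
  also have "\<dots> = lam ^ card (e - T) * Z (T \<union> (e - T)) D"
    by (rule Z_supersets) (use edge_subset assms in auto)
  also have "T \<union> (e - T) = T \<union> e" by auto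
  finally show ?thesis by simp
qed

lemma Z_antimono:
  assumes "D \<subseteq> D'" "D' \<subseteq> E"
  shows "Z T D' \<le> Z T D"
  unfolding Z_def
proof (intro sum_mono mult_left_mono power_decreasing card_mono)
  show "finite {f \<in> D'. f \<subseteq> S \<union> T}" for S using finite_subE[OF assms(2)] by auto
qed (use z_nonneg z_le_1 lam_pos assms in auto)

text \<open>With \<open>T\<close> pinned, the odds of \<open>v\<close> are \<open>lam * exp (- suppr T D v)\<close> (see \<open>Z_pin_ratio\<close>).\<close>

definition suppr :: "'a set \<Rightarrow> 'a set set \<Rightarrow> 'a \<Rightarrow> real" where
  "suppr T D v = ln (Z (insert v T) {f\<in>D. v \<notin> f}) - ln (Z (insert v T) D)"

lemma suppr_nonneg:
  assumes "D \<subseteq> E" "\<forall>f\<in>D. \<not> f \<subseteq> insert v T"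
  shows "0 \<le> suppr T D v"
proof -
  have "1 \<le> Z (insert v T) D" using assms by (intro Z_ge_1) auto
  moreover have "Z (insert v T) D \<le> Z (insert v T) {f\<in>D. v \<notin> f}"
    using assms by (intro Z_antimono) auto
  ultimately show ?thesis by (simp add: suppr_def)
qed

text \<open>With \<open>a\<close> and \<open>b\<close> the two sums of \<open>Z_split\<close>, the
  ratio is \<open>a / (lam * a + b)\<close> and \<open>a / b = exp (- suppr T D v)\<close>. Times
  \<open>lam\<close> it is the probability that \<open>v\<close> is occupied given the pins.\<close>

lemma Z_pin_ratio:
  assumes "v \<in> V - T" "D \<subseteq> E" "\<forall>f\<in>D. \<not> f \<subseteq> insert v T"
  shows "Z (insert v T) D / Z T D = exp (- suppr T D v) / (1 + lam * exp (- suppr T D v))"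
proof -
  let ?a = "Z (insert v T) D" and ?b = "Z (insert v T) {f\<in>D. v \<notin> f}"
  have a: "1 \<le> ?a" using assms by (intro Z_ge_1) auto
  have b: "?a \<le> ?b" using assms by (intro Z_antimono) auto
  have "exp (- suppr T D v) = ?a / ?b"
    using a b by (simp add: suppr_def exp_diff)
  moreover have "?a / (lam * ?a + ?b) = (?a / ?b) / (1 + lam * (?a / ?b))"
    using a b lam_pos by (simp add: divide_simps)
  ultimately show ?thesis
    using Z_split[OF assms(1), of D] by simp
qed

text \<open>Chain rule: pin the vertices one at a time. Each gives a factor
  \<open>exp (- \<sigma> u)\<close> and a normalisation between \<open>1 - lam\<close> and
  \<open>1\<close>; \<open>\<kappa>\<close> collects the normalisations. \<open>Q\<close> is left
  abstract so that each level of the recursion can insert its own error bound, and it is assumed for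
  every \<open>A'\<close> because the order of pinning is not exposed.\<close>

lemma Z_pin_set:
  assumes "finite A" "A \<subseteq> V - T" "D \<subseteq> E" "\<forall>f\<in>D. \<not> f \<subseteq> T \<union> A"
    and Q: "\<And>u A'. u \<in> A \<Longrightarrow> A' \<subseteq> A - {u} \<Longrightarrow> Q u (suppr (T \<union> A') D u)"
  shows "\<exists>\<sigma> \<kappa>. (\<forall>u\<in>A. Q u (\<sigma> u) \<and> 0 \<le> \<sigma> u) \<and> 0 < \<kappa> \<and> 1 - real (card A) * lam \<le> \<kappa> \<and> \<kappa> \<le> 1
    \<and> Z (T \<union> A) D / Z T D = exp (- (\<Sum>u\<in>A. \<sigma> u)) * \<kappa>"
  using assms
proof (induction A rule: finite_induct)
  case empty
  have "1 \<le> Z T D" using empty by (intro Z_ge_1) auto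
  then show ?case by (intro exI[of _ "\<lambda>_. 0"] exI[of _ 1]) auto
next
  case (insert a A)
  have "\<exists>\<sigma> \<kappa>. (\<forall>u\<in>A. Q u (\<sigma> u) \<and> 0 \<le> \<sigma> u) \<and> 0 < \<kappa> \<and> 1 - real (card A) * lam \<le> \<kappa> \<and> \<kappa> \<le> 1
    \<and> Z (T \<union> A) D / Z T D = exp (- (\<Sum>u\<in>A. \<sigma> u)) * \<kappa>"
  proof (rule insert.IH)
    show "Q u (suppr (T \<union> A') D u)" if "u \<in> A" "A' \<subseteq> A - {u}" for u A'
      using insert.prems(4)[of u A'] that by auto
  qed (use insert.prems in auto)
  then obtain \<sigma> \<kappa> where \<sigma>: "\<forall>u\<in>A. Q u (\<sigma> u) \<and> 0 \<le> \<sigma> u"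
    and \<kappa>: "0 < \<kappa>" "1 - real (card A) * lam \<le> \<kappa>" "\<kappa> \<le> 1"
    and eq: "Z (T \<union> A) D / Z T D = exp (- (\<Sum>u\<in>A. \<sigma> u)) * \<kappa>" by blast
  define s where "s = suppr (T \<union> A) D a"
  have free: "\<forall>f\<in>D. \<not> f \<subseteq> insert a (T \<union> A)" using insert.prems by auto
  have s0: "0 \<le> s" unfolding s_def using free insert.prems by (intro suppr_nonneg) auto
  have Qs: "Q a s" unfolding s_def by (rule insert.prems(4)) (use insert.hyps in auto)
  have es: "exp (-s) \<le> 1" using s0 by simp
  define r where "r = 1 / (1 + lam * exp (-s))"
  have r: "0 < r" "r \<le> 1" unfolding r_def using lam_pos by (auto simp: field_simps add_pos_pos)
  have "1 - lam \<le> r"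
  proof -
    have "(1 - lam) * (1 + lam * exp (-s)) = 1 - lam * (1 - exp (-s)) - lam * lam * exp (-s)"
      by (simp add: algebra_simps)
    also have "\<dots> \<le> 1" using es lam_pos by (smt (verit) exp_gt_zero mult_nonneg_nonneg)
    finally show ?thesis unfolding r_def using lam_pos by (simp add: pos_le_divide_eq add_pos_pos)
  qed
  then have "\<kappa> * (1 - lam) \<le> \<kappa> * r" using \<kappa> by simp
  moreover have "\<kappa> - lam \<le> \<kappa> * (1 - lam)" using \<kappa> lam_pos by (simp add: algebra_simps)
  ultimately have kr: "\<kappa> - lam \<le> \<kappa> * r" by simp
  have ratio: "Z (insert a (T \<union> A)) D / Z (T \<union> A) D = exp (-s) * r"
    using Z_pin_ratio[of a "T \<union> A" D] free insert.prems insert.hyps by (auto simp: s_def r_def)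
  have pos: "1 \<le> Z (T \<union> A) D" using insert.prems by (intro Z_ge_1) auto
  have "Z (T \<union> insert a A) D / Z T D = (Z (insert a (T \<union> A)) D / Z (T \<union> A) D) * (Z (T \<union> A) D / Z T D)"
    using pos by simp
  also have "\<dots> = exp (- s - (\<Sum>u\<in>A. \<sigma> u)) * (\<kappa> * r)"
    unfolding ratio eq by (simp add: exp_diff exp_minus field_simps)
  also have "- s - (\<Sum>u\<in>A. \<sigma> u) = - (\<Sum>u\<in>insert a A. (\<sigma>(a := s)) u)"
    using insert.hyps by (simp add: sum.insert[of A a] cong: sum.cong)
      (smt (verit, best) fun_upd_apply sum.cong)
  finally have "Z (T \<union> insert a A) D / Z T D = exp (- (\<Sum>u\<in>insert a A. (\<sigma>(a := s)) u)) * (\<kappa> * r)" .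
  moreover have "\<forall>u\<in>insert a A. Q u ((\<sigma>(a := s)) u) \<and> 0 \<le> (\<sigma>(a := s)) u" using \<sigma> Qs s0 by auto
  moreover have "0 < \<kappa> * r" "\<kappa> * r \<le> 1" using \<kappa> r by (auto simp: mult_le_one)
  moreover have "1 - real (card (insert a A)) * lam \<le> \<kappa> * r"
    using kr \<kappa> insert.hyps by (simp add: algebra_simps)
  ultimately show ?case by blast
qed

text \<open>Telescoping: \<open>De e\<close> is the edge set present just before \<open>e\<close> is
  added, and each factor is \<open>1 - z\<close> times the probability that \<open>e\<close> is
  complete in that model. With \<open>F\<close> the edges at \<open>v\<close> and \<open>D\<close>
  the edges avoiding \<open>v\<close>, this expands \<open>suppr\<close> as a sum over the edges at
  \<open>v\<close>.\<close>

lemma ln_Z_add_edges: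
  assumes "finite F" "F \<subseteq> E" "D \<subseteq> E" "D \<inter> F = {}" "\<forall>f\<in>D \<union> F. \<not> f \<subseteq> T"
  shows "\<exists>De. (\<forall>e\<in>F. D \<subseteq> De e \<and> De e \<subseteq> (D \<union> F) - {e}) \<and>
     ln (Z T D) - ln (Z T (D \<union> F))
       = (\<Sum>e\<in>F. - ln (1 - z * (lam ^ card (e - T) * Z (T \<union> e) (De e) / Z T (De e))))"
  using assms
proof (induction F rule: finite_induct)
  case empty
  show ?case by simp
next
  case (insert e F)
  let ?P = "\<lambda>e D. lam ^ card (e - T) * Z (T \<union> e) D / Z T D"
  obtain De where De: "\<forall>e\<in>F. D \<subseteq> De e \<and> De e \<subseteq> (D \<union> F) - {e}"
    and eq: "ln (Z T D) - ln (Z T (D \<union> F)) = (\<Sum>e\<in>F. - ln (1 - z * ?P e (De e)))"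
    using insert.IH insert.prems by auto
  have pos: "1 \<le> Z T (D \<union> F)" "1 \<le> Z T (insert e (D \<union> F))"
    using insert.prems by (intro Z_ge_1; auto)+
  have "Z T (insert e (D \<union> F)) = Z T (D \<union> F) - z * (lam ^ card (e - T) * Z (T \<union> e) (D \<union> F))"
    by (rule Z_insert_edge) (use insert.prems insert.hyps in auto)
  then have fac: "Z T (insert e (D \<union> F)) = Z T (D \<union> F) * (1 - z * ?P e (D \<union> F))"
    using pos by (simp add: right_diff_distrib)
  \<comment> \<open>Positivity comes from both partition functions being at least 1, and so holds
    for \<open>z = 1\<close> too.\<close>
  have fpos: "0 < 1 - z * ?P e (D \<union> F)"
    using pos unfolding fac by (smt (verit) zero_less_mult_pos)
  have "ln (Z T (insert e (D \<union> F))) = ln (Z T (D \<union> F)) + ln (1 - z * ?P e (D \<union> F))"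
    unfolding fac using pos fpos by (intro ln_mult_pos) auto
  moreover have "(\<Sum>e'\<in>F. - ln (1 - z * ?P e' ((De(e := D \<union> F)) e'))) = (\<Sum>e\<in>F. - ln (1 - z * ?P e (De e)))"
    using insert.hyps by (intro sum.cong) auto
  ultimately have "ln (Z T D) - ln (Z T (D \<union> insert e F)) =
     (\<Sum>e'\<in>insert e F. - ln (1 - z * ?P e' ((De(e := D \<union> F)) e')))"
    using insert.hyps eq by simp
  moreover have "\<forall>e'\<in>insert e F. D \<subseteq> (De(e := D \<union> F)) e' \<and> (De(e := D \<union> F)) e' \<subseteq> (D \<union> insert e F) - {e'}"
    using De insert.hyps insert.prems by auto
  ultimately show ?case by blast
qed

end

subsection \<open>Counting edges that meet the pinned set\<close>

text \<open>The asymptotic conditions become inequalities with a common error, so that the recursion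
  can be run on a single hypergraph. The product bound reflects
  \<open>(k - l) + (l - 1) = k - 1\<close>: the exponents for \<open>l\<close> and
  \<open>k + 1 - l\<close> add up to 1. The bound for \<open>l = 2\<close> is listed separately
  because the range \<open>{2..k-1}\<close> is empty for \<open>k = 2\<close>.\<close>

definition near_tree :: "nat \<Rightarrow> 'a set \<Rightarrow> 'a set set \<Rightarrow> real \<Rightarrow> real \<Rightarrow> real \<Rightarrow> bool" where
  "near_tree k V E lam c \<epsilon> \<longleftrightarrow>
     lam \<le> \<epsilon> \<and> \<bar>lam ^ (k - 1) * real (max_deg V E) - c ^ (k - 1)\<bar> \<le> \<epsilon> \<and>
     (\<forall>l\<in>{2..k-1}. real (Delta_l V E l) * lam ^ (k - l) \<le> \<epsilon>) \<and>
     (\<forall>l\<in>{2..k-1}. real (Delta_l V E l) * real (Delta_l V E (k + 1 - l)) \<le> \<epsilon> * real (max_deg V E)) \<and>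
     real (Delta_l V E 2) \<le> \<epsilon> * real (max_deg V E) \<and>
     real (Gamma k V E) \<le> \<epsilon> * real (max_deg V E) \<and>
     1 \<le> \<epsilon> * real (max_deg V E)"

text \<open>The four summands of the error of one recursion step, in order: the approximation on
  regular edges, the edges meeting the pinned set, the obstructed edges, and the terms of the ideal
  recursion that have no regular edge as counterpart.\<close>

definition est_const :: "nat \<Rightarrow> real \<Rightarrow> nat \<Rightarrow> nat \<Rightarrow> real" where
  "est_const k C \<tau> M = (1 + (real k + 2) * (C + 1)) + 2 * 2 ^ \<tau>
      + 2 * (C + 1) * (real \<tau> + 2 ^ (\<tau> + 1)) + C * (real M + real \<tau> + (real \<tau> + 2 ^ (\<tau> + 1)))"

context penalty_hypergraph
begin

abbreviation Dmax :: real where "Dmax \<equiv> real (max_deg V E)"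

lemma hdeg_le_Delta_l: "S \<subseteq> V \<Longrightarrow> hdeg E S \<le> Delta_l V E (card S)"
  unfolding Delta_l_def
proof (rule Max_ge)
  have "{T. T \<subseteq> V \<and> card T = card S} \<subseteq> Pow V" by auto
  then have "finite {T. T \<subseteq> V \<and> card T = card S}" using finite_V finite_subset by blast
  then show "finite (insert 0 (hdeg E ` {T. T \<subseteq> V \<and> card T = card S}))" by simp
qed auto

lemma degree_le_max_deg: "v \<in> V \<Longrightarrow> card {e\<in>E. v \<in> e} \<le> max_deg V E"
  using hdeg_le_Delta_l[of "{v}"] by (simp add: max_deg_def hdeg_def)

lemma codegree_le_Gamma:
  assumes "v \<in> V" "w \<in> V" "v \<noteq> w"
  shows "card {S. card S = k - 1 \<and> insert v S \<in> E \<and> insert w S \<in> E} \<le> Gamma k V E"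
  unfolding Gamma_def
proof (rule Max_ge)
  have "{(v, v'). v \<in> V \<and> v' \<in> V \<and> v \<noteq> v'} \<subseteq> V \<times> V" by auto
  then have "finite {(v, v'). v \<in> V \<and> v' \<in> V \<and> v \<noteq> v'}"
    using finite_V by (meson finite_SigmaI finite_subset)
  then show "finite (insert 0 ((\<lambda>(v, v'). card {S. card S = k - 1 \<and> insert v S \<in> E \<and> insert v' S \<in> E}) `
       {(v, v'). v \<in> V \<and> v' \<in> V \<and> v \<noteq> v'}))" by simp
qed (use assms in auto)

lemma card_edges_meeting:
  assumes "v \<in> V - T" "T \<subseteq> V"
  shows "card {e\<in>E. v \<in> e \<and> e \<inter> T \<noteq> {}} \<le> card T * Delta_l V E 2"
proof -
  have fT: "finite T" using assms finite_V finite_subset by blast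
  have "{e\<in>E. v \<in> e \<and> e \<inter> T \<noteq> {}} \<subseteq> (\<Union>u\<in>T. {e\<in>E. {v,u} \<subseteq> e})" by auto
  then have "card {e\<in>E. v \<in> e \<and> e \<inter> T \<noteq> {}} \<le> card (\<Union>u\<in>T. {e\<in>E. {v,u} \<subseteq> e})"
    using fT finite_E by (intro card_mono) auto
  also have "\<dots> \<le> (\<Sum>u\<in>T. card {e\<in>E. {v,u} \<subseteq> e})" by (rule card_UN_le[OF fT])
  also have "\<dots> \<le> (\<Sum>u\<in>T. Delta_l V E 2)"
  proof (rule sum_mono)
    fix u assume u: "u \<in> T"
    then have "card {v,u} = 2" using assms by (auto simp: card_2_iff)
    then show "card {e\<in>E. {v,u} \<subseteq> e} \<le> Delta_l V E 2"
      using hdeg_le_Delta_l[of "{v,u}"] assms u by (auto simp: hdeg_def)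
  qed
  finally show ?thesis by simp
qed

text \<open>Group the edges by their trace \<open>W\<close> on \<open>T\<close>. The edges with
  trace \<open>W\<close> all contain \<open>insert v W\<close>, so there are at most
  \<open>Delta_l V E (card W + 1)\<close> of them, each of weight
  \<open>lam ^ (k - (card W + 1))\<close>. Since \<open>W\<close> is nonempty and no edge lies
  inside \<open>insert v T\<close>, the index is in \<open>{2..k-1}\<close>.\<close>

lemma sum_pinned_edges:
  assumes "v \<in> V - T" "T \<subseteq> V" "F \<subseteq> {e\<in>E. v \<in> e \<and> e \<inter> T \<noteq> {} \<and> \<not> e \<subseteq> insert v T}"
    and \<epsilon>: "\<forall>l\<in>{2..k-1}. real (Delta_l V E l) * lam ^ (k - l) \<le> \<epsilon>" "0 \<le> \<epsilon>"
  shows "(\<Sum>e\<in>F. lam ^ card (e - insert v T)) \<le> 2 ^ card T * \<epsilon>"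
proof -
  have fT: "finite T" using assms finite_V finite_subset by blast
  have fF: "finite F" using assms(3) finite_E by (auto intro: finite_subset)
  have "(\<Sum>e\<in>F. lam ^ card (e - insert v T))
      = (\<Sum>W\<in>Pow T. \<Sum>e\<in>{e\<in>F. e \<inter> T = W}. lam ^ card (e - insert v T))"
    using fF fT by (intro sum.group[symmetric]) auto
  also have "\<dots> \<le> (\<Sum>W\<in>Pow T. \<epsilon>)"
  proof (rule sum_mono)
    fix W assume W: "W \<in> Pow T"
    show "(\<Sum>e\<in>{e\<in>F. e \<inter> T = W}. lam ^ card (e - insert v T)) \<le> \<epsilon>"
    proof (cases "{e\<in>F. e \<inter> T = W} = {}")
      case True
      show ?thesis unfolding True using \<epsilon> by simp
    next
      case False
      have fW: "finite W" using W fT finite_subset by blast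
      have vW: "v \<notin> W" using W assms by auto
      have cd: "card (e - insert v T) = k - (card W + 1) \<and> e - insert v T \<noteq> {}" if e: "e \<in> F" "e \<inter> T = W" for e
      proof -
        have "e - insert v T = e - insert v W" "insert v W \<subseteq> e" using e assms(3) by auto
        then have "card (e - insert v T) = card e - card (insert v W)"
          using fW by (simp add: card_Diff_subset)
        moreover have "card e = k" using e assms(3) edge_card by auto
        ultimately show ?thesis using fW vW e assms(3) by auto
      qed
      from False obtain e where e: "e \<in> F" "e \<inter> T = W" by auto
      have "finite (e - insert v T)" using e assms(3) edge_finite by auto
      then have "0 < k - (card W + 1)" using cd[OF e] by (metis card_gt_0_iff)
      moreover have "W \<noteq> {}" using e assms(3) by auto
      then have "1 \<le> card W" using fW by (simp add: Suc_leI card_gt_0_iff)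
      ultimately have l: "card W + 1 \<in> {2..k-1}" by auto
      have "(\<Sum>e\<in>{e\<in>F. e \<inter> T = W}. lam ^ card (e - insert v T))
          = (\<Sum>e\<in>{e\<in>F. e \<inter> T = W}. lam ^ (k - (card W + 1)))"
        using cd by (intro sum.cong) auto
      also have "\<dots> = real (card {e\<in>F. e \<inter> T = W}) * lam ^ (k - (card W + 1))" by simp
      also have "\<dots> \<le> real (Delta_l V E (card W + 1)) * lam ^ (k - (card W + 1))"
      proof (intro mult_right_mono of_nat_mono)
        have "card {e\<in>F. e \<inter> T = W} \<le> hdeg E (insert v W)"
          unfolding hdeg_def using finite_E assms(3) by (intro card_mono) auto
        also have "\<dots> \<le> Delta_l V E (card W + 1)"
          using hdeg_le_Delta_l[of "insert v W"] W assms fW vW by auto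
        finally show "card {e\<in>F. e \<inter> T = W} \<le> Delta_l V E (card W + 1)" .
      qed (use lam_pos in auto)
      also have "\<dots> \<le> \<epsilon>" using \<epsilon> l by blast
      finally show ?thesis .
    qed
  qed
  also have "\<dots> = 2 ^ card T * \<epsilon>" using fT by (simp add: card_Pow)
  finally show ?thesis .
qed

text \<open>An obstructing \<open>f\<close> cannot lie inside \<open>insert v T\<close>, so it
  shares a nonempty set \<open>A\<close> with \<open>e - {v}\<close>; let \<open>W\<close> be the
  rest of \<open>f\<close>. If \<open>A\<close> is all of \<open>e - {v}\<close>, then
  \<open>e\<close> and \<open>f\<close> differ in one vertex and \<open>Gamma\<close> counts the
  possible \<open>A\<close>. Otherwise choose \<open>W\<close> inside \<open>insert v T\<close>,
  then \<open>f\<close> through \<open>W\<close>, then \<open>e\<close> through \<open>v\<close> and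
  \<open>f - W\<close>: at most \<open>Delta_l V E (card W) * Delta_l V E (k + 1 - card W)\<close>
  choices for each \<open>W\<close>.\<close>

lemma card_obstructed_edges:
  assumes "v \<in> V - T" "T \<subseteq> V" "D \<subseteq> E" "\<forall>f\<in>D. \<not> f \<subseteq> insert v T"
    and \<epsilon>: "\<forall>l\<in>{2..k-1}. real (Delta_l V E l) * real (Delta_l V E (k + 1 - l)) \<le> \<epsilon> * Dmax"
      "real (Gamma k V E) \<le> \<epsilon> * Dmax" "0 \<le> \<epsilon>"
  shows "real (card {e\<in>E. v \<in> e \<and> e \<inter> T = {} \<and> (\<exists>f\<in>D. f \<noteq> e \<and> f \<subseteq> T \<union> e)})
     \<le> (real (card T) + 2 ^ (card T + 1)) * \<epsilon> * Dmax"
proof -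
  let ?B = "{e\<in>E. v \<in> e \<and> e \<inter> T = {} \<and> (\<exists>f\<in>D. f \<noteq> e \<and> f \<subseteq> T \<union> e)}"
  let ?S = "\<lambda>w. {S. card S = k - 1 \<and> insert v S \<in> E \<and> insert w S \<in> E}"
  let ?W = "{W \<in> Pow (insert v T). card W \<in> {2..k-1}}"
  let ?f = "\<lambda>W. {f\<in>E. W \<subseteq> f \<and> v \<notin> f - W}"
  let ?X = "\<Union>w\<in>T. insert v ` ?S w"
  let ?Y = "\<Union>W\<in>?W. \<Union>f\<in>?f W. {e\<in>E. insert v (f - W) \<subseteq> e}"
  have fT: "finite T" using assms finite_V finite_subset by blast
  have fS: "finite (?S w)" for w
  proof (rule finite_subset)
    show "?S w \<subseteq> Pow V" using edge_subset by auto
  qed (use finite_V in auto)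
  have fW: "finite ?W" using fT by auto
  have sub: "?B \<subseteq> ?X \<union> ?Y"
  proof
    fix e assume "e \<in> ?B"
    then obtain f where e: "e \<in> E" "v \<in> e" "e \<inter> T = {}" and f: "f \<in> D" "f \<noteq> e" "f \<subseteq> T \<union> e" by auto
    have fE: "f \<in> E" using f assms by auto
    define A where "A = f \<inter> (e - {v})"
    define W where "W = f - A"
    have fin: "finite f" "finite e" "finite A" using edge_finite fE e unfolding A_def by auto
    have Wsub: "W \<subseteq> insert v T" using f unfolding W_def A_def by auto
    have "A \<noteq> {}" using f(1) assms(4) Wsub unfolding W_def by auto
    then have A1: "1 \<le> card A" using fin by (simp add: Suc_leI card_gt_0_iff)
    have cW: "card W = k - card A" unfolding W_def using fin fE edge_card
      by (subst card_Diff_subset) (auto simp: A_def)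
    have cev: "card (e - {v}) = k - 1" using e fin edge_card by simp
    have Ak: "card A \<le> k - 1" using card_mono[of "e - {v}" A] fin cev unfolding A_def by auto
    show "e \<in> ?X \<union> ?Y"
    proof (cases "card A = k - 1")
      case True
      then have Ae: "A = e - {v}" using card_subset_eq[of "e - {v}" A] fin cev unfolding A_def by auto
      have "card W = 1" using cW True k_ge_2 by simp
      then obtain w where w: "W = {w}" by (auto simp: card_1_singleton_iff)
      have fw: "f = insert w A" using w unfolding W_def A_def by auto
      have "w \<noteq> v" using fw Ae e f by auto
      then have "w \<in> T" using w Wsub by auto
      moreover have "e = insert v A" using Ae e by auto
      moreover have "A \<in> ?S w" using True fw fE e Ae by (auto simp: insert_absorb)
      ultimately show ?thesis by blast
    next
      case False
      then have "card W \<in> {2..k-1}" using cW A1 Ak by auto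
      then have "W \<in> ?W" using Wsub by auto
      \<comment> \<open>As \<open>A\<close> avoids \<open>v\<close>, the set \<open>f - W\<close>
        does too; this is why \<open>insert v (f - W)\<close> has \<open>k + 1 - card W\<close>
        elements in the count below.\<close>
      moreover have "f \<in> ?f W" using fE unfolding W_def A_def by auto
      moreover have "e \<in> {e\<in>E. insert v (f - W) \<subseteq> e}" using e unfolding W_def A_def by auto
      ultimately show ?thesis by blast
    qed
  qed
  have "card ?X \<le> (\<Sum>w\<in>T. card (insert v ` ?S w))" by (rule card_UN_le[OF fT])
  also have "\<dots> \<le> (\<Sum>w\<in>T. Gamma k V E)"
  proof (rule sum_mono)
    fix w assume w: "w \<in> T"
    have "card (insert v ` ?S w) \<le> card (?S w)" by (rule card_image_le[OF fS])
    also have "\<dots> \<le> Gamma k V E" using assms w by (intro codegree_le_Gamma) auto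
    finally show "card (insert v ` ?S w) \<le> Gamma k V E" .
  qed
  finally have "card ?X \<le> card T * Gamma k V E" by simp
  from of_nat_mono[OF this, where ?'a = real]
  have "real (card ?X) \<le> real (card T) * real (Gamma k V E)" by simp
  also have "\<dots> \<le> real (card T) * (\<epsilon> * Dmax)" using \<epsilon> by (intro mult_left_mono) auto
  finally have X: "real (card ?X) \<le> real (card T) * (\<epsilon> * Dmax)" .
  have "card ?Y \<le> (\<Sum>W\<in>?W. card (\<Union>f\<in>?f W. {e\<in>E. insert v (f - W) \<subseteq> e}))"
    by (rule card_UN_le[OF fW])
  from of_nat_mono[OF this, where ?'a = real]
  have "real (card ?Y) \<le> (\<Sum>W\<in>?W. real (card (\<Union>f\<in>?f W. {e\<in>E. insert v (f - W) \<subseteq> e})))"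
    by simp
  also have "\<dots> \<le> (\<Sum>W\<in>?W. \<epsilon> * Dmax)"
  proof (rule sum_mono)
    fix W assume W: "W \<in> ?W"
    then have WV: "W \<subseteq> V" using assms by auto
    then have finW: "finite W" using finite_V finite_subset by blast
    have "card (\<Union>f\<in>?f W. {e\<in>E. insert v (f - W) \<subseteq> e}) \<le> (\<Sum>f\<in>?f W. card {e\<in>E. insert v (f - W) \<subseteq> e})"
      using finite_E by (intro card_UN_le) auto
    also have "\<dots> \<le> (\<Sum>f\<in>?f W. Delta_l V E (k + 1 - card W))"
    proof (rule sum_mono)
      fix f assume f: "f \<in> ?f W"
      then have "card (f - W) = k - card W" using finW edge_card by (simp add: card_Diff_subset)
      moreover have "finite (f - W)" using f edge_finite by auto
      ultimately have "card (insert v (f - W)) = k + 1 - card W"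
        using f W k_ge_2 by auto
      moreover have "insert v (f - W) \<subseteq> V" using f edge_subset assms by auto
      ultimately show "card {e\<in>E. insert v (f - W) \<subseteq> e} \<le> Delta_l V E (k + 1 - card W)"
        using hdeg_le_Delta_l[of "insert v (f - W)"] by (simp add: hdeg_def)
    qed
    also have "\<dots> = card (?f W) * Delta_l V E (k + 1 - card W)" by simp
    also have "\<dots> \<le> Delta_l V E (card W) * Delta_l V E (k + 1 - card W)"
    proof (rule mult_right_mono)
      have "card (?f W) \<le> hdeg E W" unfolding hdeg_def using finite_E by (intro card_mono) auto
      also have "\<dots> \<le> Delta_l V E (card W)" by (rule hdeg_le_Delta_l[OF WV])
      finally show "card (?f W) \<le> Delta_l V E (card W)" .
    qed simp
    finally have "card (\<Union>f\<in>?f W. {e\<in>E. insert v (f - W) \<subseteq> e})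
        \<le> Delta_l V E (card W) * Delta_l V E (k + 1 - card W)" .
    from of_nat_mono[OF this, where ?'a = real]
    have "real (card (\<Union>f\<in>?f W. {e\<in>E. insert v (f - W) \<subseteq> e}))
        \<le> real (Delta_l V E (card W)) * real (Delta_l V E (k + 1 - card W))" by simp
    also have "\<dots> \<le> \<epsilon> * Dmax" using \<epsilon> W by auto
    finally show "real (card (\<Union>f\<in>?f W. {e\<in>E. insert v (f - W) \<subseteq> e})) \<le> \<epsilon> * Dmax" .
  qed
  also have "\<dots> = real (card ?W) * (\<epsilon> * Dmax)" by simp
  also have "\<dots> \<le> 2 ^ (card T + 1) * (\<epsilon> * Dmax)"
  proof (rule mult_right_mono)
    have "card ?W \<le> card (Pow (insert v T))" using fT by (intro card_mono) auto
    also have "\<dots> = 2 ^ (card T + 1)" using fT assms by (simp add: card_Pow)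
    finally have "card ?W \<le> 2 ^ (card T + 1)" .
    from of_nat_mono[OF this, where ?'a = real] show "real (card ?W) \<le> 2 ^ (card T + 1)" by simp
  qed (use \<epsilon> in auto)
  finally have Y: "real (card ?Y) \<le> 2 ^ (card T + 1) * (\<epsilon> * Dmax)" .
  have finXY: "finite (?X \<union> ?Y)" using fT fS fW finite_E by auto
  have "card ?B \<le> card ?X + card ?Y"
    using card_mono[OF finXY sub] card_Un_le[of ?X ?Y] by linarith
  then have "real (card ?B) \<le> real (card ?X) + real (card ?Y)" by linarith
  with X Y show ?thesis by (simp add: algebra_simps)
qed

end

subsection \<open>One step of the recursion\<close>

lemma neg_ln_one_minus_bounds:
  fixes x :: real
  assumes "0 \<le> x" "x \<le> 1/2"
  shows "x \<le> - ln (1 - x)" "- ln (1 - x) \<le> x + 2 * x\<^sup>2" "- ln (1 - x) \<le> 2 * x"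
proof -
  show "x \<le> - ln (1 - x)" using ln_one_minus_pos_upper_bound[of x] assms by simp
  show *: "- ln (1 - x) \<le> x + 2 * x\<^sup>2" using ln_one_minus_pos_lower_bound[of x] assms by simp
  have "2 * x * x \<le> 1 * x" using assms by (intro mult_right_mono) auto
  then show "- ln (1 - x) \<le> 2 * x" using * by (simp add: power2_eq_square)
qed

context penalty_hypergraph
begin

text \<open>Up to \<open>Dmax\<close> such terms are added, so each error has to be of order
  \<open>\<epsilon> / Dmax\<close>. Multiplying by \<open>Dmax\<close> turns \<open>P\<close> into
  \<open>a * Y * \<kappa>\<close> with \<open>a\<close> near \<open>C\<close> and
  \<open>\<kappa>\<close> near 1. In the quadratic error of the logarithm, one factor
  \<open>P\<close> absorbs \<open>Dmax\<close> and the other is at most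
  \<open>\<epsilon>\<close>.\<close>

lemma edge_term_estimate:
  assumes P: "P = lam ^ (k - 1) * (Y * \<kappa>)" and Y: "0 \<le> Y" "Y \<le> 1"
    and \<kappa>: "0 < \<kappa>" "1 - real (k - 1) * lam \<le> \<kappa>" "\<kappa> \<le> 1"
    and \<epsilon>: "lam \<le> \<epsilon>" "\<epsilon> \<le> 1/2" "\<bar>lam ^ (k - 1) * Dmax - C\<bar> \<le> \<epsilon>" and C: "0 \<le> C" and Dpos: "0 < Dmax"
  shows "\<bar>- ln (1 - z * P) - z / Dmax * (C * Y)\<bar> \<le> (1 + (real k + 2) * (C + 1)) * \<epsilon> / Dmax"
proof -
  define a where "a = lam ^ (k - 1) * Dmax"
  have a: "0 \<le> a" "a \<le> C + \<epsilon>" "C - \<epsilon> \<le> a" using \<epsilon> lam_pos unfolding a_def by auto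
  have PD: "P * Dmax = a * Y * \<kappa>" unfolding P a_def by simp
  have Yk: "0 \<le> Y * \<kappa>" "Y * \<kappa> \<le> 1" using Y \<kappa> by (auto simp: mult_le_one)
  have lam1: "lam ^ (k - 1) \<le> lam"
    using power_decreasing[of 1 "k - 1" lam] lam_pos \<epsilon> k_ge_2 by simp
  have "lam ^ (k - 1) * (Y * \<kappa>) \<le> lam ^ (k - 1) * 1" using Yk lam_pos by (intro mult_left_mono) auto
  then have P_le: "P \<le> \<epsilon>" using lam1 \<epsilon> unfolding P by simp
  have P0: "0 \<le> P" unfolding P using Yk lam_pos by simp
  have zP: "0 \<le> z * P" "z * P \<le> P" "z * P \<le> 1/2"
    using P0 P_le z_nonneg z_le_1 \<epsilon> mult_right_mono[of z 1 P] by auto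
  define g where "g = - ln (1 - z * P)"
  have g: "z * P \<le> g" "g \<le> z * P + 2 * (z * P)\<^sup>2"
    unfolding g_def using neg_ln_one_minus_bounds[of "z * P"] zP by auto
  have C\<epsilon>: "C + \<epsilon> \<le> C + 1" using \<epsilon> by simp
  have \<epsilon>0: "0 \<le> \<epsilon>" using \<epsilon> lam_pos by simp
  have aY: "a * Y \<le> C + 1" using mult_mono[of a "C + 1" Y 1] a C\<epsilon> Y C by simp
  have aY0: "0 \<le> a * Y" using a Y by simp
  have up1: "a * Y * \<kappa> \<le> C * Y + \<epsilon>"
  proof -
    have "a * Y * \<kappa> \<le> a * Y * 1" using aY0 \<kappa> by (intro mult_left_mono) auto
    also have "\<dots> \<le> (C + \<epsilon>) * Y" using a Y by (simp add: mult_right_mono)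
    also have "\<dots> \<le> C * Y + \<epsilon>" using Y \<epsilon>0 mult_left_mono[of Y 1 \<epsilon>] by (simp add: algebra_simps)
    finally show ?thesis .
  qed
  have lo1: "C * Y - \<epsilon> - real k * (C + 1) * \<epsilon> \<le> a * Y * \<kappa>"
  proof -
    have k1: "real (k - 1) * lam \<le> real k * \<epsilon>"
      using \<epsilon> lam_pos by (intro mult_mono) auto
    have "a * Y * (1 - real k * \<epsilon>) \<le> a * Y * \<kappa>" using aY0 \<kappa> k1 by (intro mult_left_mono) auto
    moreover have "a * Y * (real k * \<epsilon>) \<le> (C + 1) * (real k * \<epsilon>)"
      using aY \<epsilon>0 by (intro mult_right_mono) auto
    moreover have "(C - \<epsilon>) * Y \<le> a * Y" using a Y by (intro mult_right_mono) auto
    moreover have "\<epsilon> * Y \<le> \<epsilon>" using Y \<epsilon>0 mult_left_mono[of Y 1 \<epsilon>] by simp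
    ultimately show ?thesis by (simp add: algebra_simps)
  qed
  have sq: "(z * P)\<^sup>2 * Dmax \<le> (C + 1) * \<epsilon>"
  proof -
    have "(z * P)\<^sup>2 * Dmax \<le> P\<^sup>2 * Dmax" using zP Dpos by (intro mult_right_mono power_mono) auto
    also have "\<dots> = P * (a * Y * \<kappa>)" using PD by (simp add: power2_eq_square algebra_simps)
    also have "\<dots> \<le> \<epsilon> * (C + 1)"
    proof (rule mult_mono)
      have "a * Y * \<kappa> \<le> a * Y * 1" using aY0 \<kappa> by (intro mult_left_mono) auto
      then show "a * Y * \<kappa> \<le> C + 1" using aY by simp
    qed (use P_le \<epsilon>0 aY0 \<kappa> in auto)
    finally show ?thesis by (simp add: mult.commute)
  qed
  have gD: "z * (a * Y * \<kappa>) \<le> g * Dmax" "g * Dmax \<le> z * (a * Y * \<kappa>) + 2 * ((C + 1) * \<epsilon>)"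
  proof -
    have "z * P * Dmax \<le> g * Dmax" using g Dpos by simp
    then show "z * (a * Y * \<kappa>) \<le> g * Dmax" using PD by (simp add: mult.assoc)
    have "g * Dmax \<le> (z * P + 2 * (z * P)\<^sup>2) * Dmax" using g Dpos by simp
    also have "\<dots> = z * (a * Y * \<kappa>) + 2 * ((z * P)\<^sup>2 * Dmax)" unfolding PD[symmetric] by (simp add: algebra_simps)
    finally show "g * Dmax \<le> z * (a * Y * \<kappa>) + 2 * ((C + 1) * \<epsilon>)" using sq by simp
  qed
  have zup: "z * (a * Y * \<kappa>) \<le> z * (C * Y) + \<epsilon>"
    using mult_left_mono[OF up1 z_nonneg] mult_right_mono[OF z_le_1 \<epsilon>0] by (simp add: algebra_simps)
  have zlo: "z * (C * Y) - (\<epsilon> + real k * (C + 1) * \<epsilon>) \<le> z * (a * Y * \<kappa>)"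
  proof -
    have "z * (\<epsilon> + real k * (C + 1) * \<epsilon>) \<le> 1 * (\<epsilon> + real k * (C + 1) * \<epsilon>)"
      using z_le_1 \<epsilon>0 C by (intro mult_right_mono) auto
    moreover have "z * (C * Y - \<epsilon> - real k * (C + 1) * \<epsilon>) \<le> z * (a * Y * \<kappa>)"
      using mult_left_mono[OF lo1 z_nonneg] .
    ultimately show ?thesis by (simp add: algebra_simps)
  qed
  have nn: "0 \<le> C * \<epsilon>" "0 \<le> real k * (C + 1) * \<epsilon>" using C \<epsilon>0 by auto
  have "\<bar>g * Dmax - z * (C * Y)\<bar> \<le> (1 + (real k + 2) * (C + 1)) * \<epsilon>"
    using gD zup zlo nn \<epsilon>0 by (simp add: abs_le_iff algebra_simps)
  moreover have "\<bar>g - z / Dmax * (C * Y)\<bar> = \<bar>g * Dmax - z * (C * Y)\<bar> / Dmax"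
  proof -
    have "g - z / Dmax * (C * Y) = (g * Dmax - z * (C * Y)) / Dmax" using Dpos by (simp add: field_simps)
    then show ?thesis by simp
  qed
  ultimately show ?thesis unfolding g_def[symmetric] using Dpos by (simp add: divide_right_mono)
qed

text \<open>The predicate \<open>Q\<close> transports an a priori bound from one recursion level to the next. The edges at \<open>v\<close> whose
  contribution is replaced by that of \<open>s\<close> are those that are missing from \<open>D\<close>, meet \<open>T\<close>, or together
  with \<open>T\<close> contain a further edge of \<open>D\<close>.\<close>

lemma suppr_estimate:
  assumes nt: "near_tree k V E lam c \<epsilon>" and \<epsilon>: "\<epsilon> \<le> 1/2" and c: "0 \<le> c"
    and T: "T \<subseteq> V" "card T \<le> \<tau>" and v: "v \<in> V - T" and D: "D \<subseteq> E"
    and M: "card ({g\<in>E. g \<inter> T = {}} - D) \<le> M" and free: "\<forall>f\<in>D. \<not> f \<subseteq> insert v T"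
    and Q: "\<And>T' D' u. \<lbrakk>T' \<subseteq> V; card T' \<le> card T + k; D' \<subseteq> E; card ({g\<in>E. g \<inter> T' = {}} - D') \<le> M;
              u \<in> V - T'; \<forall>f\<in>D'. \<not> f \<subseteq> insert u T'\<rbrakk> \<Longrightarrow> Q u (suppr T' D' u)"
    and s: "\<And>u. u \<in> V \<Longrightarrow> Q u (s u) \<and> 0 \<le> s u"
  shows "\<exists>\<sigma>. (\<forall>e\<in>E. \<forall>u\<in>e - {v}. Q u (\<sigma> e u) \<and> 0 \<le> \<sigma> e u) \<and>
     \<bar>suppr T D v - z / Dmax * (\<Sum>e\<in>{e\<in>E. v \<in> e}. c ^ (k - 1) * exp (- (\<Sum>u\<in>e - {v}. \<sigma> e u)))\<bar>
       \<le> est_const k (c ^ (k - 1)) \<tau> M * \<epsilon>"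
proof -
  define C where "C = c ^ (k - 1)"
  have C0: "0 \<le> C" unfolding C_def using c by simp
  have nt1: "lam \<le> \<epsilon>" "\<bar>lam ^ (k - 1) * Dmax - C\<bar> \<le> \<epsilon>"
    and nt2: "\<forall>l\<in>{2..k-1}. real (Delta_l V E l) * lam ^ (k - l) \<le> \<epsilon>"
    and nt3: "\<forall>l\<in>{2..k-1}. real (Delta_l V E l) * real (Delta_l V E (k + 1 - l)) \<le> \<epsilon> * Dmax"
    and nt4: "real (Delta_l V E 2) \<le> \<epsilon> * Dmax" "real (Gamma k V E) \<le> \<epsilon> * Dmax" "1 \<le> \<epsilon> * Dmax"
    using nt unfolding near_tree_def C_def by auto
  have \<epsilon>0: "0 < \<epsilon>" using nt1 lam_pos by simp
  have Dpos: "0 < Dmax" using nt4(3) \<epsilon>0 by (smt (verit) zero_less_mult_pos)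
  have fT: "finite T" using T finite_V finite_subset by blast
  have lamD: "lam ^ (k - 1) \<le> (C + 1) / Dmax"
    using nt1 \<epsilon> Dpos by (simp add: field_simps abs_le_iff)
  define T' where "T' = insert v T"
  define D0 where "D0 = {f\<in>D. v \<notin> f}"
  define F where "F = {f\<in>D. v \<in> f}"
  have fF: "finite F" "F \<subseteq> E" "D0 \<subseteq> E" "D0 \<inter> F = {}" "D0 \<union> F = D"
    using D finite_subE unfolding F_def D0_def by auto
  define P where "P = (\<lambda>e De. lam ^ card (e - T') * Z (T' \<union> e) De / Z T' De)"
  define g where "g = (\<lambda>e De. - ln (1 - z * P e De))"
  have "\<exists>De. (\<forall>e\<in>F. D0 \<subseteq> De e \<and> De e \<subseteq> (D0 \<union> F) - {e}) \<and>
      ln (Z T' D0) - ln (Z T' (D0 \<union> F)) = (\<Sum>e\<in>F. g e (De e))"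
    unfolding P_def g_def by (rule ln_Z_add_edges) (use fF free in \<open>auto simp: T'_def\<close>)
  then obtain De where De: "\<forall>e\<in>F. D0 \<subseteq> De e \<and> De e \<subseteq> D - {e}"
    and eq: "ln (Z T' D0) - ln (Z T' D) = (\<Sum>e\<in>F. g e (De e))"
    unfolding fF(5) by blast
  have sup_eq: "suppr T D v = (\<Sum>e\<in>F. g e (De e))"
    using eq unfolding suppr_def T'_def D0_def by simp
  \<comment> \<open>Crude bounds for every edge at \<open>v\<close>, needed for the edges outside
    \<open>G\<close>. Pinned vertices of \<open>e\<close> cost nothing, so only
    \<open>e - T'\<close> enters the exponent.\<close>
  have Pb: "0 \<le> P e (De e)" "P e (De e) \<le> lam ^ card (e - T')" "P e (De e) \<le> lam" if e: "e \<in> F" for e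
  proof -
    have "De e \<subseteq> D" using De e by blast
    then have sub: "De e \<subseteq> E" "\<forall>f\<in>De e. \<not> f \<subseteq> T'" using D free unfolding T'_def by blast+
    have z1: "1 \<le> Z T' (De e)" by (rule Z_ge_1[OF sub])
    have z2: "Z (T' \<union> e) (De e) \<le> Z T' (De e)" by (rule Z_pin_le[OF sub(1)])
    have z3: "0 \<le> Z (T' \<union> e) (De e)" unfolding Z_def using lam_pos z_le_1 by (intro sum_nonneg) auto
    show "0 \<le> P e (De e)" unfolding P_def using z1 z3 lam_pos by simp
    have "lam ^ card (e - T') * (Z (T' \<union> e) (De e) / Z T' (De e)) \<le> lam ^ card (e - T') * 1"
      using z1 z2 lam_pos by (intro mult_left_mono) auto
    then show *: "P e (De e) \<le> lam ^ card (e - T')" unfolding P_def by simp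
    have "e - T' \<noteq> {}" using e free unfolding F_def T'_def by auto
    moreover have "finite (e - T')" using e fF edge_finite by auto
    ultimately have "1 \<le> card (e - T')" by (simp add: Suc_leI card_gt_0_iff)
    then have "lam ^ card (e - T') \<le> lam ^ 1" using lam_pos nt1 \<epsilon> by (intro power_decreasing) auto
    then show "P e (De e) \<le> lam" using * by simp
  qed
  have gb: "0 \<le> g e (De e)" "g e (De e) \<le> 2 * lam ^ card (e - T')" if e: "e \<in> F" for e
  proof -
    have zP: "0 \<le> z * P e (De e)" "z * P e (De e) \<le> P e (De e)"
      using Pb[OF e] z_nonneg z_le_1 mult_right_mono[of z 1 "P e (De e)"] by auto
    have "z * P e (De e) \<le> 1/2" using zP Pb[OF e] nt1 \<epsilon> by simp
    from neg_ln_one_minus_bounds[OF zP(1) this] zP Pb[OF e]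
    show "0 \<le> g e (De e)" "g e (De e) \<le> 2 * lam ^ card (e - T')" unfolding g_def by auto
  qed
  define Ev where "Ev = {e\<in>E. v \<in> e}"
  define B where "B = {e\<in>E. v \<in> e \<and> e \<inter> T = {} \<and> (\<exists>f\<in>D. f \<noteq> e \<and> f \<subseteq> T \<union> e)}"
  \<comment> \<open>For these edges no edge of \<open>De e\<close> lies inside the pinned set even
    after all of \<open>e\<close> is pinned, so \<open>Z_pin_set\<close> applies.\<close>
  define G where "G = {e\<in>F. e \<inter> T = {} \<and> \<not> (\<exists>f\<in>D. f \<noteq> e \<and> f \<subseteq> T \<union> e)}"
  have fin: "finite Ev" "finite B" "finite G" using finite_E fF unfolding Ev_def B_def G_def by auto
  have GF: "G \<subseteq> F" "G \<subseteq> Ev" using fF unfolding G_def Ev_def F_def by auto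
  have cardEv: "real (card Ev) \<le> Dmax" using degree_le_max_deg v unfolding Ev_def by auto
  have cardB: "real (card B) \<le> (real \<tau> + 2 ^ (\<tau> + 1)) * \<epsilon> * Dmax"
  proof -
    have "real (card B) \<le> (real (card T) + 2 ^ (card T + 1)) * \<epsilon> * Dmax"
      unfolding B_def by (rule card_obstructed_edges[OF v T(1) D free nt3 nt4(2)]) (use \<epsilon>0 in simp)
    also have "\<dots> \<le> (real \<tau> + 2 ^ (\<tau> + 1)) * \<epsilon> * Dmax"
      using T(2) \<epsilon>0 Dpos by (intro mult_right_mono add_mono power_increasing) auto
    finally show ?thesis .
  qed
  have "\<forall>e\<in>G. \<exists>\<sigma> \<kappa>. (\<forall>u\<in>e - {v}. Q u (\<sigma> u) \<and> 0 \<le> \<sigma> u) \<and> 0 < \<kappa> \<and> 1 - real (k - 1) * lam \<le> \<kappa> \<and> \<kappa> \<le> 1 \<and>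
      P e (De e) = lam ^ (k - 1) * (exp (- (\<Sum>u\<in>e - {v}. \<sigma> u)) * \<kappa>)"
  proof
    fix e assume e: "e \<in> G"
    have eF: "e \<in> F" "e \<in> E" "v \<in> e" "e \<inter> T = {}" and good: "\<And>f. f \<in> D \<Longrightarrow> f \<noteq> e \<Longrightarrow> \<not> f \<subseteq> T \<union> e"
      using e fF unfolding G_def F_def by auto
    have eV: "e \<subseteq> V" "finite e" using edge_subset edge_finite eF by auto
    have De': "D0 \<subseteq> De e" "De e \<subseteq> D" "e \<notin> De e" using De eF by auto
    have free': "\<not> f \<subseteq> T \<union> e" if "f \<in> De e" for f using good De' that by blast
    have card_ev: "card (e - {v}) = k - 1" using eF eV edge_card by simp
    have "\<exists>\<sigma> \<kappa>. (\<forall>u\<in>e - {v}. Q u (\<sigma> u) \<and> 0 \<le> \<sigma> u) \<and> 0 < \<kappa> \<and> 1 - real (card (e - {v})) * lam \<le> \<kappa> \<and> \<kappa> \<le> 1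
        \<and> Z (T' \<union> (e - {v})) (De e) / Z T' (De e) = exp (- (\<Sum>u\<in>e - {v}. \<sigma> u)) * \<kappa>"
    proof (rule Z_pin_set)
      show "finite (e - {v})" using eV by simp
      show "e - {v} \<subseteq> V - T'" using eV eF unfolding T'_def by auto
      show "De e \<subseteq> E" using De' D by auto
      show "\<forall>f\<in>De e. \<not> f \<subseteq> T' \<union> (e - {v})" using free' eF unfolding T'_def by auto
      fix u A assume u: "u \<in> e - {v}" and A: "A \<subseteq> e - {v} - {u}"
      show "Q u (suppr (T' \<union> A) (De e) u)"
      proof (rule Q)
        show "T' \<union> A \<subseteq> V" using T v A eV unfolding T'_def by auto
        show "De e \<subseteq> E" using De' D by auto
        show "u \<in> V - (T' \<union> A)" using u A eV eF unfolding T'_def by auto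
        have fA: "finite A" using A eV finite_subset by blast
        have "card A \<le> card (e - {v} - {u})" using A eV by (intro card_mono) auto
        also have "\<dots> \<le> k - 1" using card_ev eV u by simp
        finally have "card A \<le> k - 1" .
        moreover have "card (T' \<union> A) \<le> card T' + card A" by (rule card_Un_le)
        moreover have "card T' = card T + 1" unfolding T'_def using v fT by simp
        ultimately show "card (T' \<union> A) \<le> card T + k" using k_ge_2 by linarith
        \<comment> \<open>The count \<open>M\<close> is not increased: \<open>De e\<close> keeps
          every edge of \<open>D\<close> avoiding \<open>v\<close>, and the edges through
          \<open>v\<close> meet the new pinned set.\<close>
        have "{g \<in> E. g \<inter> (T' \<union> A) = {}} - De e \<subseteq> {g\<in>E. g \<inter> T = {}} - D"
          using De' unfolding T'_def D0_def by auto
        then have "card ({g \<in> E. g \<inter> (T' \<union> A) = {}} - De e) \<le> card ({g\<in>E. g \<inter> T = {}} - D)"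
          using finite_E by (intro card_mono) auto
        then show "card ({g \<in> E. g \<inter> (T' \<union> A) = {}} - De e) \<le> M" using M by simp
        have "insert u (T' \<union> A) \<subseteq> T \<union> e" using u A eF unfolding T'_def by auto
        then show "\<forall>f\<in>De e. \<not> f \<subseteq> insert u (T' \<union> A)" using free' by blast
      qed
    qed
    moreover have "T' \<union> (e - {v}) = T' \<union> e" "e - T' = e - {v}" using eF unfolding T'_def by auto
    ultimately show "\<exists>\<sigma> \<kappa>. (\<forall>u\<in>e - {v}. Q u (\<sigma> u) \<and> 0 \<le> \<sigma> u) \<and> 0 < \<kappa> \<and> 1 - real (k - 1) * lam \<le> \<kappa> \<and> \<kappa> \<le> 1 \<and>
      P e (De e) = lam ^ (k - 1) * (exp (- (\<Sum>u\<in>e - {v}. \<sigma> u)) * \<kappa>)"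
      unfolding P_def using card_ev by (metis times_divide_eq_right)
  qed
  then obtain \<sigma> \<kappa> where \<sigma>: "\<forall>e\<in>G. (\<forall>u\<in>e - {v}. Q u (\<sigma> e u) \<and> 0 \<le> \<sigma> e u) \<and> 0 < \<kappa> e \<and> 1 - real (k - 1) * lam \<le> \<kappa> e \<and>
      \<kappa> e \<le> 1 \<and> P e (De e) = lam ^ (k - 1) * (exp (- (\<Sum>u\<in>e - {v}. \<sigma> e u)) * \<kappa> e)"
    by metis
  \<comment> \<open>Outside \<open>G\<close> nothing is known about the exponents, but few edges are
    concerned; any nonnegative values satisfying \<open>Q\<close> will do, and \<open>s\<close>
    supplies them.\<close>
  define \<sigma>' where "\<sigma>' = (\<lambda>e. if e \<in> G then \<sigma> e else s)"
  have \<sigma>'Q: "\<forall>e\<in>E. \<forall>u\<in>e - {v}. Q u (\<sigma>' e u) \<and> 0 \<le> \<sigma>' e u"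
  proof (intro ballI)
    fix e u assume "e \<in> E" "u \<in> e - {v}"
    then show "Q u (\<sigma>' e u) \<and> 0 \<le> \<sigma>' e u"
      using \<sigma> s[of u] edge_subset[of e] unfolding \<sigma>'_def by auto
  qed
  define Y where "Y = (\<lambda>e. exp (- (\<Sum>u\<in>e - {v}. \<sigma>' e u)))"
  have Y: "0 \<le> Y e" "Y e \<le> 1" if "e \<in> Ev" for e
  proof -
    have "0 \<le> (\<Sum>u\<in>e - {v}. \<sigma>' e u)" using \<sigma>'Q that unfolding Ev_def by (intro sum_nonneg) auto
    then show "0 \<le> Y e" "Y e \<le> 1" unfolding Y_def by auto
  qed
  define h where "h = (\<lambda>e. z / Dmax * (C * Y e))"
  have h: "0 \<le> h e" "h e \<le> C / Dmax" if "e \<in> Ev" for e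
  proof -
    show "0 \<le> h e" unfolding h_def using Y[OF that] z_nonneg Dpos C0 by simp
    have "z * (C * Y e) \<le> 1 * (C * 1)" using Y[OF that] z_nonneg z_le_1 C0 by (intro mult_mono) auto
    then show "h e \<le> C / Dmax" unfolding h_def using Dpos by (simp add: divide_right_mono)
  qed
  have S1: "\<bar>\<Sum>e\<in>G. g e (De e) - h e\<bar> \<le> (1 + (real k + 2) * (C + 1)) * \<epsilon>"
  proof -
    have "\<bar>\<Sum>e\<in>G. g e (De e) - h e\<bar> \<le> (\<Sum>e\<in>G. \<bar>g e (De e) - h e\<bar>)" by (rule sum_abs)
    also have "\<dots> \<le> (\<Sum>e\<in>G. (1 + (real k + 2) * (C + 1)) * \<epsilon> / Dmax)"
    proof (rule sum_mono)
      fix e assume e: "e \<in> G"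
      have "P e (De e) = lam ^ (k - 1) * (Y e * \<kappa> e)" "0 < \<kappa> e" "1 - real (k - 1) * lam \<le> \<kappa> e" "\<kappa> e \<le> 1"
        using \<sigma> e unfolding Y_def \<sigma>'_def by auto
      from edge_term_estimate[OF this(1) _ _ this(2-4) nt1(1) \<epsilon> nt1(2) C0 Dpos] Y[of e] e GF
      show "\<bar>g e (De e) - h e\<bar> \<le> (1 + (real k + 2) * (C + 1)) * \<epsilon> / Dmax"
        unfolding g_def h_def by auto
    qed
    also have "\<dots> = real (card G) * ((1 + (real k + 2) * (C + 1)) * \<epsilon> / Dmax)" by simp
    also have "\<dots> \<le> Dmax * ((1 + (real k + 2) * (C + 1)) * \<epsilon> / Dmax)"
    proof (rule mult_right_mono)
      have "card G \<le> card Ev" using GF fin by (intro card_mono) auto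
      then show "real (card G) \<le> Dmax" using cardEv by simp
    qed (use C0 \<epsilon>0 Dpos in auto)
    also have "\<dots> = (1 + (real k + 2) * (C + 1)) * \<epsilon>" using Dpos by simp
    finally show ?thesis .
  qed
  have S2: "0 \<le> (\<Sum>e\<in>F - G. g e (De e))"
    "(\<Sum>e\<in>F - G. g e (De e)) \<le> 2 * 2 ^ \<tau> * \<epsilon> + 2 * (C + 1) * (real \<tau> + 2 ^ (\<tau> + 1)) * \<epsilon>"
  proof -
    show "0 \<le> (\<Sum>e\<in>F - G. g e (De e))" using gb by (intro sum_nonneg) auto
    \<comment> \<open>The edges outside \<open>G\<close> are negligible for two reasons: those
      meeting \<open>T\<close> have small total weight, while the obstructed ones have the full
      weight \<open>lam ^ (k - 1)\<close>, of order \<open>1 / Dmax\<close>, but are few.\<close>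
    define F1 where "F1 = {e\<in>F. e \<inter> T \<noteq> {}}"
    have F1F: "F1 \<subseteq> F" "finite F1" using fF unfolding F1_def by auto
    have FG: "F - G \<subseteq> F1 \<union> (B \<inter> F)" using fF unfolding F1_def G_def B_def F_def by auto
    have "(\<Sum>e\<in>F - G. g e (De e)) \<le> (\<Sum>e\<in>F1 \<union> (B \<inter> F). g e (De e))"
      using FG F1F fF gb fin by (intro sum_mono2) auto
    also have "\<dots> = (\<Sum>e\<in>F1. g e (De e)) + (\<Sum>e\<in>B \<inter> F. g e (De e))"
      using F1F fin by (intro sum.union_disjoint) (auto simp: F1_def B_def)
    also have "(\<Sum>e\<in>F1. g e (De e)) \<le> 2 * 2 ^ \<tau> * \<epsilon>"
    proof -
      have "(\<Sum>e\<in>F1. g e (De e)) \<le> (\<Sum>e\<in>F1. 2 * lam ^ card (e - T'))"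
        using gb F1F by (intro sum_mono) auto
      also have "\<dots> = 2 * (\<Sum>e\<in>F1. lam ^ card (e - insert v T))" by (simp add: sum_distrib_left T'_def)
      also have "\<dots> \<le> 2 * (2 ^ card T * \<epsilon>)"
      proof (intro mult_left_mono sum_pinned_edges[OF v T(1) _ nt2])
        show "F1 \<subseteq> {e \<in> E. v \<in> e \<and> e \<inter> T \<noteq> {} \<and> \<not> e \<subseteq> insert v T}"
          using free fF unfolding F1_def F_def by auto
      qed (use \<epsilon>0 in auto)
      also have "\<dots> \<le> 2 * (2 ^ \<tau> * \<epsilon>)"
        using T(2) \<epsilon>0 by (intro mult_left_mono mult_right_mono power_increasing) auto
      finally show ?thesis by simp
    qed
    also have "(\<Sum>e\<in>B \<inter> F. g e (De e)) \<le> 2 * (C + 1) * (real \<tau> + 2 ^ (\<tau> + 1)) * \<epsilon>"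
    proof -
      have "(\<Sum>e\<in>B \<inter> F. g e (De e)) \<le> (\<Sum>e\<in>B \<inter> F. 2 * ((C + 1) / Dmax))"
      proof (rule sum_mono)
        fix e assume e: "e \<in> B \<inter> F"
        then have "e - T' = e - {v}" "e \<in> E" "v \<in> e" unfolding B_def T'_def by auto
        then have "card (e - T') = k - 1" using edge_card edge_finite by simp
        then have "g e (De e) \<le> 2 * lam ^ (k - 1)" using gb[of e] e by auto
        also have "\<dots> \<le> 2 * ((C + 1) / Dmax)" using lamD by (rule mult_left_mono) simp
        finally show "g e (De e) \<le> 2 * ((C + 1) / Dmax)" .
      qed
      also have "\<dots> = real (card (B \<inter> F)) * (2 * ((C + 1) / Dmax))" by simp
      also have "\<dots> \<le> real (card B) * (2 * ((C + 1) / Dmax))"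
        using fin C0 Dpos by (intro mult_right_mono of_nat_mono card_mono) auto
      also have "\<dots> \<le> ((real \<tau> + 2 ^ (\<tau> + 1)) * \<epsilon> * Dmax) * (2 * ((C + 1) / Dmax))"
        using cardB C0 Dpos by (intro mult_right_mono) auto
      also have "\<dots> = 2 * (C + 1) * (real \<tau> + 2 ^ (\<tau> + 1)) * \<epsilon>" using Dpos by simp
      finally show ?thesis .
    qed
    finally show "(\<Sum>e\<in>F - G. g e (De e)) \<le> 2 * 2 ^ \<tau> * \<epsilon> + 2 * (C + 1) * (real \<tau> + 2 ^ (\<tau> + 1)) * \<epsilon>"
      by simp
  qed
  have S3: "0 \<le> (\<Sum>e\<in>Ev - G. h e)"
    "(\<Sum>e\<in>Ev - G. h e) \<le> C * (real M + real \<tau> + (real \<tau> + 2 ^ (\<tau> + 1))) * \<epsilon>"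
  proof -
    show "0 \<le> (\<Sum>e\<in>Ev - G. h e)" using h by (intro sum_nonneg) auto
    define E1 where "E1 = {e\<in>E. v \<in> e \<and> e \<inter> T \<noteq> {}}"
    define E2 where "E2 = {g\<in>E. g \<inter> T = {}} - D"
    have "Ev - G \<subseteq> (E1 \<union> B) \<union> E2" unfolding Ev_def G_def F_def E1_def E2_def B_def by auto
    then have "card (Ev - G) \<le> card ((E1 \<union> B) \<union> E2)"
      using finite_E fin unfolding E1_def E2_def by (intro card_mono) auto
    also have "\<dots> \<le> card (E1 \<union> B) + card E2" by (rule card_Un_le)
    also have "\<dots> \<le> card E1 + card B + card E2" using card_Un_le[of E1 B] by simp
    finally have "real (card (Ev - G)) \<le> real (card E1) + real (card B) + real (card E2)" by linarith
    moreover have "real (card E1) \<le> real \<tau> * (\<epsilon> * Dmax)"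
    proof -
      have "card E1 \<le> card T * Delta_l V E 2" unfolding E1_def by (rule card_edges_meeting[OF v T(1)])
      from of_nat_mono[OF this, where ?'a = real]
      have "real (card E1) \<le> real (card T) * real (Delta_l V E 2)" by simp
      also have "\<dots> \<le> real \<tau> * (\<epsilon> * Dmax)" using T(2) nt4 by (intro mult_mono) auto
      finally show ?thesis .
    qed
    moreover have "real (card E2) \<le> real M * (\<epsilon> * Dmax)"
      using M mult_left_mono[OF nt4(3), of "real M"] unfolding E2_def by simp
    ultimately have card3: "real (card (Ev - G)) \<le> (real M + real \<tau> + (real \<tau> + 2 ^ (\<tau> + 1))) * \<epsilon> * Dmax"
      using cardB by (simp add: algebra_simps)
    have "(\<Sum>e\<in>Ev - G. h e) \<le> (\<Sum>e\<in>Ev - G. C / Dmax)" using h by (intro sum_mono) auto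
    also have "\<dots> = real (card (Ev - G)) * (C / Dmax)" by simp
    also have "\<dots> \<le> ((real M + real \<tau> + (real \<tau> + 2 ^ (\<tau> + 1))) * \<epsilon> * Dmax) * (C / Dmax)"
      using card3 C0 Dpos by (intro mult_right_mono) auto
    also have "\<dots> = C * (real M + real \<tau> + (real \<tau> + 2 ^ (\<tau> + 1))) * \<epsilon>" using Dpos by simp
    finally show "(\<Sum>e\<in>Ev - G. h e) \<le> C * (real M + real \<tau> + (real \<tau> + 2 ^ (\<tau> + 1))) * \<epsilon>" .
  qed
  have "(\<Sum>e\<in>F. g e (De e)) = (\<Sum>e\<in>G. g e (De e)) + (\<Sum>e\<in>F - G. g e (De e))"
    using GF fF by (metis add.commute sum.subset_diff)
  moreover have "(\<Sum>e\<in>Ev. h e) = (\<Sum>e\<in>G. h e) + (\<Sum>e\<in>Ev - G. h e)"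
    using GF fin by (metis add.commute sum.subset_diff)
  ultimately have split: "suppr T D v - (\<Sum>e\<in>Ev. h e)
      = (\<Sum>e\<in>G. g e (De e) - h e) + (\<Sum>e\<in>F - G. g e (De e)) - (\<Sum>e\<in>Ev - G. h e)"
    unfolding sup_eq by (simp add: sum_subtractf)
  have "\<bar>suppr T D v - (\<Sum>e\<in>Ev. h e)\<bar> \<le> est_const k C \<tau> M * \<epsilon>"
  proof -
    have "est_const k C \<tau> M * \<epsilon> = (1 + (real k + 2) * (C + 1)) * \<epsilon>
        + (2 * 2 ^ \<tau> * \<epsilon> + 2 * (C + 1) * (real \<tau> + 2 ^ (\<tau> + 1)) * \<epsilon>)
        + C * (real M + real \<tau> + (real \<tau> + 2 ^ (\<tau> + 1))) * \<epsilon>"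
      unfolding est_const_def by (simp only: distrib_right add.assoc)
    moreover have "\<bar>x + y - w\<bar> \<le> r1 + r2 + r3"
      if "\<bar>x\<bar> \<le> r1" "0 \<le> y" "y \<le> r2" "0 \<le> w" "w \<le> r3" for x y w r1 r2 r3 :: real
      using that by linarith
    ultimately show "\<bar>suppr T D v - (\<Sum>e\<in>Ev. h e)\<bar> \<le> est_const k C \<tau> M * \<epsilon>"
      unfolding split using S1 S2 S3 by presburger
  qed
  moreover have "(\<Sum>e\<in>Ev. h e) = z / Dmax * (\<Sum>e\<in>Ev. C * Y e)"
    unfolding h_def by (simp add: sum_distrib_left)
  ultimately show ?thesis
    using \<sigma>'Q unfolding Y_def Ev_def C_def by (intro exI[of _ \<sigma>']) auto
qed

end

subsection \<open>Contraction\<close>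

lemma mult_exp_neg_le: "x * exp (- x) \<le> 1 / exp (1::real)"
proof -
  have "x \<le> exp (x - 1)" using exp_ge_add_one_self[of "x - 1"] by simp
  then have "x * exp (-x) \<le> exp (x - 1) * exp (-x)" by (intro mult_right_mono) auto
  also have "\<dots> = 1 / exp 1" by (simp add: exp_diff exp_minus divide_simps)
  finally show ?thesis .
qed

lemma abs_ln_diff_le:
  fixes m a b :: real
  assumes "0 \<le> m" "0 \<le> a" "0 \<le> b"
  shows "\<bar>ln (1 + m * a) - ln (1 + m * b)\<bar> \<le> m * \<bar>a - b\<bar>"
proof -
  have *: "ln (1 + m * a) - ln (1 + m * b) \<le> m * (a - b)" if "0 \<le> a" "0 \<le> b" "b \<le> a" for a b
  proof -
    have p: "1 \<le> 1 + m * b" "1 \<le> 1 + m * a" using assms(1) that by auto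
    have "ln (1 + m * a) - ln (1 + m * b) \<le> ((1 + m * a) - (1 + m * b)) / (1 + m * b)"
      using p by (intro ln_diff_le) auto
    also have "\<dots> \<le> (m * (a - b)) / 1" using p assms(1) that by (intro frac_le) (auto simp: right_diff_distrib mult_left_mono)
    finally show ?thesis by simp
  qed
  have mono: "b \<le> a \<Longrightarrow> 0 \<le> b \<Longrightarrow> ln (1 + m * b) \<le> ln (1 + m * a)" for a b
    using assms(1) by (intro ln_mono) (auto simp: mult_left_mono add_pos_nonneg)
  show ?thesis
    using *[of a b] *[of b a] mono[of a b] mono[of b a] assms by (cases "b \<le> a") auto
qed

text \<open>Return from the logarithmic coordinate: on \<open>[0, A]\<close> the derivative
  \<open>m / (1 + m x)\<close> is at least \<open>1 / (1 + m A)\<close>, because \<open>m\<close> is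
  at least 1.\<close>

lemma abs_diff_le_ln:
  fixes m a b A :: real
  assumes "1 \<le> m" "0 \<le> a" "0 \<le> b" "a \<le> A" "b \<le> A"
  shows "\<bar>a - b\<bar> \<le> (1 + m * A) * \<bar>ln (1 + m * a) - ln (1 + m * b)\<bar>"
proof -
  have *: "a - b \<le> (1 + m * A) * (ln (1 + m * a) - ln (1 + m * b))" if "0 \<le> b" "b \<le> a" "a \<le> A" for a b
  proof -
    have p: "1 \<le> 1 + m * b" "1 \<le> 1 + m * a" using assms(1) that by auto
    have "m * b \<le> m * a" using that assms(1) by (intro mult_left_mono) auto
    then have l0: "0 \<le> ln (1 + m * a) - ln (1 + m * b)" using p by simp
    have "ln (1 + m * b) - ln (1 + m * a) \<le> ((1 + m * b) - (1 + m * a)) / (1 + m * a)"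
      using p by (intro ln_diff_le) auto
    then have "m * (a - b) / (1 + m * a) \<le> ln (1 + m * a) - ln (1 + m * b)"
      by (simp add: diff_divide_distrib algebra_simps)
    then have "m * (a - b) \<le> (1 + m * a) * (ln (1 + m * a) - ln (1 + m * b))"
      using p by (simp add: divide_le_eq mult.commute)
    also have "\<dots> \<le> (1 + m * A) * (ln (1 + m * a) - ln (1 + m * b))"
      using l0 assms(1) that by (intro mult_right_mono) auto
    finally have "m * (a - b) \<le> (1 + m * A) * (ln (1 + m * a) - ln (1 + m * b))" .
    moreover have "1 * (a - b) \<le> m * (a - b)" using assms(1) that by (intro mult_right_mono) auto
    ultimately show ?thesis by simp
  qed
  have A0: "0 \<le> 1 + m * A" using assms by auto
  show ?thesis
  proof (cases "b \<le> a")
    case True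
    have "(1 + m * A) * (ln (1 + m * a) - ln (1 + m * b)) \<le> (1 + m * A) * \<bar>ln (1 + m * a) - ln (1 + m * b)\<bar>"
      using A0 by (intro mult_left_mono) auto
    then show ?thesis using *[of b a] True assms by simp
  next
    case False
    have "(1 + m * A) * (ln (1 + m * b) - ln (1 + m * a)) \<le> (1 + m * A) * \<bar>ln (1 + m * a) - ln (1 + m * b)\<bar>"
      using A0 by (intro mult_left_mono) auto
    then show ?thesis using *[of a b] False assms by simp
  qed
qed

text \<open>The value at \<open>x = B\<close> of \<open>(x + B / e) / (1 + x)\<close>. That quotient
  increases in \<open>x\<close>, and stays below 1, exactly when \<open>B < e\<close>.\<close>

definition ctr :: "real \<Rightarrow> real" where "ctr B = (B + B / exp 1) / (B + 1)"

lemma ctr_bounds: "0 < B \<Longrightarrow> 0 < ctr B" "0 < B \<Longrightarrow> B < exp 1 \<Longrightarrow> ctr B < 1"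
  by (auto simp: ctr_def add_pos_pos)

text \<open>In the coordinate \<open>ln (1 + m s)\<close> the derivative of the recursion picks up from each term
  \<open>exp (- S)\<close>, \<open>S = \<Sum>s\<close>, the factor \<open>m (1 + S)\<close>, and \<open>S exp (- S) \<le> 1 / e\<close>. This is where the
  threshold \<open>e\<close> enters.\<close>

lemma sum_exp_contraction:
  fixes m :: nat and a b :: "'b \<Rightarrow> 'c \<Rightarrow> real"
  assumes I: "finite I" "\<And>i. i \<in> I \<Longrightarrow> finite (U i) \<and> card (U i) = m" and m: "1 \<le> m"
    and ab: "\<And>i u. i \<in> I \<Longrightarrow> u \<in> U i \<Longrightarrow> 0 \<le> a i u \<and> 0 \<le> b i u"
    and w: "0 \<le> w" "w * real (card I) * real m \<le> B" and B: "0 < B" "B < exp 1"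
    and \<eta>: "\<And>i u. i \<in> I \<Longrightarrow> u \<in> U i \<Longrightarrow> \<bar>ln (1 + real m * a i u) - ln (1 + real m * b i u)\<bar> \<le> \<eta>" "0 \<le> \<eta>"
  shows "\<bar>ln (1 + real m * (w * (\<Sum>i\<in>I. exp (- (\<Sum>u\<in>U i. a i u)))))
      - ln (1 + real m * (w * (\<Sum>i\<in>I. exp (- (\<Sum>u\<in>U i. b i u)))))\<bar> \<le> ctr B * \<eta>"
proof -
  have m0: "0 < real m" using m by simp
  define p where "p = (\<lambda>i u. ln (1 + real m * a i u))"
  define d where "d = (\<lambda>i u. ln (1 + real m * b i u) - p i u)"
  \<comment> \<open>Linear interpolation in the coordinate \<open>ln (1 + m s)\<close>, running from
    \<open>a\<close> at \<open>t = 0\<close> to \<open>b\<close> at \<open>t = 1\<close>.\<close>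
  define y where "y = (\<lambda>t i u. (exp (p i u + t * d i u) - 1) / real m)"
  define Y where "Y = (\<lambda>t i. exp (- (\<Sum>u\<in>U i. y t i u)))"
  define Y' where "Y' = (\<lambda>t i. Y t i * - (\<Sum>u\<in>U i. exp (p i u + t * d i u) * d i u / real m))"
  define X where "X = (\<lambda>t. w * (\<Sum>i\<in>I. Y t i))"
  define X' where "X' = (\<lambda>t. w * (\<Sum>i\<in>I. Y' t i))"
  define f where "f = (\<lambda>t. ln (1 + real m * X t))"
  have X0: "0 \<le> X t" for t unfolding X_def Y_def using w by (intro mult_nonneg_nonneg sum_nonneg) auto
  have dX: "(X has_real_derivative X' t) (at t)" for t
    unfolding X_def X'_def Y'_def Y_def y_def
    using m by (auto intro!: derivative_eq_intros sum.cong simp: sum_divide_distrib)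
  have df: "(f has_real_derivative (real m * X' t / (1 + real m * X t))) (at t)" for t
  proof -
    have "0 < 1 + real m * X t" using X0[of t] by (simp add: add_pos_nonneg)
    then show ?thesis unfolding f_def by (auto intro!: derivative_eq_intros dX simp: field_simps)
  qed
  have "\<exists>t>0. t < 1 \<and> f 1 - f 0 = (1 - 0) * (real m * X' t / (1 + real m * X t))"
    by (rule MVT2) (use df in auto)
  then obtain t where t: "0 < t" "t < 1" and ft: "f 1 - f 0 = real m * X' t / (1 + real m * X t)" by auto
  have p0: "0 \<le> p i u" "0 \<le> p i u + d i u" if "i \<in> I" "u \<in> U i" for i u
    using ab[OF that] unfolding p_def d_def by auto
  have y0: "0 \<le> y t i u" if "i \<in> I" "u \<in> U i" for i u
  proof -
    have "p i u + t * d i u = (1 - t) * p i u + t * (p i u + d i u)" by (simp add: algebra_simps)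
    also have "\<dots> \<ge> 0" using mult_nonneg_nonneg[OF _ p0(1)[OF that], of "1 - t"] mult_nonneg_nonneg[OF _ p0(2)[OF that], of t] t by linarith
    finally show ?thesis unfolding y_def by simp
  qed
  have Y01: "0 \<le> Y t i" "Y t i \<le> 1" if "i \<in> I" for i
    unfolding Y_def using y0[OF that] by (auto simp: sum_nonneg)
  have Y'_le: "\<bar>real m * Y' t i\<bar> \<le> \<eta> * (real m * Y t i + real m / exp 1)" if i: "i \<in> I" for i
  proof -
    have "\<bar>\<Sum>u\<in>U i. exp (p i u + t * d i u) * d i u / real m\<bar> \<le> (\<Sum>u\<in>U i. \<bar>exp (p i u + t * d i u) * d i u / real m\<bar>)"
      by (rule sum_abs)
    also have "\<dots> \<le> (\<Sum>u\<in>U i. (1 + real m * y t i u) * \<eta> / real m)"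
    proof (rule sum_mono)
      fix u assume u: "u \<in> U i"
      have "exp (p i u + t * d i u) = 1 + real m * y t i u" unfolding y_def using m0 by simp
      moreover have "\<bar>d i u\<bar> \<le> \<eta>" using \<eta>(1)[OF i u] unfolding d_def p_def by (simp add: abs_minus_commute)
      moreover have "0 \<le> 1 + real m * y t i u" using y0[OF i u] by simp
      ultimately show "\<bar>exp (p i u + t * d i u) * d i u / real m\<bar> \<le> (1 + real m * y t i u) * \<eta> / real m"
        by (simp add: abs_mult divide_right_mono mult_left_mono)
    qed
    also have "\<dots> = \<eta> * (\<Sum>u\<in>U i. 1 / real m + y t i u)"
      unfolding sum_distrib_left using m0 by (intro sum.cong) (auto simp: field_simps)
    \<comment> \<open>The scale \<open>m\<close> in the coordinate equals the number of exponents,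
      which makes the constant here exactly 1.\<close>
    also have "(\<Sum>u\<in>U i. 1 / real m + y t i u) = 1 + (\<Sum>u\<in>U i. y t i u)"
      using I(2)[OF i] m0 by (simp add: sum.distrib)
    finally have *: "\<bar>\<Sum>u\<in>U i. exp (p i u + t * d i u) * d i u / real m\<bar> \<le> \<eta> * (1 + (\<Sum>u\<in>U i. y t i u))" .
    have "\<bar>Y' t i\<bar> = Y t i * \<bar>\<Sum>u\<in>U i. exp (p i u + t * d i u) * d i u / real m\<bar>"
      unfolding Y'_def using Y01[OF i] by (simp add: abs_mult)
    also have "\<dots> \<le> Y t i * (\<eta> * (1 + (\<Sum>u\<in>U i. y t i u)))" using * Y01[OF i] by (intro mult_left_mono) auto
    also have "\<dots> = \<eta> * (Y t i + (\<Sum>u\<in>U i. y t i u) * Y t i)" by (simp add: algebra_simps)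
    also have "\<dots> \<le> \<eta> * (Y t i + 1 / exp 1)"
      using mult_exp_neg_le[of "\<Sum>u\<in>U i. y t i u"] \<eta>(2) unfolding Y_def by (intro mult_left_mono add_mono) auto
    finally have "real m * \<bar>Y' t i\<bar> \<le> real m * (\<eta> * (Y t i + 1 / exp 1))" using m0 by simp
    then show ?thesis by (simp add: abs_mult algebra_simps)
  qed
  have "\<bar>real m * X' t\<bar> = w * \<bar>\<Sum>i\<in>I. real m * Y' t i\<bar>"
    unfolding X'_def using w by (simp add: abs_mult sum_distrib_left[symmetric])
  also have "\<dots> \<le> w * (\<Sum>i\<in>I. \<eta> * (real m * Y t i + real m / exp 1))"
  proof (rule mult_left_mono[OF _ w(1)])
    have "\<bar>\<Sum>i\<in>I. real m * Y' t i\<bar> \<le> (\<Sum>i\<in>I. \<bar>real m * Y' t i\<bar>)" by (rule sum_abs)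
    also have "\<dots> \<le> (\<Sum>i\<in>I. \<eta> * (real m * Y t i + real m / exp 1))" by (rule sum_mono) (rule Y'_le)
    finally show "\<bar>\<Sum>i\<in>I. real m * Y' t i\<bar> \<le> (\<Sum>i\<in>I. \<eta> * (real m * Y t i + real m / exp 1))" .
  qed
  also have "\<dots> = \<eta> * (real m * X t + w * real (card I) * real m / exp 1)"
    unfolding X_def by (simp add: sum_distrib_left[symmetric] sum.distrib algebra_simps)
  also have "\<dots> \<le> \<eta> * (real m * X t + B / exp 1)"
    using w(2) \<eta>(2) by (intro mult_left_mono add_mono divide_right_mono) auto
  finally have mX': "\<bar>real m * X' t\<bar> \<le> \<eta> * (real m * X t + B / exp 1)" .
  have mX: "real m * X t \<le> B"
  proof -
    have "(\<Sum>i\<in>I. Y t i) \<le> real (card I)" using sum_mono[of I "Y t" "\<lambda>_. 1"] Y01 by simp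
    then have "real m * X t \<le> real m * (w * real (card I))" unfolding X_def using w m0 by (intro mult_left_mono) auto
    then show ?thesis using w(2) by (simp add: mult_ac)
  qed
  have X0': "0 \<le> real m * X t" using X0[of t] by simp
  have frac: "(real m * X t + B / exp 1) / (1 + real m * X t) \<le> ctr B"
  proof -
    have r: "B / exp 1 < 1" using B by simp
    have "0 \<le> (1 - B / exp 1) * (B - real m * X t)" using r mX by simp
    moreover have "(x + r) * (B + 1) \<le> (B + r) * (1 + x)" if "0 \<le> (1 - r) * (B - x)" for x r :: real
      using that by (simp add: algebra_simps)
    ultimately have *: "(real m * X t + B / exp 1) * (B + 1) \<le> (B + B / exp 1) * (1 + real m * X t)" by blast
    have "0 < B + 1" "0 < 1 + real m * X t" using B X0' by auto
    then have "(real m * X t + B / exp 1) / (1 + real m * X t) \<le> (B + B / exp 1) / (B + 1)"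
      using * by (simp only: pos_divide_le_eq times_divide_eq_left pos_le_divide_eq)
    then show ?thesis unfolding ctr_def .
  qed
  have "\<bar>f 1 - f 0\<bar> = \<bar>real m * X' t\<bar> / (1 + real m * X t)" unfolding ft using X0' by (simp add: abs_mult)
  also have "\<dots> \<le> \<eta> * (real m * X t + B / exp 1) / (1 + real m * X t)"
    using mX' X0' by (intro divide_right_mono) auto
  also have "\<dots> \<le> \<eta> * ctr B" using mult_left_mono[OF frac \<eta>(2)] by simp
  finally have fin: "\<bar>f 1 - f 0\<bar> \<le> ctr B * \<eta>" by (simp add: mult.commute)
  have ya: "y 0 i u = a i u" "y 1 i u = b i u" if "i \<in> I" "u \<in> U i" for i u
    using ab[OF that] m0 unfolding y_def d_def p_def by (auto simp: add_pos_nonneg)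
  have "Y 0 i = exp (- (\<Sum>u\<in>U i. a i u))" "Y 1 i = exp (- (\<Sum>u\<in>U i. b i u))" if "i \<in> I" for i
    unfolding Y_def using ya[OF that] by (auto intro!: arg_cong[of _ _ exp] sum.cong)
  then have "f 0 = ln (1 + real m * (w * (\<Sum>i\<in>I. exp (- (\<Sum>u\<in>U i. a i u)))))"
    "f 1 = ln (1 + real m * (w * (\<Sum>i\<in>I. exp (- (\<Sum>u\<in>U i. b i u)))))"
    unfolding f_def X_def by simp_all
  then show ?thesis using fin by (simp add: abs_minus_commute)
qed

text \<open>The fixed point equation of \<open>Fmap\<close> under
  \<open>x v = c * exp (- s v)\<close>; a product over the other \<open>k - 1\<close> vertices of an
  edge yields \<open>c ^ (k - 1)\<close>. Unlike \<open>ln (c / x v)\<close>, it makes sense at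
  \<open>c = 0\<close>, so the curve of fixed points can start there.\<close>

definition log_fixpoint :: "'a set \<Rightarrow> 'a set set \<Rightarrow> nat \<Rightarrow> real \<Rightarrow> real \<Rightarrow> ('a \<Rightarrow> real) \<Rightarrow> bool" where
  "log_fixpoint V E k c z s \<longleftrightarrow> (\<forall>v\<in>V. s v = z / real (max_deg V E) *
      (\<Sum>e\<in>{e\<in>E. v \<in> e}. c ^ (k - 1) * exp (- (\<Sum>u\<in>e - {v}. s u))))"

context penalty_hypergraph
begin

lemma recursion_bounds:
  assumes "v \<in> V" "0 \<le> C" "\<forall>e\<in>{e\<in>E. v \<in> e}. \<forall>u\<in>e - {v}. 0 \<le> \<sigma> e u"
  shows "0 \<le> z / Dmax * (\<Sum>e\<in>{e\<in>E. v \<in> e}. C * exp (- (\<Sum>u\<in>e - {v}. \<sigma> e u)))"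
    and "z / Dmax * (\<Sum>e\<in>{e\<in>E. v \<in> e}. C * exp (- (\<Sum>u\<in>e - {v}. \<sigma> e u))) \<le> z * C"
proof -
  show "0 \<le> z / Dmax * (\<Sum>e\<in>{e\<in>E. v \<in> e}. C * exp (- (\<Sum>u\<in>e - {v}. \<sigma> e u)))"
    using assms z_nonneg by (intro mult_nonneg_nonneg sum_nonneg) auto
  have "(\<Sum>e\<in>{e\<in>E. v \<in> e}. C * exp (- (\<Sum>u\<in>e - {v}. \<sigma> e u))) \<le> (\<Sum>e\<in>{e\<in>E. v \<in> e}. C * 1)"
  proof (intro sum_mono mult_left_mono)
    fix e assume "e \<in> {e\<in>E. v \<in> e}"
    then have "0 \<le> (\<Sum>u\<in>e - {v}. \<sigma> e u)" using assms(3) by (intro sum_nonneg) auto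
    then show "exp (- (\<Sum>u\<in>e - {v}. \<sigma> e u)) \<le> 1" by simp
  qed (use assms in auto)
  also have "\<dots> = real (card {e\<in>E. v \<in> e}) * C" by simp
  also have "\<dots> \<le> Dmax * C" using degree_le_max_deg[OF assms(1)] assms(2) by (intro mult_right_mono) auto
  finally have "z / Dmax * (\<Sum>e\<in>{e\<in>E. v \<in> e}. C * exp (- (\<Sum>u\<in>e - {v}. \<sigma> e u))) \<le> z / Dmax * (Dmax * C)"
    using z_nonneg by (intro mult_left_mono) auto
  also have "\<dots> \<le> z * C" using z_nonneg assms by simp
  finally show "z / Dmax * (\<Sum>e\<in>{e\<in>E. v \<in> e}. C * exp (- (\<Sum>u\<in>e - {v}. \<sigma> e u))) \<le> z * C" .
qed

text \<open>\<open>sum_exp_contraction\<close> with the edges at \<open>v\<close> as index set and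
  weight \<open>z * C / Dmax\<close>; the degree bound makes the total weight at most
  \<open>z * C\<close>. The exponents depend on the edge as well as on the vertex, because each edge
  is revealed in its own conditioned model.\<close>

lemma recursion_contraction:
  assumes "v \<in> V" "0 \<le> C" "z * (real k - 1) * C \<le> B" "0 < B" "B < exp 1" "0 \<le> \<eta>"
    and ab: "\<And>e u. e \<in> E \<Longrightarrow> u \<in> e - {v} \<Longrightarrow> 0 \<le> a e u \<and> 0 \<le> b e u"
    and \<eta>: "\<And>e u. e \<in> E \<Longrightarrow> u \<in> e - {v} \<Longrightarrow>
        \<bar>ln (1 + (real k - 1) * a e u) - ln (1 + (real k - 1) * b e u)\<bar> \<le> \<eta>"
  shows "\<bar>ln (1 + (real k - 1) * (z / Dmax * (\<Sum>e\<in>{e\<in>E. v \<in> e}. C * exp (- (\<Sum>u\<in>e - {v}. a e u)))))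
     - ln (1 + (real k - 1) * (z / Dmax * (\<Sum>e\<in>{e\<in>E. v \<in> e}. C * exp (- (\<Sum>u\<in>e - {v}. b e u)))))\<bar> \<le> ctr B * \<eta>"
proof -
  have k1: "real (k - 1) = real k - 1" using k_ge_2 by simp
  have "\<bar>ln (1 + real (k - 1) * ((z * C / Dmax) * (\<Sum>e\<in>{e\<in>E. v \<in> e}. exp (- (\<Sum>u\<in>e - {v}. a e u)))))
     - ln (1 + real (k - 1) * ((z * C / Dmax) * (\<Sum>e\<in>{e\<in>E. v \<in> e}. exp (- (\<Sum>u\<in>e - {v}. b e u)))))\<bar> \<le> ctr B * \<eta>"
  proof (rule sum_exp_contraction)
    show "finite {e\<in>E. v \<in> e}" using finite_E by simp
    show "finite (e - {v}) \<and> card (e - {v}) = k - 1" if "e \<in> {e\<in>E. v \<in> e}" for e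
      using that edge_finite edge_card by simp
    show "1 \<le> k - 1" using k_ge_2 by simp
    show "0 \<le> z * C / Dmax" using z_nonneg assms by simp
    have "z * C / Dmax * real (card {e\<in>E. v \<in> e}) \<le> z * C / Dmax * Dmax"
      using degree_le_max_deg[OF assms(1)] assms(2) z_nonneg by (intro mult_left_mono) auto
    also have "\<dots> \<le> z * C" using z_nonneg assms by simp
    finally have "z * C / Dmax * real (card {e\<in>E. v \<in> e}) * real (k - 1) \<le> z * C * real (k - 1)"
      by (intro mult_right_mono) auto
    then show "z * C / Dmax * real (card {e\<in>E. v \<in> e}) * real (k - 1) \<le> B"
      using assms(3) unfolding k1 by (simp add: mult_ac)
  qed (use assms k1 in auto)
  then show ?thesis unfolding k1 by (simp add: sum_distrib_left[symmetric] mult_ac)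
qed

lemma log_fixpoint_bounds:
  assumes "log_fixpoint V E k c z s" "0 \<le> c" "v \<in> V"
  shows "0 \<le> s v" "s v \<le> z * c ^ (k - 1)"
proof -
  have *: "0 \<le> s u" if "u \<in> V" for u
  proof -
    have "s u = z / Dmax * (\<Sum>e\<in>{e\<in>E. u \<in> e}. c ^ (k - 1) * exp (- (\<Sum>w\<in>e - {u}. s w)))"
      using assms(1) that unfolding log_fixpoint_def by auto
    also have "\<dots> \<ge> 0" using assms(2) z_nonneg by (intro mult_nonneg_nonneg sum_nonneg) auto
    finally show ?thesis .
  qed
  show "0 \<le> s v" using * assms by auto
  have "s v = z / Dmax * (\<Sum>e\<in>{e\<in>E. v \<in> e}. c ^ (k - 1) * exp (- (\<Sum>u\<in>e - {v}. s u)))"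
    using assms unfolding log_fixpoint_def by auto
  also have "\<dots> \<le> z * c ^ (k - 1)"
    using recursion_bounds(2)[of v "c ^ (k - 1)" "\<lambda>_. s"] assms * edge_subset by fastforce
  finally show "s v \<le> z * c ^ (k - 1)" .
qed

text \<open>Each level pins at most \<open>k\<close> further vertices, whence the budget
  \<open>card T + k * L\<close>. In the logarithmic coordinate a level turns an error
  \<open>\<eta>\<close> into \<open>ctr B * \<eta> + (real k - 1) * K\<close>; the additive part of
  the bound is the fixed point of this map.\<close>

lemma suppr_depth_estimate:
  assumes nt: "near_tree k V E lam c \<epsilon>" and \<epsilon>: "\<epsilon> \<le> 1/2" and c: "0 \<le> c"
    and fp: "log_fixpoint V E k c z s"
    and B: "z * (real k - 1) * c ^ (k - 1) \<le> B" "0 < B" "B < exp 1"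
    and K: "est_const k (c ^ (k - 1)) \<tau> M * \<epsilon> \<le> K" "K \<le> 1"
    and T: "T \<subseteq> V" "card T + k * L \<le> \<tau>" and D: "D \<subseteq> E" "card ({g\<in>E. g \<inter> T = {}} - D) \<le> M"
    and v: "v \<in> V - T" and free: "\<forall>f\<in>D. \<not> f \<subseteq> insert v T"
  shows "\<bar>ln (1 + (real k - 1) * suppr T D v) - ln (1 + (real k - 1) * s v)\<bar>
      \<le> ctr B ^ L * ln (1 + (real k - 1) * (c ^ (k - 1) + 1)) + (real k - 1) * K / (1 - ctr B)"
    and "suppr T D v \<le> c ^ (k - 1) + 1"
proof -
  define C where "C = c ^ (k - 1)"
  have C0: "0 \<le> C" unfolding C_def using c by simp
  have k1: "1 \<le> real k - 1" using k_ge_2 by simp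
  have th: "0 < ctr B" "ctr B < 1" using ctr_bounds B by auto
  have zC: "z * C \<le> C" using z_le_1 C0 mult_right_mono[of z 1 C] by simp
  have s0: "0 \<le> s u" "s u \<le> C" if "u \<in> V" for u
    using log_fixpoint_bounds[OF fp c that] zC unfolding C_def by auto
  have \<epsilon>0: "0 < \<epsilon>" using nt lam_pos unfolding near_tree_def by auto
  have "0 \<le> est_const k C \<tau> M" unfolding est_const_def using C0 by (intro add_nonneg_nonneg mult_nonneg_nonneg) auto
  then have K0: "0 \<le> K" using K \<epsilon>0 unfolding C_def by (smt (verit) mult_nonneg_nonneg)
  \<comment> \<open>The estimate with the trivial predicate: nonnegative exponents alone bound
    \<open>suppr\<close> by \<open>z * C + K\<close>. This starts the induction, at depth 0.\<close>
  have bound: "0 \<le> suppr T D v \<and> suppr T D v \<le> C + 1"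
    if T: "T \<subseteq> V" "card T \<le> \<tau>" and D: "D \<subseteq> E" "card ({g\<in>E. g \<inter> T = {}} - D) \<le> M"
    and v: "v \<in> V - T" and free: "\<forall>f\<in>D. \<not> f \<subseteq> insert v T" for T D v
  proof -
    obtain \<sigma> where \<sigma>: "\<forall>e\<in>E. \<forall>u\<in>e - {v}. 0 \<le> \<sigma> e u"
      and est: "\<bar>suppr T D v - z / Dmax * (\<Sum>e\<in>{e\<in>E. v \<in> e}. c ^ (k - 1) * exp (- (\<Sum>u\<in>e - {v}. \<sigma> e u)))\<bar>
       \<le> est_const k (c ^ (k - 1)) \<tau> M * \<epsilon>"
      using suppr_estimate[OF nt \<epsilon> c T v D free, where Q = "\<lambda>_ _. True" and s = s] s0 by blast
    have "z / Dmax * (\<Sum>e\<in>{e\<in>E. v \<in> e}. c ^ (k - 1) * exp (- (\<Sum>u\<in>e - {v}. \<sigma> e u))) \<le> z * c ^ (k - 1)"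
      by (rule recursion_bounds(2)) (use v C0 \<sigma> C_def in auto)
    then show ?thesis using est K zC suppr_nonneg[OF D(1) free] unfolding C_def by auto
  qed
  show "suppr T D v \<le> c ^ (k - 1) + 1" using bound[OF T(1) _ D v free] T(2) unfolding C_def by auto
  define R where "R = (real k - 1) * K / (1 - ctr B)"
  have R0: "0 \<le> R" unfolding R_def using k1 K0 th by simp
  define h0 where "h0 = ln (1 + (real k - 1) * (C + 1))"
  have h0: "0 \<le> h0" unfolding h0_def using k1 C0 by simp
  from T D v free
  have "\<bar>ln (1 + (real k - 1) * suppr T D v) - ln (1 + (real k - 1) * s v)\<bar> \<le> ctr B ^ L * h0 + R"
  proof (induction L arbitrary: T D v)
    case 0
    have b: "0 \<le> suppr T D v" "suppr T D v \<le> C + 1" using bound[OF 0(1) _ 0(3-6)] 0(2) by auto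
    have l: "0 \<le> ln (1 + (real k - 1) * x) \<and> ln (1 + (real k - 1) * x) \<le> h0" if "0 \<le> x" "x \<le> C + 1" for x
    proof -
      have "(real k - 1) * x \<le> (real k - 1) * (C + 1)" "0 \<le> (real k - 1) * x"
        using that k1 by (auto intro: mult_left_mono)
      then show ?thesis unfolding h0_def by auto
    qed
    have "s v \<le> C + 1" "0 \<le> s v" using s0[of v] 0 by auto
    then show ?case using l[OF b] l[of "s v"] R0 by auto
  next
    case (Suc L)
    define \<eta> where "\<eta> = ctr B ^ L * h0 + R"
    have \<eta>0: "0 \<le> \<eta>" unfolding \<eta>_def using th h0 R0 by (intro add_nonneg_nonneg mult_nonneg_nonneg) auto
    define Q where "Q = (\<lambda>u x. \<bar>ln (1 + (real k - 1) * x) - ln (1 + (real k - 1) * s u)\<bar> \<le> \<eta>)"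
    have cT: "card T \<le> \<tau>" using Suc.prems(2) by simp
    have "\<exists>\<sigma>. (\<forall>e\<in>E. \<forall>u\<in>e - {v}. Q u (\<sigma> e u) \<and> 0 \<le> \<sigma> e u) \<and>
     \<bar>suppr T D v - z / Dmax * (\<Sum>e\<in>{e\<in>E. v \<in> e}. c ^ (k - 1) * exp (- (\<Sum>u\<in>e - {v}. \<sigma> e u)))\<bar>
       \<le> est_const k (c ^ (k - 1)) \<tau> M * \<epsilon>"
    proof (rule suppr_estimate[OF nt \<epsilon> c Suc.prems(1) cT Suc.prems(5) Suc.prems(3,4,6)])
      fix T' D' u
      assume *: "T' \<subseteq> V" "card T' \<le> card T + k" "D' \<subseteq> E" "card ({g \<in> E. g \<inter> T' = {}} - D') \<le> M"
          "u \<in> V - T'" "\<forall>f\<in>D'. \<not> f \<subseteq> insert u T'"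
      show "Q u (suppr T' D' u)" unfolding Q_def \<eta>_def
        by (rule Suc.IH) (use * Suc.prems(2) in auto)
    next
      show "Q u (s u) \<and> 0 \<le> s u" if "u \<in> V" for u using s0[OF that] \<eta>0 unfolding Q_def by auto
    qed
    then obtain \<sigma> where \<sigma>: "\<forall>e\<in>E. \<forall>u\<in>e - {v}. Q u (\<sigma> e u) \<and> 0 \<le> \<sigma> e u"
      and est: "\<bar>suppr T D v - z / Dmax * (\<Sum>e\<in>{e\<in>E. v \<in> e}. c ^ (k - 1) * exp (- (\<Sum>u\<in>e - {v}. \<sigma> e u)))\<bar>
       \<le> est_const k (c ^ (k - 1)) \<tau> M * \<epsilon>" by blast
    define m where "m = z / Dmax * (\<Sum>e\<in>{e\<in>E. v \<in> e}. c ^ (k - 1) * exp (- (\<Sum>u\<in>e - {v}. \<sigma> e u)))"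
    have m0: "0 \<le> m" unfolding m_def by (rule recursion_bounds(1)) (use Suc.prems C0 \<sigma> C_def in auto)
    have vV: "v \<in> V" using Suc.prems by simp
    have sv: "s v = z / Dmax * (\<Sum>e\<in>{e\<in>E. v \<in> e}. c ^ (k - 1) * exp (- (\<Sum>u\<in>e - {v}. s u)))"
      using fp vV unfolding log_fixpoint_def by auto
    have "\<bar>ln (1 + (real k - 1) * m) - ln (1 + (real k - 1) * s v)\<bar> \<le> ctr B * \<eta>"
      unfolding sv m_def
    proof (rule recursion_contraction[OF vV _ _ B(2,3) \<eta>0])
      show "0 \<le> \<sigma> e u \<and> 0 \<le> s u" if "e \<in> E" "u \<in> e - {v}" for e u
        using \<sigma> that s0[of u] edge_subset by blast
      show "\<bar>ln (1 + (real k - 1) * \<sigma> e u) - ln (1 + (real k - 1) * s u)\<bar> \<le> \<eta>" if "e \<in> E" "u \<in> e - {v}" for e u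
        using \<sigma> that unfolding Q_def by blast
    qed (use B C0 C_def in auto)
    moreover have "\<bar>ln (1 + (real k - 1) * suppr T D v) - ln (1 + (real k - 1) * m)\<bar> \<le> (real k - 1) * K"
    proof -
      have "\<bar>ln (1 + (real k - 1) * suppr T D v) - ln (1 + (real k - 1) * m)\<bar> \<le> (real k - 1) * \<bar>suppr T D v - m\<bar>"
        using k1 m0 suppr_nonneg[OF Suc.prems(3,6)] by (intro abs_ln_diff_le) auto
      also have "\<dots> \<le> (real k - 1) * K" using est K k1 unfolding m_def by (intro mult_left_mono) auto
      finally show ?thesis .
    qed
    moreover have "ctr B * \<eta> + (real k - 1) * K = ctr B ^ Suc L * h0 + R"
    proof -
      have "(real k - 1) * K = R * (1 - ctr B)" unfolding R_def using th by simp
      then show ?thesis unfolding \<eta>_def by (simp add: algebra_simps)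
    qed
    ultimately show ?case by linarith
  qed
  then show "\<bar>ln (1 + (real k - 1) * suppr T D v) - ln (1 + (real k - 1) * s v)\<bar>
      \<le> ctr B ^ L * ln (1 + (real k - 1) * (c ^ (k - 1) + 1)) + (real k - 1) * K / (1 - ctr B)"
    unfolding h0_def R_def C_def .
qed

end

text \<open>The depth \<open>L\<close> is chosen from \<open>\<delta>\<close> first; it determines
  the number \<open>\<tau>\<close> of pins to allow for, hence \<open>est_const\<close> and finally
  \<open>\<epsilon>\<close>. The result depends on \<open>c\<close> and \<open>z\<close> only
  through the bounds \<open>C\<^sub>0\<close> and \<open>B\<close>, where \<open>C\<^sub>0\<close>
  is written between the hypotheses as the cap on \<open>c ^ (k - 1)\<close>.\<close>

lemma suppr_close:
  fixes \<tau>\<^sub>0 M :: nat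
  assumes k: "2 \<le> k" and B: "0 < B" "B < exp 1" and C0: "0 \<le> C\<^sub>0" and \<delta>: "0 < \<delta>"
  shows "\<exists>\<epsilon>>0. \<epsilon> \<le> 1/2 \<and> (\<forall>(V::'a set) E lam z c s T D v.
     penalty_hypergraph V E k lam z \<longrightarrow> near_tree k V E lam c \<epsilon> \<longrightarrow> 0 \<le> c \<longrightarrow> c ^ (k - 1) \<le> C\<^sub>0 \<longrightarrow>
     z * (real k - 1) * c ^ (k - 1) \<le> B \<longrightarrow> log_fixpoint V E k c z s \<longrightarrow>
     T \<subseteq> V \<longrightarrow> card T \<le> \<tau>\<^sub>0 \<longrightarrow> D \<subseteq> E \<longrightarrow> card ({g\<in>E. g \<inter> T = {}} - D) \<le> M \<longrightarrow>
     v \<in> V - T \<longrightarrow> (\<forall>f\<in>D. \<not> f \<subseteq> insert v T) \<longrightarrow>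
     \<bar>penalty_hypergraph.suppr V lam z T D v - s v\<bar> \<le> \<delta>)"
proof -
  have k1: "1 \<le> real k - 1" using k by simp
  have th: "0 < ctr B" "ctr B < 1" using ctr_bounds B by auto
  define A where "A = 1 + (real k - 1) * (C\<^sub>0 + 1)"
  have A1: "1 \<le> A" unfolding A_def using k1 C0 by simp
  have lnA: "0 \<le> ln A" using A1 by simp
  have "(\<lambda>L. ctr B ^ L * (ln A + 1)) \<longlonglongrightarrow> 0 * (ln A + 1)"
    using th by (intro tendsto_mult LIMSEQ_power_zero tendsto_const) auto
  then have "eventually (\<lambda>L. ctr B ^ L * (ln A + 1) < \<delta> / (2 * A)) sequentially"
    using \<delta> A1 by (intro order_tendstoD(2)) auto
  then obtain L where L: "ctr B ^ L * (ln A + 1) < \<delta> / (2 * A)"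
    by (metis eventually_at_top_linorder order_refl)
  \<comment> \<open>Half of the allowance \<open>\<delta> / A\<close> is left to the accumulated
    errors and half to the initial one; \<open>A\<close> is the factor lost when the logarithmic
    coordinate is undone.\<close>
  define K where "K = min 1 (\<delta> * (1 - ctr B) / (2 * A * (real k - 1)))"
  have K: "0 < K" "K \<le> 1" "(real k - 1) * K / (1 - ctr B) \<le> \<delta> / (2 * A)"
  proof -
    show "0 < K" unfolding K_def using \<delta> th A1 k1 by simp
    show "K \<le> 1" unfolding K_def by simp
    have "K \<le> \<delta> * (1 - ctr B) / (2 * A * (real k - 1))" unfolding K_def by simp
    then have "(real k - 1) * K \<le> (real k - 1) * (\<delta> * (1 - ctr B) / (2 * A * (real k - 1)))"
      using k1 by (intro mult_left_mono) auto
    also have "\<dots> = \<delta> / (2 * A) * (1 - ctr B)" using k1 A1 by (simp add: field_simps)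
    finally show "(real k - 1) * K / (1 - ctr B) \<le> \<delta> / (2 * A)" using th by (simp add: divide_le_eq)
  qed
  define \<tau> where "\<tau> = \<tau>\<^sub>0 + k * L"
  define Kc where "Kc = est_const k C\<^sub>0 \<tau> M"
  have Kc: "1 \<le> Kc" unfolding Kc_def est_const_def using C0
    by (smt (verit) mult_nonneg_nonneg of_nat_0_le_iff zero_le_power)
  define \<epsilon> where "\<epsilon> = min (1/2) (K / Kc)"
  have \<epsilon>: "0 < \<epsilon>" "\<epsilon> \<le> 1/2" "Kc * \<epsilon> \<le> K"
  proof -
    show "0 < \<epsilon>" unfolding \<epsilon>_def using K Kc by auto
    show "\<epsilon> \<le> 1/2" unfolding \<epsilon>_def by (rule min.cobounded1)
    have "Kc * \<epsilon> \<le> Kc * (K / Kc)" unfolding \<epsilon>_def using Kc by (intro mult_left_mono) auto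
    then show "Kc * \<epsilon> \<le> K" using Kc by simp
  qed
  show ?thesis
  proof (intro exI[of _ \<epsilon>] conjI allI impI)
    show "0 < \<epsilon>" "\<epsilon> \<le> 1/2" using \<epsilon> by auto
    fix V :: "'a set" and E lam z c s T D v
    assume hyp: "penalty_hypergraph V E k lam z" and nt: "near_tree k V E lam c \<epsilon>" and c: "0 \<le> c" "c ^ (k - 1) \<le> C\<^sub>0"
      and zB: "z * (real k - 1) * c ^ (k - 1) \<le> B" and fp: "log_fixpoint V E k c z s"
      and T: "T \<subseteq> V" "card T \<le> \<tau>\<^sub>0" and D: "D \<subseteq> E" "card ({g\<in>E. g \<inter> T = {}} - D) \<le> M"
      and v: "v \<in> V - T" and free: "\<forall>f\<in>D. \<not> f \<subseteq> insert v T"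
    interpret penalty_hypergraph V E k lam z by (rule hyp)
    have c0: "0 \<le> c ^ (k - 1)" using c by simp
    have "est_const k (c ^ (k - 1)) \<tau> M \<le> Kc"
      unfolding Kc_def est_const_def using c c0 by (intro add_mono mult_right_mono mult_left_mono) auto
    then have "est_const k (c ^ (k - 1)) \<tau> M * \<epsilon> \<le> Kc * \<epsilon>" using \<epsilon>(1) by (intro mult_right_mono) auto
    then have "est_const k (c ^ (k - 1)) \<tau> M * \<epsilon> \<le> K" using \<epsilon>(3) by (rule order_trans)
    note est = suppr_depth_estimate[OF nt \<epsilon>(2) c(1) fp zB B this K(2) T(1) _ D v free, of L]
    have cT: "card T + k * L \<le> \<tau>" using T unfolding \<tau>_def by simp
    have "ln (1 + (real k - 1) * (c ^ (k - 1) + 1)) \<le> ln A"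
      unfolding A_def using c c0 k1 by (intro ln_mono) (auto intro!: mult_left_mono add_pos_nonneg)
    then have "ctr B ^ L * ln (1 + (real k - 1) * (c ^ (k - 1) + 1)) \<le> ctr B ^ L * (ln A + 1)"
      using th by (intro mult_left_mono) auto
    moreover have half: "\<delta> / (2 * A) + \<delta> / (2 * A) = \<delta> / A" by simp
    ultimately have d: "\<bar>ln (1 + (real k - 1) * suppr T D v) - ln (1 + (real k - 1) * s v)\<bar> \<le> \<delta> / A"
      using est(1)[OF cT] L K(3) half by linarith
    have zc: "z * c ^ (k - 1) \<le> 1 * c ^ (k - 1)" using z_le_1 c0 by (rule mult_right_mono)
    have "\<bar>suppr T D v - s v\<bar> \<le> (1 + (real k - 1) * (C\<^sub>0 + 1)) * \<bar>ln (1 + (real k - 1) * suppr T D v) - ln (1 + (real k - 1) * s v)\<bar>"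
    proof (rule abs_diff_le_ln[OF k1])
      show "0 \<le> suppr T D v" by (rule suppr_nonneg[OF D(1) free])
      show "suppr T D v \<le> C\<^sub>0 + 1" using est(2)[OF cT] c by simp
      show "0 \<le> s v" "s v \<le> C\<^sub>0 + 1" using log_fixpoint_bounds[OF fp c(1), of v] v zc c by auto
    qed
    also have "\<dots> \<le> A * (\<delta> / A)" using d A1 unfolding A_def[symmetric] by (intro mult_left_mono) auto
    finally show "\<bar>suppr T D v - s v\<bar> \<le> \<delta>" using A1 by simp
  qed
qed

subsection \<open>Inclusion probabilities and variances\<close>

lemma near_tree_mono:
  assumes "near_tree k V E lam c \<epsilon>" "\<epsilon> \<le> \<epsilon>'"
  shows "near_tree k V E lam c \<epsilon>'"
proof -
  have "\<epsilon> * real (max_deg V E) \<le> \<epsilon>' * real (max_deg V E)" using assms(2) by (intro mult_right_mono) auto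
  then show ?thesis using assms unfolding near_tree_def by (meson order_trans)
qed

context penalty_hypergraph
begin

text \<open>The probability that \<open>A\<close> is contained in the sample:
  \<open>lam ^ card A\<close> restores the weight that pinning omits.\<close>

definition incl_prob :: "'a set \<Rightarrow> real" where
  "incl_prob A = lam ^ card A * Z A E / Z {} E"

lemma edge_nonempty: "e \<in> E \<Longrightarrow> e \<noteq> {}"
  using edge_card k_ge_2 by fastforce

lemma Z_E_ge_1: "1 \<le> Z {} E"
  by (rule Z_ge_1) (use edge_nonempty in auto)

lemma Z_nonneg: "0 \<le> Z T D"
  unfolding Z_def using lam_pos z_le_1 by (intro sum_nonneg) auto

lemma incl_prob_le: "incl_prob A \<le> lam ^ card A"
proof -
  have "Z A E \<le> Z {} E" using Z_pin_le[of E "{}" A] by simp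
  then have "lam ^ card A * (Z A E / Z {} E) \<le> lam ^ card A * 1"
    using Z_E_ge_1 lam_pos by (intro mult_left_mono) auto
  then show ?thesis unfolding incl_prob_def by simp
qed

lemma incl_prob_nonneg: "0 \<le> incl_prob A"
  unfolding incl_prob_def using Z_nonneg Z_E_ge_1 lam_pos by simp

text \<open>An edge is complete with probability at most \<open>lam ^ k \<le> lam\<close>, so
  penalising it costs at most a factor \<open>1 - lam\<close>. Boundedly many edges thus leave
  \<open>Z\<close> almost unchanged.\<close>

lemma Z_add_edges_ge:
  assumes "finite F" "F \<subseteq> E" "D \<subseteq> E" "D \<inter> F = {}" "lam \<le> 1"
  shows "(1 - lam) ^ card F * Z {} D \<le> Z {} (D \<union> F)"
  using assms
proof (induction F rule: finite_induct)
  case empty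
  show ?case by simp
next
  case (insert e F)
  have sub: "D \<union> F \<subseteq> E" "e \<in> E" "e \<notin> D \<union> F" using insert by auto
  have "z * (lam ^ card (e - {}) * Z ({} \<union> e) (D \<union> F)) \<le> 1 * (lam * Z {} (D \<union> F))"
  proof (intro mult_mono)
    have "lam ^ k \<le> lam ^ 1" using k_ge_2 insert.prems lam_pos by (intro power_decreasing) auto
    then show "lam ^ card (e - {}) \<le> lam" using sub edge_card by simp
    show "Z ({} \<union> e) (D \<union> F) \<le> Z {} (D \<union> F)" by (rule Z_pin_le[OF sub(1)])
  qed (use z_nonneg z_le_1 lam_pos Z_nonneg in auto)
  then have "(1 - lam) * Z {} (D \<union> F) \<le> Z {} (insert e (D \<union> F))"
    using Z_insert_edge[OF sub(2,3,1), of "{}"] by (simp add: algebra_simps)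
  moreover have "(1 - lam) * ((1 - lam) ^ card F * Z {} D) \<le> (1 - lam) * Z {} (D \<union> F)"
    using insert.IH insert.prems by (intro mult_left_mono) auto
  ultimately show ?case using insert.hyps by (simp add: mult.assoc)
qed

text \<open>Edges inside the pinned set are complete in every summand. Splitting them off restores
  the condition behind \<open>Z_ge_1\<close> and \<open>suppr\<close>, that no penalised edge lies
  inside the pins.\<close>

lemma Z_pin_edges:
  "Z A E = (1 - z) ^ card {g\<in>E. g \<subseteq> A} * Z A {g\<in>E. \<not> g \<subseteq> A}"
  unfolding Z_def sum_distrib_left
proof (rule sum.cong[OF refl])
  fix S
  have "{f\<in>E. f \<subseteq> S \<union> A} = {g\<in>E. g \<subseteq> A} \<union> {f\<in>{g\<in>E. \<not> g \<subseteq> A}. f \<subseteq> S \<union> A}" by auto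
  moreover have "card ({g\<in>E. g \<subseteq> A} \<union> {f\<in>{g\<in>E. \<not> g \<subseteq> A}. f \<subseteq> S \<union> A})
      = card {g\<in>E. g \<subseteq> A} + card {f\<in>{g\<in>E. \<not> g \<subseteq> A}. f \<subseteq> S \<union> A}"
    using finite_E by (intro card_Un_disjoint) auto
  ultimately show "lam ^ card S * (1 - z) ^ card {f\<in>E. f \<subseteq> S \<union> A} =
      (1 - z) ^ card {g\<in>E. g \<subseteq> A} * (lam ^ card S * (1 - z) ^ card {f\<in>{g\<in>E. \<not> g \<subseteq> A}. f \<subseteq> S \<union> A})"
    by (simp add: power_add)
qed

end

definition incl_approx :: "'a set set \<Rightarrow> real \<Rightarrow> real \<Rightarrow> ('a \<Rightarrow> real) \<Rightarrow> 'a set \<Rightarrow> real" where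
  "incl_approx E lam z s A = (1 - z) ^ card {g\<in>E. g \<subseteq> A} * lam ^ card A * exp (- (\<Sum>a\<in>A. s a))"

text \<open>With \<open>D\<close> the edges not inside \<open>A\<close>, the probability is
  \<open>(1 - z) ^ card J * lam ^ card A\<close> times \<open>Z A D / Z {} D\<close> times
  \<open>Z {} D / Z {} E\<close>. The first quotient comes from \<open>Z_pin_set\<close>; the second
  is near 1 since only the edges \<open>J\<close> inside \<open>A\<close> are restored. Size
  \<open>2 * k\<close> covers the union of two edges, as the variance requires. The error is
  relative, which forces the exact value 0 if \<open>z = 1\<close> and \<open>A\<close> contains an
  edge.\<close>

lemma incl_prob_close:
  assumes k: "2 \<le> k" and B: "0 < B" "B < exp 1" and C0: "0 \<le> C\<^sub>0" and \<delta>: "0 < \<delta>" "\<delta> \<le> 1"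
  shows "\<exists>\<epsilon>>0. \<epsilon> \<le> 1/2 \<and> (\<forall>(V::'a set) E lam z c s A.
     penalty_hypergraph V E k lam z \<longrightarrow> near_tree k V E lam c \<epsilon> \<longrightarrow> 0 \<le> c \<longrightarrow> c ^ (k - 1) \<le> C\<^sub>0 \<longrightarrow>
     z * (real k - 1) * c ^ (k - 1) \<le> B \<longrightarrow> log_fixpoint V E k c z s \<longrightarrow>
     A \<subseteq> V \<longrightarrow> card A \<le> 2 * k \<longrightarrow>
     \<bar>penalty_hypergraph.incl_prob V E lam z A - incl_approx E lam z s A\<bar> \<le> \<delta> * incl_approx E lam z s A)"
proof -
  \<comment> \<open>Edges inside \<open>A\<close> are subsets of \<open>A\<close>, hence at most
    this many; they are the edges missing from \<open>D\<close>.\<close>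
  define M :: nat where "M = 2 ^ (2 * k)"
  \<comment> \<open>At most \<open>2 * k\<close> exponents, each off by this amount, change the
    exponential by a factor of at most \<open>1 + \<delta> / 4\<close> either way.\<close>
  define \<delta>\<^sub>1 where "\<delta>\<^sub>1 = ln (1 + \<delta> / 4) / (2 * real k)"
  have k0: "0 < real k" using k by simp
  have dd: "\<delta> * \<delta> \<le> \<delta>" using \<delta> by (simp add: mult_left_le)
  have \<delta>1: "0 < \<delta>\<^sub>1" unfolding \<delta>\<^sub>1_def using \<delta> k0 by simp
  obtain \<epsilon>\<^sub>1 where \<epsilon>1: "0 < \<epsilon>\<^sub>1" "\<epsilon>\<^sub>1 \<le> 1/2" and close: "\<forall>(V::'a set) E lam z c s T D v.
     penalty_hypergraph V E k lam z \<longrightarrow> near_tree k V E lam c \<epsilon>\<^sub>1 \<longrightarrow> 0 \<le> c \<longrightarrow> c ^ (k - 1) \<le> C\<^sub>0 \<longrightarrow>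
     z * (real k - 1) * c ^ (k - 1) \<le> B \<longrightarrow> log_fixpoint V E k c z s \<longrightarrow>
     T \<subseteq> V \<longrightarrow> card T \<le> 2 * k \<longrightarrow> D \<subseteq> E \<longrightarrow> card ({g\<in>E. g \<inter> T = {}} - D) \<le> M \<longrightarrow>
     v \<in> V - T \<longrightarrow> (\<forall>f\<in>D. \<not> f \<subseteq> insert v T) \<longrightarrow>
     \<bar>penalty_hypergraph.suppr V lam z T D v - s v\<bar> \<le> \<delta>\<^sub>1"
    using suppr_close[OF k B C0 \<delta>1, of "2 * k" M, where 'a = 'a] by (elim exE conjE) (rule that)
  define \<epsilon>\<^sub>2 where "\<epsilon>\<^sub>2 = \<delta> / 8 / (2 * real k + real M)"
  have \<epsilon>2: "0 < \<epsilon>\<^sub>2" "(2 * real k + real M) * \<epsilon>\<^sub>2 = \<delta> / 8"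
  proof -
    have "0 < 2 * real k + real M" using k0 by (simp add: add_pos_nonneg)
    then show "0 < \<epsilon>\<^sub>2" "(2 * real k + real M) * \<epsilon>\<^sub>2 = \<delta> / 8"
      unfolding \<epsilon>\<^sub>2_def using \<delta> by (simp_all del: divide_divide_eq_left)
  qed
  define \<epsilon> where "\<epsilon> = min \<epsilon>\<^sub>1 \<epsilon>\<^sub>2"
  have \<epsilon>: "0 < \<epsilon>" "\<epsilon> \<le> 1/2" "\<epsilon> \<le> \<epsilon>\<^sub>1" "\<epsilon> \<le> \<epsilon>\<^sub>2" unfolding \<epsilon>_def using \<epsilon>1 \<epsilon>2 by auto
  have "(2 * real k + real M) * \<epsilon> \<le> \<delta> / 8"
    using \<epsilon>2(2) mult_left_mono[OF \<epsilon>(4), of "2 * real k + real M"] by simp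
  moreover have "(2 * real k + real M) * \<epsilon> = 2 * real k * \<epsilon> + real M * \<epsilon>" by (rule distrib_right)
  moreover have "0 \<le> 2 * real k * \<epsilon>" "0 \<le> real M * \<epsilon>" using \<epsilon>(1) by auto
  ultimately have k\<epsilon>: "2 * real k * \<epsilon> \<le> \<delta> / 8" and M\<epsilon>: "real M * \<epsilon> \<le> \<delta> / 8" by linarith+
  show ?thesis
  proof (intro exI[of _ \<epsilon>] conjI allI impI)
    show "0 < \<epsilon>" "\<epsilon> \<le> 1/2" using \<epsilon> by auto
    fix V :: "'a set" and E lam z c s A
    assume hyp: "penalty_hypergraph V E k lam z" and nt: "near_tree k V E lam c \<epsilon>" and c: "0 \<le> c" "c ^ (k - 1) \<le> C\<^sub>0"
      and zB: "z * (real k - 1) * c ^ (k - 1) \<le> B" and fp: "log_fixpoint V E k c z s"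
      and A: "A \<subseteq> V" "card A \<le> 2 * k"
    interpret penalty_hypergraph V E k lam z by (rule hyp)
    have lam: "lam \<le> \<epsilon>" using nt unfolding near_tree_def by simp
    have fA: "finite A" using A finite_V finite_subset by blast
    define J where "J = {g\<in>E. g \<subseteq> A}"
    define D where "D = {g\<in>E. \<not> g \<subseteq> A}"
    have DJ: "D \<subseteq> E" "J \<subseteq> E" "D \<union> J = E" "D \<inter> J = {}" "finite J" using finite_E unfolding D_def J_def by auto
    have cJ: "card J \<le> M"
    proof -
      have "card J \<le> card (Pow A)" unfolding J_def using fA by (intro card_mono) auto
      also have "\<dots> \<le> M" unfolding M_def using fA A by (simp add: card_Pow)
      finally show ?thesis .
    qed
    have "\<exists>\<sigma> \<kappa>. (\<forall>u\<in>A. \<bar>\<sigma> u - s u\<bar> \<le> \<delta>\<^sub>1 \<and> 0 \<le> \<sigma> u) \<and> 0 < \<kappa> \<and> 1 - real (card A) * lam \<le> \<kappa> \<and> \<kappa> \<le> 1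
      \<and> Z ({} \<union> A) D / Z {} D = exp (- (\<Sum>u\<in>A. \<sigma> u)) * \<kappa>"
    proof (rule Z_pin_set)
      fix u A' assume u: "u \<in> A" "A' \<subseteq> A - {u}"
      show "\<bar>suppr ({} \<union> A') D u - s u\<bar> \<le> \<delta>\<^sub>1"
      proof (rule close[rule_format, OF hyp near_tree_mono[OF nt \<epsilon>(3)] c zB fp])
        have "card A' \<le> card A" using u fA by (intro card_mono) auto
        then show "card ({} \<union> A') \<le> 2 * k" using A by simp
        have "{g \<in> E. g \<inter> ({} \<union> A') = {}} - D \<subseteq> J" unfolding D_def J_def by auto
        then have "card ({g \<in> E. g \<inter> ({} \<union> A') = {}} - D) \<le> card J" using DJ by (intro card_mono) auto
        then show "card ({g \<in> E. g \<inter> ({} \<union> A') = {}} - D) \<le> M" using cJ by simp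
      qed (use u A DJ in \<open>auto simp: D_def\<close>)
    qed (use fA A DJ in \<open>auto simp: D_def\<close>)
    then obtain \<sigma> \<kappa> where \<sigma>: "\<forall>u\<in>A. \<bar>\<sigma> u - s u\<bar> \<le> \<delta>\<^sub>1" and \<kappa>: "0 < \<kappa>" "1 - real (card A) * lam \<le> \<kappa>" "\<kappa> \<le> 1"
      and rat: "Z A D / Z {} D = exp (- (\<Sum>u\<in>A. \<sigma> u)) * \<kappa>" by auto
    define \<rho> where "\<rho> = Z {} D / Z {} E"
    have Zs: "1 \<le> Z {} E" "Z {} E \<le> Z {} D" using Z_E_ge_1 Z_antimono[of D E "{}"] DJ by auto
    have \<rho>1: "1 \<le> \<rho>" unfolding \<rho>_def using Zs by simp
    have \<rho>2: "\<rho> * (1 - \<delta> / 8) \<le> 1"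
    proof -
      have "1 - \<delta> / 8 \<le> 1 - real (card J) * lam"
      proof -
        have "real (card J) * lam \<le> real M * \<epsilon>" using cJ lam lam_pos by (intro mult_mono) auto
        then show ?thesis using M\<epsilon> by simp
      qed
      also have "\<dots> \<le> (1 - lam) ^ card J"
        using Bernoulli_inequality[of "- lam" "card J"] lam \<epsilon> by simp
      finally have "(1 - \<delta> / 8) * Z {} D \<le> (1 - lam) ^ card J * Z {} D" using Z_nonneg by (intro mult_right_mono) auto
      also have "\<dots> \<le> Z {} (D \<union> J)" by (rule Z_add_edges_ge) (use DJ lam \<epsilon> in auto)
      finally show ?thesis unfolding \<rho>_def using DJ Zs by (simp add: field_simps)
    qed
    define x where "x = exp (\<Sum>u\<in>A. s u - \<sigma> u)"
    have sumb: "\<bar>\<Sum>u\<in>A. s u - \<sigma> u\<bar> \<le> ln (1 + \<delta> / 4)"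
    proof -
      have "\<bar>\<Sum>u\<in>A. s u - \<sigma> u\<bar> \<le> (\<Sum>u\<in>A. \<bar>s u - \<sigma> u\<bar>)" by (rule sum_abs)
      also have "\<dots> \<le> (\<Sum>u\<in>A. \<delta>\<^sub>1)" using \<sigma> by (intro sum_mono) (auto simp: abs_minus_commute)
      also have "\<dots> = real (card A) * \<delta>\<^sub>1" by simp
      also have "\<dots> \<le> 2 * real k * \<delta>\<^sub>1" using A \<delta>1 by (intro mult_right_mono) auto
      also have "\<dots> = ln (1 + \<delta> / 4)" unfolding \<delta>\<^sub>1_def using k0 by simp
      finally show ?thesis .
    qed
    have x1: "x \<le> 1 + \<delta> / 4"
    proof -
      have "x \<le> exp (ln (1 + \<delta> / 4))" unfolding x_def using sumb by simp
      then show ?thesis using \<delta> by (simp add: add_pos_pos)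
    qed
    have x2: "1 - \<delta> / 4 \<le> x"
    proof -
      have "exp (- ln (1 + \<delta> / 4)) \<le> x" unfolding x_def using sumb by (simp add: abs_le_iff)
      moreover have "exp (- ln (1 + \<delta> / 4)) = 1 / (1 + \<delta> / 4)" using \<delta> by (simp add: exp_minus inverse_eq_divide add_pos_pos)
      moreover have "1 - \<delta> / 4 \<le> 1 / (1 + \<delta> / 4)" using \<delta> by (simp add: field_simps)
      ultimately show ?thesis by linarith
    qed
    have x0: "0 < x" unfolding x_def by simp
    have \<kappa>2: "1 - \<delta> / 8 \<le> \<kappa>"
    proof -
      have "real (card A) * lam \<le> (2 * real k) * \<epsilon>" using A lam lam_pos by (intro mult_mono) auto
      then show ?thesis using \<kappa>(2) k\<epsilon> by simp
    qed
    have up: "x * \<kappa> * \<rho> \<le> 1 + \<delta>"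
    proof -
      have "x * \<kappa> * \<rho> \<le> (1 + \<delta> / 4) * 1 * \<rho>" using x1 \<kappa> x0 \<rho>1 \<delta> by (intro mult_mono) auto
      also have "\<rho> \<le> 1 / (1 - \<delta> / 8)" using \<rho>2 \<delta> by (simp add: pos_le_divide_eq)
      also have "1 / (1 - \<delta> / 8) \<le> 1 + \<delta> / 4"
      proof -
        have "1 \<le> (1 + \<delta> / 4) * (1 - \<delta> / 8)" using \<delta> dd by (simp add: algebra_simps)
        then show ?thesis using \<delta> by (simp add: pos_divide_le_eq)
      qed
      finally have "x * \<kappa> * \<rho> \<le> (1 + \<delta> / 4) * (1 + \<delta> / 4)" using \<delta> by (simp add: mult_left_mono)
      also have "(1 + \<delta> / 4) * (1 + \<delta> / 4) = 1 + \<delta> / 2 + \<delta> * \<delta> / 16" by (simp add: algebra_simps)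
      also have "\<dots> \<le> 1 + \<delta>" using \<delta>(1) dd by linarith
      finally show ?thesis .
    qed
    have lo: "1 - \<delta> \<le> x * \<kappa> * \<rho>"
    proof -
      have "1 - \<delta> \<le> (1 - \<delta> / 4) * (1 - \<delta> / 8) * 1" using \<delta> by (simp add: algebra_simps)
      also have "\<dots> \<le> x * \<kappa> * \<rho>" using x2 \<kappa>2 \<rho>1 \<delta> x0 \<kappa> by (intro mult_mono) auto
      finally show ?thesis .
    qed
    define q where "q = incl_approx E lam z s A"
    have q0: "0 \<le> q" unfolding q_def incl_approx_def using z_le_1 lam_pos by simp
    have "incl_prob A = lam ^ card A * ((1 - z) ^ card J * Z A D) / Z {} E"
      unfolding incl_prob_def J_def D_def by (subst Z_pin_edges) simp
    also have "\<dots> = (1 - z) ^ card J * lam ^ card A * (Z A D / Z {} D) * \<rho>" unfolding \<rho>_def using Zs by simp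
    also have "\<dots> = q * (x * \<kappa> * \<rho>)"
      unfolding rat q_def incl_approx_def J_def x_def sum_subtractf by (simp add: exp_diff exp_minus field_simps)
    finally have eq: "incl_prob A - q = q * (x * \<kappa> * \<rho> - 1)" by (simp add: algebra_simps)
    have "\<bar>x * \<kappa> * \<rho> - 1\<bar> \<le> \<delta>" using up lo by simp
    then have "q * \<bar>x * \<kappa> * \<rho> - 1\<bar> \<le> q * \<delta>" using q0 by (rule mult_left_mono)
    then show "\<bar>incl_prob A - incl_approx E lam z s A\<bar> \<le> \<delta> * incl_approx E lam z s A"
      unfolding q_def[symmetric] eq using q0 by (simp add: abs_mult mult.commute)
  qed
qed

section \<open>Variances as sums over pairs of sets\<close>

context penalty_hypergraph
begin

lemma part_fun_eq_Z: "part_fun V E lam z = Z {} E"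
  unfolding part_fun_def ep_weight_def edges_in_def Z_def by simp

lemma ep_prob_superset:
  assumes "A \<subseteq> V"
  shows "ep_prob V E lam z (\<lambda>S. A \<subseteq> S) = incl_prob A"
proof -
  have "ep_prob V E lam z (\<lambda>S. A \<subseteq> S)
      = (\<Sum>S\<in>{S\<in>Pow (V - {}). A \<subseteq> S}. lam ^ card S * (1 - z) ^ card {f\<in>E. f \<subseteq> S \<union> {}}) / Z {} E"
    unfolding ep_prob_def ep_mu_def ep_weight_def edges_in_def part_fun_eq_Z sum_divide_distrib by simp
  also have "\<dots> = incl_prob A" using Z_supersets[of A "{}" E] assms by (simp add: incl_prob_def)
  finally show ?thesis .
qed

lemma ep_expect_cong: "(\<And>S. S \<subseteq> V \<Longrightarrow> f S = g S) \<Longrightarrow> ep_expect V E lam z f = ep_expect V E lam z g"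
  unfolding ep_expect_def by (intro sum.cong) auto

lemma ep_expect_sum: "ep_expect V E lam z (\<lambda>S. \<Sum>i\<in>I. f i S) = (\<Sum>i\<in>I. ep_expect V E lam z (f i))"
  unfolding ep_expect_def sum_distrib_left by (rule sum.swap)

lemma ep_expect_superset:
  assumes "A \<subseteq> V"
  shows "ep_expect V E lam z (\<lambda>S. of_bool (A \<subseteq> S)) = incl_prob A"
proof -
  have "ep_expect V E lam z (\<lambda>S. of_bool (A \<subseteq> S)) = (\<Sum>S\<in>Pow V. if A \<subseteq> S then ep_mu V E lam z S else 0)"
    unfolding ep_expect_def by (intro sum.cong) auto
  also have "\<dots> = ep_prob V E lam z (\<lambda>S. A \<subseteq> S)"
    unfolding ep_prob_def using finite_V by (subst sum.inter_filter) auto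
  finally show ?thesis using ep_prob_superset[OF assms] by simp
qed

lemma ep_expect_const: "ep_expect V E lam z (\<lambda>S. a) = a"
proof -
  have "(\<Sum>S\<in>Pow V. ep_mu V E lam z S) = 1"
    using Z_E_ge_1 unfolding ep_mu_def sum_divide_distrib[symmetric] part_fun_eq_Z[symmetric]
    by (simp add: part_fun_def)
  then show ?thesis unfolding ep_expect_def by (simp add: sum_distrib_right[symmetric])
qed

lemma ep_var_eq:
  "ep_var V E lam z f = ep_expect V E lam z (\<lambda>S. (f S)\<^sup>2) - (ep_expect V E lam z f)\<^sup>2"
proof -
  define m where "m = ep_expect V E lam z f"
  have "ep_var V E lam z f = (\<Sum>S\<in>Pow V. ep_mu V E lam z S * (f S)\<^sup>2 - 2 * m * (ep_mu V E lam z S * f S) + ep_mu V E lam z S * m\<^sup>2)"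
    unfolding ep_var_def m_def[symmetric]
    unfolding ep_expect_def
    by (intro sum.cong refl) (simp add: power2_eq_square algebra_simps)
  also have "\<dots> = ep_expect V E lam z (\<lambda>S. (f S)\<^sup>2) - 2 * m * m + ep_expect V E lam z (\<lambda>S. m\<^sup>2)"
    unfolding m_def ep_expect_def by (simp add: sum.distrib sum_subtractf sum_distrib_left)
  finally show ?thesis unfolding ep_expect_const m_def by (simp add: power2_eq_square)
qed

lemma ep_var_nonneg: "0 \<le> ep_var V E lam z f"
  unfolding ep_var_def ep_expect_def ep_mu_def ep_weight_def part_fun_eq_Z
  using Z_E_ge_1 lam_pos z_le_1 by (intro sum_nonneg) auto

text \<open>Covers both counts at once: singletons for \<open>F\<close> give the number of occupied
  vertices, \<open>E\<close> for \<open>F\<close> the number of complete edges. Joint inclusion of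
  two sets is inclusion of their union.\<close>

lemma ep_var_count:
  assumes "F \<subseteq> Pow V"
  shows "ep_var V E lam z (\<lambda>S. real (card {A\<in>F. A \<subseteq> S}))
     = (\<Sum>A\<in>F. \<Sum>A'\<in>F. incl_prob (A \<union> A') - incl_prob A * incl_prob A')"
proof -
  have fF: "finite F" using assms finite_V by (auto intro: finite_subset)
  have count: "real (card {A\<in>F. A \<subseteq> S}) = (\<Sum>A\<in>F. of_bool (A \<subseteq> S))" for S
    using fF by (simp add: sum_of_bool_eq Int_def)
  have "ep_expect V E lam z (\<lambda>S. real (card {A\<in>F. A \<subseteq> S})) = (\<Sum>A\<in>F. incl_prob A)"
    unfolding count ep_expect_sum using assms by (intro sum.cong) (auto intro!: ep_expect_superset)
  moreover have "(real (card {A\<in>F. A \<subseteq> S}))\<^sup>2 = (\<Sum>A\<in>F. \<Sum>A'\<in>F. of_bool (A \<union> A' \<subseteq> S))" for S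
    unfolding count power2_eq_square sum_product by (simp add: of_bool_conj)
  then have "ep_expect V E lam z (\<lambda>S. (real (card {A\<in>F. A \<subseteq> S}))\<^sup>2) = (\<Sum>A\<in>F. \<Sum>A'\<in>F. incl_prob (A \<union> A'))"
    unfolding ep_expect_sum using assms
    by (simp only: ep_expect_sum) (intro sum.cong refl ep_expect_superset, auto)
  ultimately show ?thesis
    unfolding ep_var_eq by (simp add: power2_eq_square sum_product sum_subtractf)
qed

text \<open>Edges inside \<open>A \<union> A'\<close> but in neither part only lower the left side.
  This one-sided comparison suffices, because a variance needs only an upper bound.\<close>

lemma incl_approx_Un_le:
  assumes "A \<inter> A' = {}" "finite A" "finite A'"
  shows "incl_approx E lam z s (A \<union> A') \<le> incl_approx E lam z s A * incl_approx E lam z s A'"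
proof -
  let ?J = "\<lambda>A. {g\<in>E. g \<subseteq> A}"
  have "?J A \<inter> ?J A' = {}" using assms(1) edge_nonempty by blast
  then have "card (?J A) + card (?J A') = card (?J A \<union> ?J A')"
    using finite_E by (intro card_Un_disjoint[symmetric]) auto
  also have "\<dots> \<le> card (?J (A \<union> A'))" using finite_E by (intro card_mono) auto
  finally have "(1 - z) ^ card (?J (A \<union> A')) \<le> (1 - z) ^ (card (?J A) + card (?J A'))"
    using z_nonneg z_le_1 by (intro power_decreasing) auto
  then have "(1 - z) ^ card (?J (A \<union> A')) * (lam ^ card (A \<union> A') * exp (- (\<Sum>a\<in>A \<union> A'. s a)))
     \<le> (1 - z) ^ (card (?J A) + card (?J A')) * (lam ^ card (A \<union> A') * exp (- (\<Sum>a\<in>A \<union> A'. s a)))"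
    using lam_pos by (intro mult_right_mono) auto
  moreover have "card (A \<union> A') = card A + card A'" using assms by (intro card_Un_disjoint) auto
  moreover have "(\<Sum>a\<in>A \<union> A'. s a) = (\<Sum>a\<in>A. s a) + (\<Sum>a\<in>A'. s a)" using assms by (intro sum.union_disjoint) auto
  moreover have "exp (- ((\<Sum>a\<in>A. s a) + (\<Sum>a\<in>A'. s a))) = exp (- (\<Sum>a\<in>A. s a)) * exp (- (\<Sum>a\<in>A'. s a))"
    by (simp flip: exp_add)
  ultimately show ?thesis unfolding incl_approx_def by (simp only: power_add mult_ac)
qed

text \<open>Intersecting pairs are bounded by the trivial \<open>lam ^ card (A \<union> A')\<close>.
  For disjoint pairs the main terms cancel and leave
  \<open>(1 + \<delta>) - (1 - \<delta>)^2\<close>, at most \<open>3 * \<delta>\<close>.\<close>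

lemma ep_var_count_le:
  assumes F: "F \<subseteq> Pow V" "\<And>A. A \<in> F \<Longrightarrow> card A \<le> k" and \<delta>: "0 \<le> \<delta>" "\<delta> \<le> 1"
    and s: "\<And>v. v \<in> V \<Longrightarrow> 0 \<le> s v"
    and close: "\<And>A. A \<subseteq> V \<Longrightarrow> card A \<le> 2 * k \<Longrightarrow>
       \<bar>incl_prob A - incl_approx E lam z s A\<bar> \<le> \<delta> * incl_approx E lam z s A"
  shows "ep_var V E lam z (\<lambda>S. real (card {A\<in>F. A \<subseteq> S}))
    \<le> (\<Sum>A\<in>F. \<Sum>A'\<in>{A'\<in>F. A \<inter> A' \<noteq> {}}. lam ^ card (A \<union> A')) + 3 * \<delta> * (\<Sum>A\<in>F. lam ^ card A)\<^sup>2"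
proof -
  let ?q = "incl_approx E lam z s"
  have fF: "finite F" using F finite_V by (auto intro: finite_subset)
  have q: "0 \<le> ?q A" "?q A \<le> lam ^ card A" if "A \<subseteq> V" for A
  proof -
    have "0 \<le> (\<Sum>a\<in>A. s a)" using s that by (intro sum_nonneg) auto
    then have "(1 - z) ^ card {g\<in>E. g \<subseteq> A} * lam ^ card A * exp (- (\<Sum>a\<in>A. s a)) \<le> 1 * lam ^ card A * 1"
      using z_nonneg z_le_1 lam_pos by (intro mult_mono) (auto simp: power_le_one)
    then show "?q A \<le> lam ^ card A" unfolding incl_approx_def by simp
    show "0 \<le> ?q A" unfolding incl_approx_def using z_le_1 lam_pos by simp
  qed
  have pair: "incl_prob (A \<union> A') - incl_prob A * incl_prob A'
      \<le> (if A \<inter> A' \<noteq> {} then lam ^ card (A \<union> A') else 0) + 3 * \<delta> * (lam ^ card A * lam ^ card A')"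
    if "A \<in> F" "A' \<in> F" for A A'
  proof (cases "A \<inter> A' = {}")
    case False
    have "0 \<le> incl_prob A * incl_prob A'" using incl_prob_nonneg by simp
    moreover have "0 \<le> 3 * \<delta> * (lam ^ card A * lam ^ card A')" using \<delta> lam_pos by simp
    ultimately have "incl_prob (A \<union> A') - incl_prob A * incl_prob A'
        \<le> lam ^ card (A \<union> A') + 3 * \<delta> * (lam ^ card A * lam ^ card A')"
      using incl_prob_le[of "A \<union> A'"] by linarith
    then show ?thesis using False by simp
  next
    case True
    have AV: "A \<subseteq> V" "A' \<subseteq> V" "card A \<le> k" "card A' \<le> k" using that F by auto
    then have AV': "finite A" "finite A'" using finite_subset[OF _ finite_V] by auto
    have "card (A \<union> A') \<le> 2 * k" using card_Un_le[of A A'] AV by linarith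
    then have "incl_prob (A \<union> A') \<le> (1 + \<delta>) * ?q (A \<union> A')"
      using close[of "A \<union> A'"] AV by (simp add: algebra_simps abs_le_iff)
    also have "\<dots> \<le> (1 + \<delta>) * (?q A * ?q A')"
      using incl_approx_Un_le[OF True AV'] \<delta> by (intro mult_left_mono) auto
    finally have up: "incl_prob (A \<union> A') \<le> (1 + \<delta>) * (?q A * ?q A')" .
    have "(1 - \<delta>) * ?q A \<le> incl_prob A" "(1 - \<delta>) * ?q A' \<le> incl_prob A'"
      using close[of A] close[of A'] AV by (auto simp: algebra_simps abs_le_iff)
    then have "((1 - \<delta>) * ?q A) * ((1 - \<delta>) * ?q A') \<le> incl_prob A * incl_prob A'"
      using q AV \<delta> incl_prob_nonneg by (intro mult_mono) auto
    then have "incl_prob (A \<union> A') - incl_prob A * incl_prob A' \<le> (1 + \<delta> - (1 - \<delta>) * (1 - \<delta>)) * (?q A * ?q A')"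
      using up by (simp add: algebra_simps)
    also have "\<dots> \<le> 3 * \<delta> * (lam ^ card A * lam ^ card A')"
    proof (rule mult_mono)
      show "1 + \<delta> - (1 - \<delta>) * (1 - \<delta>) \<le> 3 * \<delta>" by (simp add: algebra_simps)
      show "?q A * ?q A' \<le> lam ^ card A * lam ^ card A'" using q AV lam_pos by (intro mult_mono) auto
    qed (use \<delta> q AV in auto)
    finally show ?thesis using True by simp
  qed
  have "ep_var V E lam z (\<lambda>S. real (card {A\<in>F. A \<subseteq> S}))
     \<le> (\<Sum>A\<in>F. \<Sum>A'\<in>F. (if A \<inter> A' \<noteq> {} then lam ^ card (A \<union> A') else 0) + 3 * \<delta> * (lam ^ card A * lam ^ card A'))"
    unfolding ep_var_count[OF F(1)] by (intro sum_mono pair)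
  also have "\<dots> = (\<Sum>A\<in>F. \<Sum>A'\<in>F. if A \<inter> A' \<noteq> {} then lam ^ card (A \<union> A') else 0)
      + 3 * \<delta> * (\<Sum>A\<in>F. lam ^ card A)\<^sup>2"
    unfolding power2_eq_square sum_product by (simp add: sum.distrib sum_distrib_left)
  also have "(\<Sum>A\<in>F. \<Sum>A'\<in>F. if A \<inter> A' \<noteq> {} then lam ^ card (A \<union> A') else 0)
      = (\<Sum>A\<in>F. \<Sum>A'\<in>{A'\<in>F. A \<inter> A' \<noteq> {}}. lam ^ card (A \<union> A'))"
    by (rule sum.cong[OF refl]) (rule sum.inter_filter[OF fF, symmetric])
  finally show ?thesis .
qed

lemma ep_var_vertices_le:
  assumes \<delta>: "0 \<le> \<delta>" "\<delta> \<le> 1" and s: "\<And>v. v \<in> V \<Longrightarrow> 0 \<le> s v"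
    and close: "\<And>A. A \<subseteq> V \<Longrightarrow> card A \<le> 2 * k \<Longrightarrow>
       \<bar>incl_prob A - incl_approx E lam z s A\<bar> \<le> \<delta> * incl_approx E lam z s A"
  shows "ep_var V E lam z (\<lambda>S. real (card S)) \<le> real (card V) * lam + 3 * \<delta> * (real (card V) * lam)\<^sup>2"
proof -
  define F where "F = (\<lambda>v. {v}) ` V"
  have inj: "inj_on (\<lambda>v. {v}) X" for X :: "'a set" by auto
  have "real (card S) = real (card {A\<in>F. A \<subseteq> S})" if "S \<subseteq> V" for S
  proof -
    have "{A\<in>F. A \<subseteq> S} = (\<lambda>v. {v}) ` S" using that unfolding F_def by auto
    then show ?thesis using card_image[OF inj[of S]] by simp
  qed
  then have "ep_expect V E lam z (\<lambda>S. g (real (card S))) = ep_expect V E lam z (\<lambda>S. g (real (card {A\<in>F. A \<subseteq> S})))" for g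
    by (intro ep_expect_cong) auto
  from this[of "\<lambda>x. x"] this
  have "ep_var V E lam z (\<lambda>S. real (card S)) = ep_var V E lam z (\<lambda>S. real (card {A\<in>F. A \<subseteq> S}))"
    unfolding ep_var_def by simp
  also have "\<dots> \<le> (\<Sum>A\<in>F. \<Sum>A'\<in>{A'\<in>F. A \<inter> A' \<noteq> {}}. lam ^ card (A \<union> A')) + 3 * \<delta> * (\<Sum>A\<in>F. lam ^ card A)\<^sup>2"
    by (rule ep_var_count_le[OF _ _ \<delta> s close]) (use k_ge_2 in \<open>auto simp: F_def\<close>)
  also have "(\<Sum>A\<in>F. \<Sum>A'\<in>{A'\<in>F. A \<inter> A' \<noteq> {}}. lam ^ card (A \<union> A')) = (\<Sum>A\<in>F. lam)"
  proof (rule sum.cong[OF refl])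
    fix A assume A: "A \<in> F"
    then have "{A'\<in>F. A \<inter> A' \<noteq> {}} = {A}" unfolding F_def by auto
    moreover obtain v where "A = {v}" using A unfolding F_def by auto
    ultimately show "(\<Sum>A'\<in>{A'\<in>F. A \<inter> A' \<noteq> {}}. lam ^ card (A \<union> A')) = lam" by (simp only:) simp
  qed
  also have "(\<Sum>A\<in>F. lam ^ card A) = (\<Sum>A\<in>F. lam)" by (intro sum.cong) (auto simp: F_def)
  also have "(\<Sum>A\<in>F. lam) = real (card V) * lam"
    unfolding F_def using card_image[OF inj[of V]] by simp
  finally show ?thesis .
qed

lemma card_E_le: "real (card E) \<le> real (card V) * Dmax"
proof -
  have "E \<subseteq> (\<Union>v\<in>V. {e\<in>E. v \<in> e})" using edge_subset edge_nonempty by fastforce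
  then have "card E \<le> card (\<Union>v\<in>V. {e\<in>E. v \<in> e})" using finite_V finite_E by (intro card_mono) auto
  also have "\<dots> \<le> (\<Sum>v\<in>V. card {e\<in>E. v \<in> e})" by (rule card_UN_le[OF finite_V])
  also have "\<dots> \<le> (\<Sum>v\<in>V. max_deg V E)" using degree_le_max_deg by (intro sum_mono) auto
  finally have "card E \<le> card V * max_deg V E" by simp
  from of_nat_mono[OF this, where ?'a = real] show ?thesis by simp
qed

text \<open>Group by \<open>W = e \<inter> f\<close>. A single vertex gives at most
  \<open>Dmax * lam ^ (k - 1)\<close>, close to \<open>c ^ (k - 1)\<close>; an intermediate size
  gives at most \<open>\<epsilon>\<close>; size \<open>k\<close> leaves only \<open>f = e\<close>.
  There are at most \<open>2 ^ k\<close> traces.\<close>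

lemma sum_meeting_edge_le:
  assumes nt: "near_tree k V E lam c \<epsilon>" and \<epsilon>: "\<epsilon> \<le> 1/2" and c: "0 \<le> c" and e: "e \<in> E"
  shows "(\<Sum>f\<in>{f\<in>E. e \<inter> f \<noteq> {}}. lam ^ card (f - e)) \<le> 2 ^ k * (c ^ (k - 1) + 1)"
proof -
  have C0: "0 \<le> c ^ (k - 1)" using c by simp
  have fe: "finite e" using e edge_finite by auto
  have "(\<Sum>f\<in>{f\<in>E. e \<inter> f \<noteq> {}}. lam ^ card (f - e))
     = (\<Sum>W\<in>Pow e. \<Sum>f\<in>{f\<in>{f\<in>E. e \<inter> f \<noteq> {}}. f \<inter> e = W}. lam ^ card (f - e))"
    using fe finite_E by (intro sum.group[symmetric]) auto
  also have "\<dots> \<le> (\<Sum>W\<in>Pow e. c ^ (k - 1) + 1)"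
  proof (rule sum_mono)
    fix W assume W: "W \<in> Pow e"
    define G where "G = {f\<in>{f\<in>E. e \<inter> f \<noteq> {}}. f \<inter> e = W}"
    show "(\<Sum>f\<in>{f\<in>{f\<in>E. e \<inter> f \<noteq> {}}. f \<inter> e = W}. lam ^ card (f - e)) \<le> c ^ (k - 1) + 1"
    proof (cases "W = {}")
      case True
      then have "{f\<in>{f\<in>E. e \<inter> f \<noteq> {}}. f \<inter> e = W} = {}" by auto
      then show ?thesis using C0 by (simp only: sum.empty)
    next
      case False
      have fW: "finite W" "W \<subseteq> V" using W fe finite_subset edge_subset[OF e] by auto
      then have W1: "1 \<le> card W" using False by (simp add: Suc_leI card_gt_0_iff)
      have Wk: "card W \<le> k" using W fe edge_card[OF e] card_mono[of e W] by auto
      have pow_eq: "lam ^ card (f - e) = lam ^ (k - card W)" if "f \<in> G" for f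
      proof -
        have "f - e = f - W" "W \<subseteq> f" "f \<in> E" using that unfolding G_def by auto
        then show ?thesis using fW edge_card by (simp add: card_Diff_subset)
      qed
      have cG: "card G \<le> hdeg E W" unfolding hdeg_def G_def using finite_E by (intro card_mono) auto
      have "(\<Sum>f\<in>G. lam ^ card (f - e)) = (\<Sum>f\<in>G. lam ^ (k - card W))" by (rule sum.cong[OF refl pow_eq])
      also have "\<dots> = real (card G) * lam ^ (k - card W)" by simp
      also have "\<dots> \<le> real (hdeg E W) * lam ^ (k - card W)" using cG lam_pos by (intro mult_right_mono) auto
      also have "\<dots> \<le> c ^ (k - 1) + 1"
      proof -
        have d: "real (hdeg E W) * lam ^ (k - card W) \<le> real (Delta_l V E (card W)) * lam ^ (k - card W)"
          using hdeg_le_Delta_l[OF fW(2)] lam_pos by (intro mult_right_mono) auto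
        consider "card W = 1" | "card W \<in> {2..k-1}" | "card W = k" using W1 Wk by force
        then show ?thesis
        proof cases
          case 1
          then show ?thesis using d nt \<epsilon> unfolding near_tree_def max_deg_def by (auto simp: abs_le_iff mult.commute)
        next
          case 2
          then have "real (Delta_l V E (card W)) * lam ^ (k - card W) \<le> \<epsilon>" using nt unfolding near_tree_def by blast
          then show ?thesis using d \<epsilon> C0 by simp
        next
          case 3
          then have "W = e" using W fe edge_card[OF e] card_subset_eq[of e W] by auto
          have "{f\<in>E. W \<subseteq> f} \<subseteq> {e}"
          proof
            fix f assume "f \<in> {f\<in>E. W \<subseteq> f}"
            then have "f \<in> E" "e \<subseteq> f" using \<open>W = e\<close> by auto
            then show "f \<in> {e}" using card_subset_eq[of f e] edge_finite edge_card e by auto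
          qed
          then have "hdeg E W \<le> 1" unfolding hdeg_def using card_mono[of "{e}"] by fastforce
          then show ?thesis using 3 C0 by simp
        qed
      qed
      finally show ?thesis unfolding G_def .
    qed
  qed
  also have "\<dots> = 2 ^ k * (c ^ (k - 1) + 1)" using fe edge_card[OF e] by (simp add: card_Pow)
  finally show ?thesis .
qed

text \<open>Since \<open>card E\<close> is at most \<open>card V * Dmax\<close> and
  \<open>lam ^ (k - 1) * Dmax\<close> is bounded, \<open>card E * lam ^ k\<close> is of order
  \<open>card V * lam\<close>. The edge count therefore has the same scale as the vertex
  count.\<close>

lemma ep_var_edges_le:
  assumes nt: "near_tree k V E lam c \<epsilon>" and \<epsilon>: "\<epsilon> \<le> 1/2" and c: "0 \<le> c"
    and \<delta>: "0 \<le> \<delta>" "\<delta> \<le> 1" and s: "\<And>v. v \<in> V \<Longrightarrow> 0 \<le> s v"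
    and close: "\<And>A. A \<subseteq> V \<Longrightarrow> card A \<le> 2 * k \<Longrightarrow>
       \<bar>incl_prob A - incl_approx E lam z s A\<bar> \<le> \<delta> * incl_approx E lam z s A"
  shows "ep_var V E lam z (\<lambda>S. real (card (edges_in E S)))
    \<le> 2 ^ k * (c ^ (k - 1) + 1)\<^sup>2 * (real (card V) * lam)
      + 3 * \<delta> * (c ^ (k - 1) + 1)\<^sup>2 * (real (card V) * lam)\<^sup>2"
proof -
  define C where "C = c ^ (k - 1) + 1"
  have C1: "1 \<le> C" unfolding C_def using c by simp
  have lamC: "lam ^ (k - 1) * Dmax \<le> C" using nt \<epsilon> unfolding near_tree_def C_def by (auto simp: abs_le_iff)
  have Elam: "real (card E) * lam ^ k \<le> C * (real (card V) * lam)"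
  proof -
    have "lam ^ k = lam ^ (k - 1) * lam" using k_ge_2 by (metis Suc_diff_1 less_le_trans pos2 power_Suc2)
    then have "real (card E) * lam ^ k \<le> (real (card V) * Dmax) * (lam ^ (k - 1) * lam)"
      using card_E_le lam_pos by (simp add: mult_right_mono)
    also have "\<dots> = (lam ^ (k - 1) * Dmax) * (real (card V) * lam)" by simp
    also have "\<dots> \<le> C * (real (card V) * lam)" using lamC lam_pos by (intro mult_right_mono) auto
    finally show ?thesis .
  qed
  have "ep_var V E lam z (\<lambda>S. real (card (edges_in E S)))
    \<le> (\<Sum>A\<in>E. \<Sum>A'\<in>{A'\<in>E. A \<inter> A' \<noteq> {}}. lam ^ card (A \<union> A')) + 3 * \<delta> * (\<Sum>A\<in>E. lam ^ card A)\<^sup>2"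
    unfolding edges_in_def by (rule ep_var_count_le[OF _ _ \<delta> s close]) (use edge_subset edge_card in auto)
  also have "(\<Sum>A\<in>E. \<Sum>A'\<in>{A'\<in>E. A \<inter> A' \<noteq> {}}. lam ^ card (A \<union> A')) \<le> (\<Sum>A\<in>E. lam ^ k * (2 ^ k * C))"
  proof (rule sum_mono)
    fix e assume e: "e \<in> E"
    have "(\<Sum>f\<in>{f\<in>E. e \<inter> f \<noteq> {}}. lam ^ card (e \<union> f)) = (\<Sum>f\<in>{f\<in>E. e \<inter> f \<noteq> {}}. lam ^ k * lam ^ card (f - e))"
    proof (rule sum.cong[OF refl])
      fix f assume "f \<in> {f\<in>E. e \<inter> f \<noteq> {}}"
      then have "card (e \<union> (f - e)) = card e + card (f - e)"
        using e edge_finite by (intro card_Un_disjoint) auto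
      then show "lam ^ card (e \<union> f) = lam ^ k * lam ^ card (f - e)"
        using edge_card[OF e] by (simp add: power_add)
    qed
    also have "\<dots> = lam ^ k * (\<Sum>f\<in>{f\<in>E. e \<inter> f \<noteq> {}}. lam ^ card (f - e))" by (simp add: sum_distrib_left)
    also have "\<dots> \<le> lam ^ k * (2 ^ k * C)"
      using sum_meeting_edge_le[OF nt \<epsilon> c e] lam_pos unfolding C_def by (intro mult_left_mono) auto
    finally show "(\<Sum>f\<in>{f\<in>E. e \<inter> f \<noteq> {}}. lam ^ card (e \<union> f)) \<le> lam ^ k * (2 ^ k * C)" .
  qed
  also have "(\<Sum>A\<in>E. lam ^ k * (2 ^ k * C)) = (real (card E) * lam ^ k) * (2 ^ k * C)" by simp
  also have "\<dots> \<le> (C * (real (card V) * lam)) * (2 ^ k * C)" using Elam C1 by (intro mult_right_mono) auto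
  also have "(\<Sum>A\<in>E. lam ^ card A) = real (card E) * lam ^ k" using edge_card by simp
  also have "3 * \<delta> * (real (card E) * lam ^ k)\<^sup>2 \<le> 3 * \<delta> * (C * (real (card V) * lam))\<^sup>2"
    using Elam \<delta> lam_pos by (intro mult_left_mono power_mono) auto
  finally show ?thesis unfolding C_def[symmetric] by (simp add: power2_eq_square mult_ac)
qed

end

subsection \<open>The Bethe functional along the curve of fixed points\<close>

lemma power_diff_le:
  fixes t t' c :: real
  assumes "t \<in> {0..c}" "t' \<in> {0..c}"
  shows "\<bar>t ^ m - t' ^ m\<bar> \<le> real m * c ^ (m - 1) * \<bar>t - t'\<bar>"
proof -
  have "norm (t ^ m - t' ^ m) \<le> (real m * c ^ (m - 1)) * norm (t - t')"
  proof (rule field_differentiable_bound[where S = "{0..c}" and f' = "\<lambda>x. real m * x ^ (m - 1)"])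
    fix x assume x: "x \<in> {0..c}"
    show "((\<lambda>x. x ^ m) has_field_derivative real m * x ^ (m - 1)) (at x within {0..c})"
      by (auto intro!: derivative_eq_intros)
    show "norm (real m * x ^ (m - 1)) \<le> real m * c ^ (m - 1)"
      using x by (auto simp: abs_mult power_mono intro!: mult_left_mono)
  qed (use assms in auto)
  then show ?thesis by simp
qed

lemma abs_exp_minus_diff_le:
  fixes a b :: real
  assumes "0 \<le> a" "0 \<le> b"
  shows "\<bar>exp (- a) - exp (- b)\<bar> \<le> \<bar>a - b\<bar>"
proof -
  have "norm (exp (- a) - exp (- b)) \<le> 1 * norm (a - b)"
    by (rule field_differentiable_bound[where S = "{0..}" and f' = "\<lambda>x. - exp (- x)"])
      (use assms in \<open>auto intro!: derivative_eq_intros\<close>)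
  then show ?thesis by simp
qed

text \<open>Convexity gives tangent bounds at \<open>a\<close> and at \<open>b\<close>; between them
  they confine the remainder to \<open>[0, (exp (- a) - exp (- b)) * (b - a)]\<close>, and
  \<open>exp (- x)\<close> is 1-Lipschitz on the half-line.\<close>

lemma exp_minus_taylor:
  fixes a b :: real
  assumes "0 \<le> a" "0 \<le> b"
  shows "\<bar>exp (- b) - exp (- a) + exp (- a) * (b - a)\<bar> \<le> (b - a)\<^sup>2"
proof -
  have t: "exp (- x) * (1 + (x - y)) \<le> exp (- y)" for x y :: real
  proof -
    have "exp (- x) * (1 + (x - y)) \<le> exp (- x) * exp (x - y)"
      using exp_ge_add_one_self[of "x - y"] by (intro mult_left_mono) auto
    then show ?thesis by (simp flip: exp_add)
  qed
  have "0 \<le> exp (- b) - exp (- a) + exp (- a) * (b - a)" using t[of a b] by (simp add: algebra_simps)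
  moreover have "exp (- b) - exp (- a) + exp (- a) * (b - a) \<le> (exp (- a) - exp (- b)) * (b - a)"
    using t[of b a] by (simp add: algebra_simps)
  moreover have "(exp (- a) - exp (- b)) * (b - a) \<le> \<bar>exp (- a) - exp (- b)\<bar> * \<bar>b - a\<bar>"
    by (metis abs_ge_self abs_mult)
  moreover have "\<bar>exp (- a) - exp (- b)\<bar> * \<bar>b - a\<bar> \<le> \<bar>a - b\<bar> * \<bar>b - a\<bar>"
    using abs_exp_minus_diff_le[OF assms] by (intro mult_right_mono) auto
  moreover have "\<bar>a - b\<bar> * \<bar>b - a\<bar> = (b - a)\<^sup>2"
    by (metis abs_minus_commute abs_mult_self_eq power2_eq_square)
  ultimately show ?thesis by linarith
qed

text \<open>As a function of \<open>b\<close> the remainder has derivative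
  \<open>a * exp (- a) - b * exp (- b)\<close>, and \<open>x * exp (- x)\<close> is 1-Lipschitz for
  \<open>x \<ge> 0\<close>, so the derivative is at most the distance from \<open>a\<close>.\<close>

lemma entropy_term_taylor:
  fixes a b :: real
  assumes "0 \<le> a" "0 \<le> b"
  shows "\<bar>exp (- b) * (1 + b) - exp (- a) * (1 + a) + a * exp (- a) * (b - a)\<bar> \<le> (b - a)\<^sup>2"
proof -
  have l: "\<bar>a * exp (- a) - x * exp (- x)\<bar> \<le> \<bar>a - x\<bar>" if "0 \<le> x" for x
  proof -
    have "norm (a * exp (- a) - x * exp (- x)) \<le> 1 * norm (a - x)"
    proof (rule field_differentiable_bound[where S = "{0..}" and f' = "\<lambda>x. (1 - x) * exp (- x)"])
      fix y :: real assume y: "y \<in> {0..}"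
      show "((\<lambda>x. x * exp (- x)) has_field_derivative (1 - y) * exp (- y)) (at y within {0..})"
        by (auto intro!: derivative_eq_intros simp: algebra_simps)
      have "\<bar>1 - y\<bar> \<le> exp y" using y exp_ge_add_one_self[of y] unfolding abs_le_iff atLeast_iff by linarith
      then have "\<bar>1 - y\<bar> * exp (- y) \<le> exp y * exp (- y)" by (intro mult_right_mono) auto
      then show "norm ((1 - y) * exp (- y)) \<le> 1" by (simp add: abs_mult flip: exp_add)
    qed (use assms that in auto)
    then show ?thesis by simp
  qed
  let ?S = "{min a b..max a b}"
  let ?h = "\<lambda>x. exp (- x) * (1 + x) + a * exp (- a) * x"
  have "norm (?h b - ?h a) \<le> \<bar>b - a\<bar> * norm (b - a)"
  proof (rule field_differentiable_bound[where S = ?S and f' = "\<lambda>x. a * exp (- a) - x * exp (- x)"])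
    fix x assume x: "x \<in> ?S"
    show "(?h has_field_derivative a * exp (- a) - x * exp (- x)) (at x within ?S)"
      by (auto intro!: derivative_eq_intros simp: algebra_simps)
    have "0 \<le> x" "\<bar>a - x\<bar> \<le> \<bar>b - a\<bar>" using x assms by auto
    then show "norm (a * exp (- a) - x * exp (- x)) \<le> \<bar>b - a\<bar>" using l[of x] by simp
  qed auto
  moreover have "\<bar>b - a\<bar> * norm (b - a) = (b - a)\<^sup>2" by (simp add: power2_eq_square)
  moreover have "?h b - ?h a = exp (- b) * (1 + b) - exp (- a) * (1 + a) + a * exp (- a) * (b - a)"
    by (simp add: algebra_simps)
  ultimately show ?thesis by simp
qed

text \<open>Allows the Bethe functional to be differentiated along the curve from Lipschitz
  continuity of the fixed points alone.\<close>

lemma has_derivative_zero_quadratic: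
  fixes R :: "real \<Rightarrow> real"
  assumes "a < t" "t < b" "\<And>x. x \<in> {a..b} \<Longrightarrow> \<bar>R x\<bar> \<le> K * (x - t)\<^sup>2"
  shows "(R has_real_derivative 0) (at t)"
proof -
  have R0: "R t = 0" using assms(3)[of t] assms(1,2) by simp
  have "((\<lambda>x. R x / (x - t)) \<longlongrightarrow> 0) (at t)"
  proof (rule Lim_null_comparison)
    have "eventually (\<lambda>x. x \<in> {a<..<b}) (at t)"
      using assms(1,2) by (intro eventually_at_in_open') auto
    moreover have "eventually (\<lambda>x. x \<noteq> t) (at t)" by (simp add: eventually_at_filter)
    ultimately show "eventually (\<lambda>x. norm (R x / (x - t)) \<le> K * \<bar>x - t\<bar>) (at t)"
    proof eventually_elim
      case (elim x)
      then have "\<bar>R x\<bar> \<le> K * (x - t)\<^sup>2" by (intro assms(3)) auto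
      then have "\<bar>R x\<bar> \<le> (K * \<bar>x - t\<bar>) * \<bar>x - t\<bar>" by (simp add: power2_eq_square)
      then show ?case using elim by (simp add: pos_divide_le_eq)
    qed
    show "((\<lambda>x. K * \<bar>x - t\<bar>) \<longlongrightarrow> 0) (at t)" by (auto intro!: tendsto_eq_intros)
  qed
  then show ?thesis unfolding has_field_derivative_iff using R0 by simp
qed

section \<open>Lipschitz dependence of the fixed points on the parameter\<close>

context penalty_hypergraph
begin

lemma edge_vertex_sum_swap:
  "(\<Sum>e\<in>E. \<Sum>u\<in>e. h e u) = (\<Sum>u\<in>V. \<Sum>e\<in>{e\<in>E. u \<in> e}. (h e u :: real))"
proof -
  have "(\<Sum>e\<in>E. \<Sum>u\<in>e. h e u) = (\<Sum>e\<in>E. \<Sum>u\<in>{u\<in>V. u \<in> e}. h e u)"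
    using edge_subset by (intro sum.cong refl) auto
  also have "\<dots> = (\<Sum>u\<in>V. \<Sum>e\<in>{e\<in>E. u \<in> e}. h e u)"
    by (rule sum.swap_restrict[OF finite_E finite_V])
  finally show ?thesis .
qed

text \<open>Let \<open>\<eta>\<close> be the largest gap in the logarithmic coordinate, attained at
  \<open>u\<close>, and insert the recursion at \<open>u\<close> with parameter \<open>t'\<close>
  applied to \<open>s\<close>. Changing the parameter costs at most \<open>(real k - 1) * d\<close>,
  changing \<open>s\<close> to \<open>s'\<close> at most \<open>ctr B * \<eta>\<close>; solving for
  \<open>\<eta>\<close> gives the bound.\<close>

lemma log_fixpoint_lipschitz:
  assumes c: "0 \<le> c" and t: "t \<in> {0..c}" "t' \<in> {0..c}"
    and fp: "log_fixpoint V E k t z s" "log_fixpoint V E k t' z s'"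
    and B: "z * (real k - 1) * c ^ (k - 1) \<le> B" "0 < B" "B < exp 1" and v: "v \<in> V"
  shows "\<bar>s v - s' v\<bar> \<le> (1 + (real k - 1) * c ^ (k - 1)) * (real k - 1) / (1 - ctr B) * \<bar>t ^ (k - 1) - t' ^ (k - 1)\<bar>"
proof -
  have k1: "1 \<le> real k - 1" using k_ge_2 by simp
  have th: "0 < ctr B" "ctr B < 1" using ctr_bounds B by auto
  have tp: "0 \<le> t" "0 \<le> t'" "t ^ (k - 1) \<le> c ^ (k - 1)" "t' ^ (k - 1) \<le> c ^ (k - 1)"
    using t by (auto intro: power_mono)
  define \<psi> where "\<psi> = (\<lambda>x. ln (1 + (real k - 1) * x))"
  define \<eta> where "\<eta> = Max ((\<lambda>u. \<bar>\<psi> (s u) - \<psi> (s' u)\<bar>) ` V)"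
  define d where "d = \<bar>t ^ (k - 1) - t' ^ (k - 1)\<bar>"
  have Vne: "V \<noteq> {}" using v by auto
  have \<eta>_ge: "\<bar>\<psi> (s u) - \<psi> (s' u)\<bar> \<le> \<eta>" if "u \<in> V" for u
    unfolding \<eta>_def using finite_V that by (intro Max_ge) auto
  have \<eta>0: "0 \<le> \<eta>" using \<eta>_ge[OF v] by linarith
  have s0: "0 \<le> s u" "0 \<le> s' u" if "u \<in> V" for u
    using log_fixpoint_bounds[OF fp(1) tp(1) that] log_fixpoint_bounds[OF fp(2) tp(2) that] by auto
  have "\<eta> \<in> (\<lambda>u. \<bar>\<psi> (s u) - \<psi> (s' u)\<bar>) ` V"
    unfolding \<eta>_def using finite_V Vne by (intro Max_in) auto
  then obtain u where u: "u \<in> V" "\<eta> = \<bar>\<psi> (s u) - \<psi> (s' u)\<bar>" by auto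
  define Y where "Y = (\<Sum>e\<in>{e\<in>E. u \<in> e}. 1 * exp (- (\<Sum>w\<in>e - {u}. s w)))"
  have su: "s u = z / Dmax * (t ^ (k - 1) * Y)"
    using fp(1) u(1) unfolding log_fixpoint_def Y_def by (simp add: sum_distrib_left)
  have eV: "w \<in> V" if "e \<in> E" "w \<in> e - {u}" for e w using that edge_subset by auto
  have zY: "0 \<le> z / Dmax * Y" "z / Dmax * Y \<le> 1"
  proof -
    show "0 \<le> z / Dmax * Y" unfolding Y_def
      by (rule recursion_bounds(1)) (use u eV s0 in auto)
    have "z / Dmax * Y \<le> z * 1" unfolding Y_def
      by (rule recursion_bounds(2)) (use u eV s0 in auto)
    then show "z / Dmax * Y \<le> 1" using z_le_1 by simp
  qed
  define m where "m = z / Dmax * (\<Sum>e\<in>{e\<in>E. u \<in> e}. t' ^ (k - 1) * exp (- (\<Sum>w\<in>e - {u}. s w)))"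
  have m: "m = z / Dmax * (t' ^ (k - 1) * Y)" unfolding m_def Y_def by (simp add: sum_distrib_left)
  have m0: "0 \<le> m" unfolding m_def by (rule recursion_bounds(1)) (use u tp eV s0 in auto)
  have "\<bar>s u - m\<bar> = (z / Dmax * Y) * d"
  proof -
    have "s u - m = (z / Dmax * Y) * (t ^ (k - 1) - t' ^ (k - 1))" unfolding su m by (simp add: algebra_simps)
    then show ?thesis unfolding d_def using zY(1) by (simp only: abs_mult[of "z / Dmax * Y"] abs_of_nonneg)
  qed
  also have "\<dots> \<le> 1 * d" using zY by (intro mult_right_mono) (auto simp: d_def)
  finally have sm: "\<bar>s u - m\<bar> \<le> d" by simp
  have "\<bar>\<psi> (s u) - \<psi> m\<bar> \<le> (real k - 1) * \<bar>s u - m\<bar>"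
    unfolding \<psi>_def using k1 s0 u m0 by (intro abs_ln_diff_le) auto
  also have "\<dots> \<le> (real k - 1) * d" using sm k1 by (intro mult_left_mono) auto
  finally have 1: "\<bar>\<psi> (s u) - \<psi> m\<bar> \<le> (real k - 1) * d" .
  have s'u: "s' u = z / Dmax * (\<Sum>e\<in>{e\<in>E. u \<in> e}. t' ^ (k - 1) * exp (- (\<Sum>w\<in>e - {u}. s' w)))"
    using fp(2) u(1) unfolding log_fixpoint_def by auto
  have 2: "\<bar>\<psi> m - \<psi> (s' u)\<bar> \<le> ctr B * \<eta>"
    unfolding m_def s'u \<psi>_def
  proof (rule recursion_contraction[OF u(1) _ _ B(2,3) \<eta>0])
    have "z * (real k - 1) * t' ^ (k - 1) \<le> z * (real k - 1) * c ^ (k - 1)"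
      using tp k1 z_nonneg by (intro mult_left_mono) auto
    then show "z * (real k - 1) * t' ^ (k - 1) \<le> B" using B(1) by simp
    show "\<bar>ln (1 + (real k - 1) * s w) - ln (1 + (real k - 1) * s' w)\<bar> \<le> \<eta>" if "e \<in> E" "w \<in> e - {u}" for e w
      using \<eta>_ge[OF eV[OF that]] unfolding \<psi>_def .
  qed (use tp s0 eV in auto)
  have "\<eta> \<le> (real k - 1) * d + ctr B * \<eta>" using 1 2 u(2) by linarith
  then have "\<eta> * (1 - ctr B) \<le> (real k - 1) * d" by (simp add: algebra_simps)
  then have \<eta>_le: "\<eta> \<le> (real k - 1) * d / (1 - ctr B)" using th by (simp add: pos_le_divide_eq)
  have zc: "z * t ^ (k - 1) \<le> c ^ (k - 1)" "z * t' ^ (k - 1) \<le> c ^ (k - 1)"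
    using mult_right_mono[OF z_le_1, of "t ^ (k - 1)"] mult_right_mono[OF z_le_1, of "t' ^ (k - 1)"] tp by auto
  have "\<bar>s v - s' v\<bar> \<le> (1 + (real k - 1) * c ^ (k - 1)) * \<bar>\<psi> (s v) - \<psi> (s' v)\<bar>"
    unfolding \<psi>_def
  proof (rule abs_diff_le_ln[OF k1])
    show "s v \<le> c ^ (k - 1)" using log_fixpoint_bounds(2)[OF fp(1) tp(1) v] zc by linarith
    show "s' v \<le> c ^ (k - 1)" using log_fixpoint_bounds(2)[OF fp(2) tp(2) v] zc by linarith
  qed (use s0 v in auto)
  also have "\<dots> \<le> (1 + (real k - 1) * c ^ (k - 1)) * ((real k - 1) * d / (1 - ctr B))"
    using \<eta>_ge[OF v] \<eta>_le k1 c by (intro mult_left_mono) auto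
  finally show ?thesis unfolding d_def by (simp add: mult.assoc)
qed

end

section \<open>The Bethe functional on the curve: derivative, integral and lower bound\<close>

locale fixpoint_curve = penalty_hypergraph +
  fixes c B :: real and s :: "real \<Rightarrow> 'a \<Rightarrow> real"
  assumes c_pos: "0 < c" and B_ge: "z * (real k - 1) * c ^ (k - 1) \<le> B" and B_pos: "0 < B" and B_less: "B < exp 1"
    and s_fix: "\<And>t. t \<in> {0..c} \<Longrightarrow> log_fixpoint V E k t z (s t)"
begin

text \<open>The Lipschitz constant in \<open>t ^ (k - 1)\<close> from
  \<open>log_fixpoint_lipschitz\<close>, times that of \<open>t ^ (k - 1)\<close> on
  \<open>{0..c}\<close>.\<close>

definition Lip :: real where
  "Lip = (1 + (real k - 1) * c ^ (k - 1)) * (real k - 1) / (1 - ctr B) * (real (k - 1) * c ^ (k - 1 - 1))"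

lemma Lip_nonneg: "0 \<le> Lip"
  unfolding Lip_def using ctr_bounds[of B] B_pos B_less c_pos k_ge_2 by (intro mult_nonneg_nonneg divide_nonneg_nonneg) auto

lemma s_lipschitz:
  assumes "t \<in> {0..c}" "t' \<in> {0..c}" "v \<in> V"
  shows "\<bar>s t v - s t' v\<bar> \<le> Lip * \<bar>t - t'\<bar>"
proof -
  let ?K = "(1 + (real k - 1) * c ^ (k - 1)) * (real k - 1) / (1 - ctr B)"
  have K: "0 \<le> ?K" using ctr_bounds[of B] B_pos B_less c_pos k_ge_2
    by (intro mult_nonneg_nonneg divide_nonneg_nonneg) auto
  have "\<bar>s t v - s t' v\<bar> \<le> ?K * \<bar>t ^ (k - 1) - t' ^ (k - 1)\<bar>"
    using assms s_fix c_pos B_ge B_pos B_less by (intro log_fixpoint_lipschitz) auto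
  also have "\<dots> \<le> ?K * (real (k - 1) * c ^ (k - 1 - 1) * \<bar>t - t'\<bar>)"
    using K power_diff_le[OF assms(1,2), of "k - 1"] by (intro mult_left_mono)
  finally show ?thesis unfolding Lip_def by (simp add: mult.assoc)
qed

lemma s_continuous: "v \<in> V \<Longrightarrow> continuous_on {0..c} (\<lambda>t. s t v)"
  by (rule lipschitz_on_continuous_on[of Lip], rule lipschitz_onI)
    (use s_lipschitz Lip_nonneg in \<open>auto simp: dist_real_def\<close>)

lemma s_nonneg: "t \<in> {0..c} \<Longrightarrow> v \<in> V \<Longrightarrow> 0 \<le> s t v"
  using log_fixpoint_bounds(1)[OF s_fix] by auto

text \<open>For positive \<open>t\<close> this is the Bethe functional with parameter
  \<open>t\<close> at \<open>x v = t * exp (- s t v)\<close>, where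
  \<open>ln (x v / t) = - s t v\<close>. Written without division by \<open>t\<close>, it extends to
  \<open>t = 0\<close> with value 0.\<close>

definition bethe :: "real \<Rightarrow> real" where
  "bethe t = - (z / Dmax) * t ^ k * (\<Sum>e\<in>E. exp (- (\<Sum>u\<in>e. s t u))) + t * (\<Sum>v\<in>V. exp (- s t v) * (1 + s t v))"

lemma bethe_continuous: "continuous_on {0..c} bethe"
  unfolding bethe_def using edge_subset
  by (intro continuous_intros s_continuous) auto

text \<open>Stationarity of the Bethe functional at the fixed point: to first order in \<open>t - t\<^sub>0\<close>
  the variation of \<open>s t\<close> does not contribute, so only the explicit dependence on \<open>t\<close> is differentiated.\<close>

lemma bethe_has_derivative:
  assumes t0: "0 < t\<^sub>0" "t\<^sub>0 < c"
  shows "(bethe has_real_derivative (\<Sum>v\<in>V. exp (- s t\<^sub>0 v))) (at t\<^sub>0)"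
proof -
  define a where "a = s t\<^sub>0"
  define Y where "Y = (\<lambda>e. exp (- (\<Sum>u\<in>e. a u)))"
  define w where "w = (\<lambda>u. z / Dmax * (\<Sum>e\<in>{e\<in>E. u \<in> e}. Y e))"
  define g where "g = (\<lambda>x::real. exp (- x) * (1 + x))"
  \<comment> \<open>The functional with the fixed point frozen at its value for
    \<open>t\<^sub>0\<close>, so that only the explicit dependence on \<open>t\<close>
    remains.\<close>
  define A where "A = (\<lambda>t. - (z / Dmax) * t ^ k * (\<Sum>e\<in>E. Y e) + t * (\<Sum>v\<in>V. g (a v)))"
  define r where "r = (\<lambda>t e. exp (- (\<Sum>u\<in>e. s t u)) - Y e + Y e * ((\<Sum>u\<in>e. s t u) - (\<Sum>u\<in>e. a u)))"
  define q where "q = (\<lambda>t v. g (s t v) - g (a v) + a v * exp (- a v) * (s t v - a v))"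
  have t0c: "t\<^sub>0 \<in> {0..c}" using t0 by auto
  have a0: "0 \<le> a u" if "u \<in> V" for u unfolding a_def using s_nonneg t0c that by auto
  have w0: "0 \<le> w u" for u unfolding w_def Y_def using z_nonneg by (intro mult_nonneg_nonneg sum_nonneg) auto
  \<comment> \<open>The fixed point equation times \<open>exp (- a u)\<close>, which completes each
    sum over \<open>e - {u}\<close> to a sum over \<open>e\<close>. It says that the first variation
    of the functional in \<open>s\<close> vanishes.\<close>
  have stat: "a u * exp (- a u) = t\<^sub>0 ^ (k - 1) * w u" if u: "u \<in> V" for u
  proof -
    have "a u * exp (- a u) = z / Dmax * (\<Sum>e\<in>{e\<in>E. u \<in> e}. t\<^sub>0 ^ (k - 1) * exp (- (\<Sum>w\<in>e - {u}. a w))) * exp (- a u)"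
      using s_fix[OF t0c] u unfolding log_fixpoint_def a_def by auto
    also have "\<dots> = z / Dmax * (\<Sum>e\<in>{e\<in>E. u \<in> e}. t\<^sub>0 ^ (k - 1) * Y e)"
      unfolding mult.assoc sum_distrib_right
    proof (intro arg_cong[where f = "\<lambda>x. z / Dmax * x"] sum.cong refl)
      fix e assume e: "e \<in> {e\<in>E. u \<in> e}"
      then have "(\<Sum>u\<in>e. a u) = a u + (\<Sum>w\<in>e - {u}. a w)" using edge_finite by (intro sum.remove) auto
      then show "t\<^sub>0 ^ (k - 1) * (exp (- (\<Sum>w\<in>e - {u}. a w)) * exp (- a u)) = t\<^sub>0 ^ (k - 1) * Y e"
        unfolding Y_def by (simp flip: exp_add)
    qed
    also have "\<dots> = t\<^sub>0 ^ (k - 1) * w u" unfolding w_def by (simp add: sum_distrib_left mult_ac)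
    finally show ?thesis .
  qed
  have kk: "t ^ k = t * t ^ (k - 1)" for t :: real using k_ge_2 by (cases k) auto
  \<comment> \<open>By \<open>stat\<close> the first-order terms in \<open>s t u - a u\<close>
    cancel up to the factor \<open>t ^ (k - 1) - t\<^sub>0 ^ (k - 1)\<close>, itself of order
    \<open>t - t\<^sub>0\<close>. The other two sums are Taylor remainders, so every part is
    quadratic.\<close>
  have decomp: "bethe t - A t = (\<Sum>u\<in>V. (s t u - a u) * w u * t * (t ^ (k - 1) - t\<^sub>0 ^ (k - 1)))
      - z / Dmax * t ^ k * (\<Sum>e\<in>E. r t e) + t * (\<Sum>v\<in>V. q t v)" for t
  proof -
    have sw: "z / Dmax * (\<Sum>e\<in>E. Y e * ((\<Sum>u\<in>e. s t u) - (\<Sum>u\<in>e. a u))) = (\<Sum>u\<in>V. (s t u - a u) * w u)"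
    proof -
      have "(\<Sum>e\<in>E. Y e * ((\<Sum>u\<in>e. s t u) - (\<Sum>u\<in>e. a u))) = (\<Sum>e\<in>E. \<Sum>u\<in>e. Y e * (s t u - a u))"
        by (simp add: sum_subtractf[symmetric] sum_distrib_left)
      also have "\<dots> = (\<Sum>u\<in>V. \<Sum>e\<in>{e\<in>E. u \<in> e}. Y e * (s t u - a u))" by (rule edge_vertex_sum_swap)
      finally show ?thesis unfolding w_def by (simp add: sum_distrib_left sum_distrib_right mult_ac)
    qed
    have "bethe t - A t = - (z / Dmax) * t ^ k * (\<Sum>e\<in>E. exp (- (\<Sum>u\<in>e. s t u)) - Y e) + t * (\<Sum>v\<in>V. g (s t v) - g (a v))"
      unfolding bethe_def A_def g_def by (simp add: sum_subtractf algebra_simps)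
    also have "(\<Sum>e\<in>E. exp (- (\<Sum>u\<in>e. s t u)) - Y e) = (\<Sum>e\<in>E. r t e) - (\<Sum>e\<in>E. Y e * ((\<Sum>u\<in>e. s t u) - (\<Sum>u\<in>e. a u)))"
      unfolding r_def sum_subtractf[symmetric] by (intro sum.cong) auto
    also have "(\<Sum>v\<in>V. g (s t v) - g (a v)) = (\<Sum>v\<in>V. q t v) - (\<Sum>v\<in>V. (t\<^sub>0 ^ (k - 1) * w v) * (s t v - a v))"
      unfolding q_def sum_subtractf[symmetric] using stat by (intro sum.cong) auto
    also have "- (z / Dmax) * t ^ k * ((\<Sum>e\<in>E. r t e) - (\<Sum>e\<in>E. Y e * ((\<Sum>u\<in>e. s t u) - (\<Sum>u\<in>e. a u))))
        = t ^ k * (\<Sum>u\<in>V. (s t u - a u) * w u) - z / Dmax * t ^ k * (\<Sum>e\<in>E. r t e)"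
      unfolding sw[symmetric] by (simp add: algebra_simps)
    also have "t ^ k * (\<Sum>u\<in>V. (s t u - a u) * w u) - z / Dmax * t ^ k * (\<Sum>e\<in>E. r t e)
         + t * ((\<Sum>v\<in>V. q t v) - (\<Sum>v\<in>V. (t\<^sub>0 ^ (k - 1) * w v) * (s t v - a v)))
       = (t ^ k * (\<Sum>u\<in>V. (s t u - a u) * w u) - t * (\<Sum>v\<in>V. (t\<^sub>0 ^ (k - 1) * w v) * (s t v - a v)))
         - z / Dmax * t ^ k * (\<Sum>e\<in>E. r t e) + t * (\<Sum>v\<in>V. q t v)" by (simp add: algebra_simps)
    also have "t ^ k * (\<Sum>u\<in>V. (s t u - a u) * w u) - t * (\<Sum>v\<in>V. (t\<^sub>0 ^ (k - 1) * w v) * (s t v - a v))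
        = (\<Sum>u\<in>V. (s t u - a u) * w u * t * (t ^ (k - 1) - t\<^sub>0 ^ (k - 1)))"
      unfolding sum_distrib_left sum_subtractf[symmetric] kk by (intro sum.cong) (auto simp: algebra_simps)
    finally show ?thesis .
  qed
  define L' where "L' = real (k - 1) * c ^ (k - 1 - 1)"
  define K where "K = (\<Sum>u\<in>V. Lip * w u * c * L') + z / Dmax * c ^ k * (\<Sum>e\<in>E. (real k * Lip)\<^sup>2) + c * (\<Sum>v\<in>V. Lip\<^sup>2)"
  have bound: "\<bar>bethe t - A t\<bar> \<le> K * (t - t\<^sub>0)\<^sup>2" if t: "t \<in> {0..c}" for t
  proof -
    have d: "\<bar>s t u - a u\<bar> \<le> Lip * \<bar>t - t\<^sub>0\<bar>" if "u \<in> V" for u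
      unfolding a_def by (rule s_lipschitz[OF t t0c that])
    have sq: "\<bar>x\<bar> \<le> M * \<bar>t - t\<^sub>0\<bar> \<Longrightarrow> x\<^sup>2 \<le> M\<^sup>2 * (t - t\<^sub>0)\<^sup>2" for x M
      by (metis abs_ge_zero power2_abs power_mono power_mult_distrib)
    have 1: "\<bar>\<Sum>u\<in>V. (s t u - a u) * w u * t * (t ^ (k - 1) - t\<^sub>0 ^ (k - 1))\<bar> \<le> (\<Sum>u\<in>V. Lip * w u * c * L') * (t - t\<^sub>0)\<^sup>2"
    proof -
      have "\<bar>\<Sum>u\<in>V. (s t u - a u) * w u * t * (t ^ (k - 1) - t\<^sub>0 ^ (k - 1))\<bar>
          \<le> (\<Sum>u\<in>V. \<bar>(s t u - a u) * w u * t * (t ^ (k - 1) - t\<^sub>0 ^ (k - 1))\<bar>)" by (rule sum_abs)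
      also have "\<dots> \<le> (\<Sum>u\<in>V. (Lip * \<bar>t - t\<^sub>0\<bar>) * w u * c * (L' * \<bar>t - t\<^sub>0\<bar>))"
      proof (rule sum_mono)
        fix u assume u: "u \<in> V"
        have "\<bar>(s t u - a u) * w u * t * (t ^ (k - 1) - t\<^sub>0 ^ (k - 1))\<bar>
            = \<bar>s t u - a u\<bar> * w u * t * \<bar>t ^ (k - 1) - t\<^sub>0 ^ (k - 1)\<bar>"
          using w0[of u] t by (simp add: abs_mult)
        also have "\<dots> \<le> (Lip * \<bar>t - t\<^sub>0\<bar>) * w u * c * (L' * \<bar>t - t\<^sub>0\<bar>)"
          using d[OF u] w0[of u] t power_diff_le[OF t t0c, of "k - 1"] Lip_nonneg c_pos unfolding L'_def
          by (intro mult_mono) auto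
        finally show "\<bar>(s t u - a u) * w u * t * (t ^ (k - 1) - t\<^sub>0 ^ (k - 1))\<bar>
            \<le> (Lip * \<bar>t - t\<^sub>0\<bar>) * w u * c * (L' * \<bar>t - t\<^sub>0\<bar>)" .
      qed
      also have "\<dots> = (\<Sum>u\<in>V. Lip * w u * c * L') * (\<bar>t - t\<^sub>0\<bar> * \<bar>t - t\<^sub>0\<bar>)"
        unfolding sum_distrib_right by (intro sum.cong) (auto simp: mult_ac)
      finally show ?thesis by (simp add: power2_eq_square)
    qed
    have 2: "\<bar>z / Dmax * t ^ k * (\<Sum>e\<in>E. r t e)\<bar> \<le> z / Dmax * c ^ k * (\<Sum>e\<in>E. (real k * Lip)\<^sup>2) * (t - t\<^sub>0)\<^sup>2"
    proof -
      have "\<bar>\<Sum>e\<in>E. r t e\<bar> \<le> (\<Sum>e\<in>E. \<bar>r t e\<bar>)" by (rule sum_abs)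
      also have "\<dots> \<le> (\<Sum>e\<in>E. (real k * Lip)\<^sup>2 * (t - t\<^sub>0)\<^sup>2)"
      proof (rule sum_mono)
        fix e assume e: "e \<in> E"
        then have eV: "u \<in> V" if "u \<in> e" for u using that edge_subset by auto
        have "\<bar>r t e\<bar> \<le> ((\<Sum>u\<in>e. s t u) - (\<Sum>u\<in>e. a u))\<^sup>2" unfolding r_def Y_def
          using s_nonneg[OF t eV] a0[OF eV] by (intro exp_minus_taylor sum_nonneg) auto
        also have "\<dots> \<le> (real k * Lip)\<^sup>2 * (t - t\<^sub>0)\<^sup>2"
        proof (rule sq)
          have "\<bar>(\<Sum>u\<in>e. s t u) - (\<Sum>u\<in>e. a u)\<bar> \<le> (\<Sum>u\<in>e. \<bar>s t u - a u\<bar>)"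
            unfolding sum_subtractf[symmetric] by (rule sum_abs)
          also have "\<dots> \<le> (\<Sum>u\<in>e. Lip * \<bar>t - t\<^sub>0\<bar>)" using d eV by (intro sum_mono) auto
          also have "\<dots> = real k * Lip * \<bar>t - t\<^sub>0\<bar>" using edge_card[OF e] by simp
          finally show "\<bar>(\<Sum>u\<in>e. s t u) - (\<Sum>u\<in>e. a u)\<bar> \<le> real k * Lip * \<bar>t - t\<^sub>0\<bar>" .
        qed
        finally show "\<bar>r t e\<bar> \<le> (real k * Lip)\<^sup>2 * (t - t\<^sub>0)\<^sup>2" .
      qed
      finally have F1: "\<bar>\<Sum>e\<in>E. r t e\<bar> \<le> (\<Sum>e\<in>E. (real k * Lip)\<^sup>2) * (t - t\<^sub>0)\<^sup>2" by (simp only: sum_distrib_right)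
      have F2: "z / Dmax * t ^ k \<le> z / Dmax * c ^ k" "0 \<le> z / Dmax * t ^ k"
        using t z_nonneg by (auto intro!: mult_left_mono divide_right_mono power_mono)
      have "(z / Dmax * t ^ k) * \<bar>\<Sum>e\<in>E. r t e\<bar> \<le> (z / Dmax * c ^ k) * ((\<Sum>e\<in>E. (real k * Lip)\<^sup>2) * (t - t\<^sub>0)\<^sup>2)"
        by (rule mult_mono[OF F2(1) F1 order_trans[OF F2(2,1)] abs_ge_zero])
      moreover have "\<bar>z / Dmax * t ^ k * (\<Sum>e\<in>E. r t e)\<bar> = (z / Dmax * t ^ k) * \<bar>\<Sum>e\<in>E. r t e\<bar>"
        using F2(2) by (simp only: abs_mult[of "z / Dmax * t ^ k"] abs_of_nonneg)
      ultimately show ?thesis by (simp only: mult.assoc)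
    qed
    have 3: "\<bar>t * (\<Sum>v\<in>V. q t v)\<bar> \<le> c * (\<Sum>v\<in>V. Lip\<^sup>2) * (t - t\<^sub>0)\<^sup>2"
    proof -
      have "\<bar>\<Sum>v\<in>V. q t v\<bar> \<le> (\<Sum>v\<in>V. \<bar>q t v\<bar>)" by (rule sum_abs)
      also have "\<dots> \<le> (\<Sum>v\<in>V. Lip\<^sup>2 * (t - t\<^sub>0)\<^sup>2)"
      proof (rule sum_mono)
        fix v assume v: "v \<in> V"
        have "\<bar>q t v\<bar> \<le> (s t v - a v)\<^sup>2" unfolding q_def g_def
          using s_nonneg[OF t v] a0[OF v] by (rule entropy_term_taylor[rotated])
        also have "\<dots> \<le> Lip\<^sup>2 * (t - t\<^sub>0)\<^sup>2" by (rule sq[OF d[OF v]])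
        finally show "\<bar>q t v\<bar> \<le> Lip\<^sup>2 * (t - t\<^sub>0)\<^sup>2" .
      qed
      finally have "\<bar>\<Sum>v\<in>V. q t v\<bar> \<le> (\<Sum>v\<in>V. Lip\<^sup>2) * (t - t\<^sub>0)\<^sup>2" by (simp only: sum_distrib_right)
      then have "t * \<bar>\<Sum>v\<in>V. q t v\<bar> \<le> c * ((\<Sum>v\<in>V. Lip\<^sup>2) * (t - t\<^sub>0)\<^sup>2)"
        using t by (intro mult_mono) auto
      then show ?thesis using t by (simp add: abs_mult)
    qed
    have "K * (t - t\<^sub>0)\<^sup>2 = (\<Sum>u\<in>V. Lip * w u * c * L') * (t - t\<^sub>0)\<^sup>2
        + z / Dmax * c ^ k * (\<Sum>e\<in>E. (real k * Lip)\<^sup>2) * (t - t\<^sub>0)\<^sup>2 + c * (\<Sum>v\<in>V. Lip\<^sup>2) * (t - t\<^sub>0)\<^sup>2"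
      unfolding K_def by (simp only: distrib_right)
    then show ?thesis unfolding decomp using 1 2 3 by linarith
  qed
  have dR: "((\<lambda>t. bethe t - A t) has_real_derivative 0) (at t\<^sub>0)"
    by (rule has_derivative_zero_quadratic[OF t0 bound])
  have dA: "(A has_real_derivative (\<Sum>v\<in>V. exp (- a v))) (at t\<^sub>0)"
  proof -
    have "(A has_real_derivative (- (z / Dmax) * (real k * t\<^sub>0 ^ (k - 1)) * (\<Sum>e\<in>E. Y e) + (\<Sum>v\<in>V. g (a v)))) (at t\<^sub>0)"
    proof -
      have "((\<lambda>t. - \<omega> * t ^ k * S + t * G) has_real_derivative (- \<omega> * (real k * t\<^sub>0 ^ (k - 1)) * S + G)) (at t\<^sub>0)" for \<omega> S G :: real
        by (auto intro!: derivative_eq_intros)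
      then show ?thesis unfolding A_def .
    qed
    \<comment> \<open>Counting each edge once per vertex turns the factor \<open>k\<close> into a
      sum over vertices; by \<open>stat\<close> this sum cancels the part
      \<open>a v * exp (- a v)\<close> of \<open>g (a v)\<close>.\<close>
    moreover have "- (z / Dmax) * (real k * t\<^sub>0 ^ (k - 1)) * (\<Sum>e\<in>E. Y e) + (\<Sum>v\<in>V. g (a v)) = (\<Sum>v\<in>V. exp (- a v))"
    proof -
      have "real k * (\<Sum>e\<in>E. Y e) = (\<Sum>e\<in>E. \<Sum>u\<in>e. Y e)" using edge_card by (simp add: sum_distrib_left)
      also have "\<dots> = (\<Sum>u\<in>V. \<Sum>e\<in>{e\<in>E. u \<in> e}. Y e)" by (rule edge_vertex_sum_swap)
      finally have kY: "real k * (\<Sum>e\<in>E. Y e) = (\<Sum>u\<in>V. \<Sum>e\<in>{e\<in>E. u \<in> e}. Y e)" .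
      have "z / Dmax * (real k * t\<^sub>0 ^ (k - 1)) * (\<Sum>e\<in>E. Y e) = t\<^sub>0 ^ (k - 1) * (z / Dmax * (real k * (\<Sum>e\<in>E. Y e)))"
        by (simp only: mult_ac)
      also have "\<dots> = (\<Sum>u\<in>V. t\<^sub>0 ^ (k - 1) * w u)"
        unfolding kY w_def sum_distrib_left[symmetric] ..
      also have "\<dots> = (\<Sum>u\<in>V. a u * exp (- a u))" using stat by (intro sum.cong) auto
      finally have *: "z / Dmax * (real k * t\<^sub>0 ^ (k - 1)) * (\<Sum>e\<in>E. Y e) = (\<Sum>u\<in>V. a u * exp (- a u))" .
      have "(\<Sum>v\<in>V. g (a v)) = (\<Sum>v\<in>V. exp (- a v)) + (\<Sum>u\<in>V. a u * exp (- a u))"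
        unfolding g_def by (simp add: algebra_simps sum.distrib)
      then show ?thesis using * by simp
    qed
    ultimately show ?thesis by simp
  qed
  have "((\<lambda>t. (bethe t - A t) + A t) has_real_derivative (0 + (\<Sum>v\<in>V. exp (- a v)))) (at t\<^sub>0)"
    by (rule DERIV_add[OF dR dA])
  then show ?thesis unfolding a_def by simp
qed

lemma bethe_eq_integral: "bethe c = (\<Sum>v\<in>V. integral {0..c} (\<lambda>t. exp (- s t v)))"
proof -
  have "((\<lambda>t. \<Sum>v\<in>V. exp (- s t v)) has_integral (bethe c - bethe 0)) {0..c}"
    by (rule fundamental_theorem_of_calculus_interior)
      (use c_pos bethe_continuous bethe_has_derivative in \<open>auto simp: has_real_derivative_iff_has_vector_derivative[symmetric]\<close>)
  moreover have "bethe 0 = 0" unfolding bethe_def using k_ge_2 by simp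
  ultimately have "bethe c = integral {0..c} (\<lambda>t. \<Sum>v\<in>V. exp (- s t v))" by (simp add: integral_unique)
  also have "\<dots> = (\<Sum>v\<in>V. integral {0..c} (\<lambda>t. exp (- s t v)))"
    using finite_V by (intro integral_sum integrable_continuous_real continuous_intros s_continuous) auto
  finally show ?thesis .
qed

text \<open>A lower bound linear in the number of vertices; it converts an additive error small
  compared with \<open>card V\<close> into a relative one, as the asymptotic equivalence for the
  partition function demands.\<close>

lemma bethe_lower: "real (card V) * (c * exp (- (z * c ^ (k - 1)))) \<le> bethe c"
proof -
  have "(\<Sum>v\<in>V. c * exp (- (z * c ^ (k - 1)))) \<le> bethe c"
    unfolding bethe_eq_integral
  proof (rule sum_mono)
    fix v assume v: "v \<in> V"
    have "integral {0..c} (\<lambda>t::real. exp (- (z * c ^ (k - 1)))) \<le> integral {0..c} (\<lambda>t. exp (- s t v))"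
    proof (rule integral_le)
      show "(\<lambda>t. exp (- s t v)) integrable_on {0..c}"
        using v by (intro integrable_continuous_real continuous_intros s_continuous)
      fix t assume t: "t \<in> {0..c}"
      have "s t v \<le> z * t ^ (k - 1)" using log_fixpoint_bounds(2)[OF s_fix[OF t] _ v] t by auto
      also have "\<dots> \<le> z * c ^ (k - 1)" using t z_nonneg by (intro mult_left_mono power_mono) auto
      finally show "exp (- (z * c ^ (k - 1))) \<le> exp (- s t v)" by simp
    qed auto
    then show "c * exp (- (z * c ^ (k - 1))) \<le> integral {0..c} (\<lambda>t. exp (- s t v))" using c_pos by simp
  qed
  then show ?thesis by simp
qed

lemma bethe_fun_eq:
  assumes x: "\<And>v. v \<in> V \<Longrightarrow> x v = c * exp (- s c v)"
  shows "bethe_fun V E c z x = bethe c"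
proof -
  have "(\<Sum>e\<in>E. \<Prod>u\<in>e. x u) = (\<Sum>e\<in>E. c ^ k * exp (- (\<Sum>u\<in>e. s c u)))"
  proof (rule sum.cong[OF refl])
    fix e assume e: "e \<in> E"
    then have "(\<Prod>u\<in>e. x u) = (\<Prod>u\<in>e. c * exp (- s c u))" using edge_subset x by (intro prod.cong) auto
    also have "\<dots> = c ^ k * exp (- (\<Sum>u\<in>e. s c u))"
      using edge_card[OF e] edge_finite[OF e] by (simp add: prod.distrib exp_sum sum_negf[symmetric])
    finally show "(\<Prod>u\<in>e. x u) = c ^ k * exp (- (\<Sum>u\<in>e. s c u))" .
  qed
  moreover have "(\<Sum>v\<in>V. x v * (ln (x v / c) - 1)) = (\<Sum>v\<in>V. - (c * (exp (- s c v) * (1 + s c v))))"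
    using x c_pos by (intro sum.cong) (auto simp: algebra_simps)
  ultimately have "(\<Sum>e\<in>E. \<Prod>u\<in>e. x u) = c ^ k * (\<Sum>e\<in>E. exp (- (\<Sum>u\<in>e. s c u)))"
    "(\<Sum>v\<in>V. x v * (ln (x v / c) - 1)) = - (c * (\<Sum>v\<in>V. exp (- s c v) * (1 + s c v)))"
    by (simp_all add: sum_distrib_left sum_negf)
  then show ?thesis unfolding bethe_fun_def bethe_def by simp
qed

end

subsection \<open>Comparison of the partition function with the Bethe functional\<close>

context penalty_hypergraph
begin

lemma part_fun_has_derivative:
  "((\<lambda>x. part_fun V E x z) has_real_derivative (\<Sum>v\<in>V. Z {v} E)) (at lam)"
proof -
  define W where "W = (\<lambda>S. (1 - z) ^ card (edges_in E S))"
  have "((\<lambda>x. \<Sum>S\<in>Pow V. x ^ card S * W S) has_real_derivative (\<Sum>S\<in>Pow V. real (card S) * lam ^ (card S - 1) * W S)) (at lam)"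
    by (auto intro!: derivative_eq_intros sum.cong)
  moreover have "(\<Sum>S\<in>Pow V. real (card S) * lam ^ (card S - 1) * W S) = (\<Sum>v\<in>V. Z {v} E)"
  proof -
    \<comment> \<open>Multiplying by \<open>lam\<close> removes the truncated exponent at the empty
      set and exposes a count of pairs of a set and one of its vertices.\<close>
    have "lam * (\<Sum>S\<in>Pow V. real (card S) * lam ^ (card S - 1) * W S) = (\<Sum>S\<in>Pow V. real (card S) * (lam ^ card S * W S))"
      unfolding sum_distrib_left
    proof (rule sum.cong[OF refl])
      fix S
      have pw: "lam * (real m * lam ^ (m - 1)) = real m * lam ^ m" for m by (cases m) auto
      have "lam * (real (card S) * lam ^ (card S - 1) * W S) = lam * (real (card S) * lam ^ (card S - 1)) * W S"
        by (simp only: mult.assoc)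
      also have "\<dots> = real (card S) * (lam ^ card S * W S)" unfolding pw by (simp only: mult.assoc)
      finally show "lam * (real (card S) * lam ^ (card S - 1) * W S) = real (card S) * (lam ^ card S * W S)" .
    qed
    also have "\<dots> = (\<Sum>S\<in>Pow V. \<Sum>v\<in>{v\<in>V. v \<in> S}. lam ^ card S * W S)"
    proof (rule sum.cong[OF refl])
      fix S assume "S \<in> Pow V"
      then have "{v\<in>V. v \<in> S} = S" by auto
      then show "real (card S) * (lam ^ card S * W S) = (\<Sum>v\<in>{v\<in>V. v \<in> S}. lam ^ card S * W S)" by simp
    qed
    also have "\<dots> = (\<Sum>v\<in>V. \<Sum>S\<in>{S\<in>Pow V. v \<in> S}. lam ^ card S * W S)"
      using finite_V by (intro sum.swap_restrict) auto
    also have "\<dots> = (\<Sum>v\<in>V. lam * Z {v} E)"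
    proof (rule sum.cong[OF refl])
      fix v assume "v \<in> V"
      then show "(\<Sum>S\<in>{S\<in>Pow V. v \<in> S}. lam ^ card S * W S) = lam * Z {v} E"
        using Z_supersets[of "{v}" "{}" E] unfolding W_def edges_in_def by simp
    qed
    finally show ?thesis using lam_pos by (simp add: sum_distrib_left[symmetric])
  qed
  ultimately show ?thesis unfolding part_fun_def ep_weight_def W_def by simp
qed

lemma ln_part_fun_has_derivative:
  "((\<lambda>x. ln (part_fun V E x z)) has_real_derivative (\<Sum>v\<in>V. incl_prob {v}) / lam) (at lam)"
proof -
  have p: "0 < part_fun V E lam z" using Z_E_ge_1 part_fun_eq_Z by simp
  have "((\<lambda>x. ln (part_fun V E x z)) has_real_derivative (1 / part_fun V E lam z) * (\<Sum>v\<in>V. Z {v} E)) (at lam)"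
    using p by (intro DERIV_chain2[OF DERIV_ln_divide part_fun_has_derivative]) auto
  moreover have "(1 / part_fun V E lam z) * (\<Sum>v\<in>V. Z {v} E) = (\<Sum>v\<in>V. incl_prob {v}) / lam"
    unfolding incl_prob_def part_fun_eq_Z sum_distrib_left sum_divide_distrib
    using lam_pos by (intro sum.cong) auto
  ultimately show ?thesis by simp
qed

lemma part_fun_ge_1:
  assumes "0 \<le> x"
  shows "1 \<le> part_fun V E x z"
proof -
  have "edges_in E {} = {}" unfolding edges_in_def using edge_nonempty by auto
  then have "ep_weight E x z {} = 1" unfolding ep_weight_def by simp
  moreover have "ep_weight E x z {} \<le> part_fun V E x z"
    unfolding part_fun_def
    by (rule member_le_sum) (use finite_V assms z_le_1 in \<open>auto simp: ep_weight_def\<close>)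
  ultimately show ?thesis by simp
qed

lemma part_fun_0: "part_fun V E 0 z = 1"
proof -
  have "part_fun V E 0 z = (\<Sum>S\<in>Pow V. if S = {} then 1 else 0)"
    unfolding part_fun_def
  proof (rule sum.cong[OF refl])
    fix S assume S: "S \<in> Pow V"
    have "edges_in E {} = {}" unfolding edges_in_def using edge_nonempty by auto
    moreover have "finite S" using S finite_V finite_subset by auto
    ultimately show "ep_weight E 0 z S = (if S = {} then 1 else 0)"
      unfolding ep_weight_def by (auto simp: zero_power card_gt_0_iff)
  qed
  also have "\<dots> = 1" using finite_V by simp
  finally show ?thesis .
qed

end

context fixpoint_curve
begin

text \<open>The difference \<open>G\<close> vanishes at \<open>t = 0\<close>, so the mean value
  theorem reduces the claim to its derivative. With \<open>\<kappa> = a * lam / c\<close>, the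
  logarithm contributes \<open>\<kappa>\<close> times the rescaled occupation probabilities, and the
  Bethe functional contributes their limits. For \<open>a\<close> the power
  \<open>1 / (k - 1)\<close> of the maximum degree, \<open>\<kappa>\<close> tends to 1.\<close>

lemma ln_part_fun_close:
  assumes \<delta>: "0 \<le> \<delta>"
    and close: "\<And>t v. 0 < t \<Longrightarrow> t < c \<Longrightarrow> v \<in> V \<Longrightarrow>
      \<bar>penalty_hypergraph.incl_prob V E (t * lam / c) z {v} - t * lam / c * exp (- s t v)\<bar>
        \<le> \<delta> * (t * lam / c * exp (- s t v))"
  shows "\<bar>a * ln (part_fun V E lam z) - bethe c\<bar>
    \<le> c * (real (card V) * (\<bar>a * lam / c - 1\<bar> * (1 + \<delta>) + \<delta>))"
proof -
  define G where "G = (\<lambda>t. a * ln (part_fun V E (t * lam / c) z) - bethe t)"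
  define \<kappa> where "\<kappa> = a * lam / c"
  define p where "p = (\<lambda>t v. penalty_hypergraph.incl_prob V E (t * lam / c) z {v})"
  have dG: "(G has_real_derivative (\<Sum>v\<in>V. \<kappa> * (p t v / (t * lam / c)) - exp (- s t v))) (at t)"
    if t: "0 < t" "t < c" for t
  proof -
    have x0: "0 < t * lam / c" using t lam_pos by simp
    interpret pt: penalty_hypergraph V E k "t * lam / c" z
      by unfold_locales (use x0 uniform k_ge_2 z_nonneg z_le_1 in auto)
    have "((\<lambda>t. ln (part_fun V E (t * lam / c) z)) has_real_derivative
        ((\<Sum>v\<in>V. p t v) / (t * lam / c)) * (lam / c)) (at t)"
      unfolding p_def
      by (rule DERIV_chain2[where f = "\<lambda>x. ln (part_fun V E x z)" and g = "\<lambda>t. t * lam / c", OF pt.ln_part_fun_has_derivative]) (use c_pos in \<open>auto intro!: derivative_eq_intros\<close>)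
    then have "(G has_real_derivative (a * (((\<Sum>v\<in>V. p t v) / (t * lam / c)) * (lam / c)) - (\<Sum>v\<in>V. exp (- s t v)))) (at t)"
      unfolding G_def by (intro DERIV_diff DERIV_cmult bethe_has_derivative t)
    moreover have "a * (((\<Sum>v\<in>V. p t v) / (t * lam / c)) * (lam / c)) = (\<Sum>v\<in>V. \<kappa> * (p t v / (t * lam / c)))"
      unfolding \<kappa>_def sum_distrib_left[symmetric] sum_divide_distrib[symmetric] by simp
    ultimately show ?thesis by (simp add: sum_subtractf)
  qed
  have bound: "\<bar>\<Sum>v\<in>V. \<kappa> * (p t v / (t * lam / c)) - exp (- s t v)\<bar>
      \<le> real (card V) * (\<bar>\<kappa> - 1\<bar> * (1 + \<delta>) + \<delta>)" if t: "0 < t" "t < c" for t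
  proof -
    have x0: "0 < t * lam / c" using t lam_pos by simp
    have "\<bar>\<Sum>v\<in>V. \<kappa> * (p t v / (t * lam / c)) - exp (- s t v)\<bar>
        \<le> (\<Sum>v\<in>V. \<bar>\<kappa> * (p t v / (t * lam / c)) - exp (- s t v)\<bar>)" by (rule sum_abs)
    also have "\<dots> \<le> (\<Sum>v\<in>V. \<bar>\<kappa> - 1\<bar> * (1 + \<delta>) + \<delta>)"
    proof (rule sum_mono)
      fix v assume v: "v \<in> V"
      define y where "y = exp (- s t v)"
      define x where "x = t * lam / c"
      have y: "0 \<le> y" "y \<le> 1" unfolding y_def using s_nonneg[of t v] t v by auto
      have "\<bar>p t v - x * y\<bar> \<le> \<delta> * (x * y)" using close[OF t v] unfolding p_def x_def y_def .
      also have "\<dots> \<le> (\<delta> * 1) * x" using y \<delta> x0 mult_left_mono[of y 1 "\<delta> * x"] unfolding x_def[symmetric] by (simp add: mult_ac)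
      finally have px: "\<bar>p t v - x * y\<bar> \<le> \<delta> * x" by simp
      have "\<bar>p t v / x - y\<bar> = \<bar>p t v - x * y\<bar> / x"
      proof -
        have "p t v / x - y = (p t v - x * y) / x" using x0 unfolding x_def[symmetric] by (simp add: diff_divide_distrib)
        then show ?thesis using x0 unfolding x_def[symmetric] by simp
      qed
      also have "\<dots> \<le> \<delta>" using px x0 unfolding x_def[symmetric] by (simp add: pos_divide_le_eq)
      finally have d: "\<bar>p t v / x - y\<bar> \<le> \<delta>" .
      have "\<kappa> * r - y = (\<kappa> - 1) * (r - y) + (\<kappa> - 1) * y + (r - y)" for r by (simp add: algebra_simps)
      from this[of "p t v / x"] have "\<bar>\<kappa> * (p t v / x) - y\<bar> \<le> \<bar>(\<kappa> - 1) * (p t v / x - y)\<bar> + \<bar>(\<kappa> - 1) * y\<bar> + \<bar>p t v / x - y\<bar>" by linarith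
      moreover have "\<bar>(\<kappa> - 1) * (p t v / x - y)\<bar> \<le> \<bar>\<kappa> - 1\<bar> * \<delta>"
        unfolding abs_mult using d by (intro mult_left_mono) auto
      moreover have "\<bar>(\<kappa> - 1) * y\<bar> \<le> \<bar>\<kappa> - 1\<bar> * 1"
        unfolding abs_mult using y by (intro mult_left_mono) auto
      ultimately show "\<bar>\<kappa> * (p t v / (t * lam / c)) - exp (- s t v)\<bar> \<le> \<bar>\<kappa> - 1\<bar> * (1 + \<delta>) + \<delta>"
        using d unfolding x_def[symmetric] y_def[symmetric] by (simp add: distrib_left)
    qed
    finally show ?thesis by simp
  qed
  have contG: "continuous_on {0..c} G"
  proof -
    have "continuous_on {0..c} (\<lambda>t. part_fun V E (t * lam / c) z)"
      unfolding part_fun_def ep_weight_def using c_pos by (intro continuous_intros) auto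
    moreover have "part_fun V E (t * lam / c) z \<noteq> 0" if "t \<in> {0..c}" for t
      using part_fun_ge_1[of "t * lam / c"] that lam_pos c_pos by auto
    ultimately show ?thesis unfolding G_def by (intro continuous_intros bethe_continuous) auto
  qed
  obtain l t where t: "0 < t" "t < c" "(G has_real_derivative l) (at t)" and GG: "G c - G 0 = (c - 0) * l"
    using MVT[OF c_pos contG] dG real_differentiable_def by blast
  have "l = (\<Sum>v\<in>V. \<kappa> * (p t v / (t * lam / c)) - exp (- s t v))" by (rule DERIV_unique[OF t(3) dG[OF t(1,2)]])
  then have "\<bar>G c - G 0\<bar> \<le> c * (real (card V) * (\<bar>\<kappa> - 1\<bar> * (1 + \<delta>) + \<delta>))"
    using bound[OF t(1,2)] c_pos unfolding GG by (simp add: abs_mult)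
  moreover have "G c = a * ln (part_fun V E lam z) - bethe c" unfolding G_def using c_pos by simp
  moreover have "G 0 = 0" unfolding G_def bethe_def using part_fun_0 k_ge_2 by simp
  ultimately show ?thesis unfolding \<kappa>_def by simp
qed

end

text \<open>Scaling \<open>lam\<close> and \<open>c\<close> by the same factor
  \<open>t / c \<le> 1\<close> multiplies the error of the second condition by its power and only
  decreases the terms in \<open>lam\<close>. One \<open>\<epsilon>\<close> thus serves the whole
  curve.\<close>

lemma near_tree_scale:
  assumes nt: "near_tree k V E lam c \<epsilon>" and t: "0 < t" "t \<le> c" and lam: "0 < lam"
  shows "near_tree k V E (t * lam / c) t \<epsilon>"
proof -
  have c: "0 < c" using t by simp
  have le: "t * lam / c \<le> lam" using t lam by (simp add: divide_le_eq)
  have pos: "0 < t * lam / c" using t lam by simp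
  have 1: "t * lam / c \<le> \<epsilon>" using nt le unfolding near_tree_def by linarith
  have 2: "\<bar>(t * lam / c) ^ (k - 1) * real (max_deg V E) - t ^ (k - 1)\<bar> \<le> \<epsilon>"
  proof -
    have eq: "(t * lam / c) ^ (k - 1) * real (max_deg V E) - t ^ (k - 1)
        = (t / c) ^ (k - 1) * (lam ^ (k - 1) * real (max_deg V E) - c ^ (k - 1))"
      using c by (simp add: power_divide power_mult_distrib right_diff_distrib)
    have tc: "0 \<le> (t / c) ^ (k - 1)" "(t / c) ^ (k - 1) \<le> 1" using t by (auto intro!: power_le_one)
    have "\<bar>(t / c) ^ (k - 1) * (lam ^ (k - 1) * real (max_deg V E) - c ^ (k - 1))\<bar>
        \<le> 1 * \<bar>lam ^ (k - 1) * real (max_deg V E) - c ^ (k - 1)\<bar>"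
      unfolding abs_mult using tc by (intro mult_right_mono) auto
    moreover have "\<bar>lam ^ (k - 1) * real (max_deg V E) - c ^ (k - 1)\<bar> \<le> \<epsilon>" using nt unfolding near_tree_def by blast
    ultimately show ?thesis unfolding eq by linarith
  qed
  have 3: "real (Delta_l V E l) * (t * lam / c) ^ (k - l) \<le> \<epsilon>" if "l \<in> {2..k-1}" for l
  proof -
    have "real (Delta_l V E l) * (t * lam / c) ^ (k - l) \<le> real (Delta_l V E l) * lam ^ (k - l)"
      using le pos by (intro mult_left_mono power_mono) auto
    also have "\<dots> \<le> \<epsilon>" using nt that unfolding near_tree_def by blast
    finally show ?thesis .
  qed
  show ?thesis using nt 1 2 3 unfolding near_tree_def by blast
qed

lemma fixpoint_imp_log_fixpoint:
  assumes "k_uniform k V E" and c: "0 < c" and fp: "is_fixpoint V E c z x"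
  shows "log_fixpoint V E k c z (\<lambda>v. ln (c / x v))"
    and "v \<in> V \<Longrightarrow> x v = c * exp (- ln (c / x v))"
proof -
  have pos: "0 < x v" if "v \<in> V" for v
    using fp that c unfolding is_fixpoint_def Fmap_def by auto
  then show x: "x v = c * exp (- ln (c / x v))" if "v \<in> V" for v
    using pos[OF that] c by (simp add: exp_minus)
  show "log_fixpoint V E k c z (\<lambda>v. ln (c / x v))"
    unfolding log_fixpoint_def
  proof
    fix v assume v: "v \<in> V"
    define m where "m = z / real (max_deg V E) * (\<Sum>e\<in>{e\<in>E. v \<in> e}. \<Prod>u\<in>e - {v}. x u)"
    have "x v = c * exp (- m)" using fp v unfolding is_fixpoint_def Fmap_def m_def by simp
    then have "c / x v = exp m" using c by (simp add: exp_minus divide_inverse)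
    then have "ln (c / x v) = m" by simp
    moreover have "(\<Prod>u\<in>e - {v}. x u) = c ^ (k - 1) * exp (- (\<Sum>u\<in>e - {v}. ln (c / x u)))"
      if e: "e \<in> {e\<in>E. v \<in> e}" for e
    proof -
      have fe: "finite e" "card e = k" "e \<subseteq> V"
        using e assms(1) finite_subset unfolding k_uniform_def by auto
      have "(\<Prod>u\<in>e - {v}. x u) = (\<Prod>u\<in>e - {v}. c * exp (- ln (c / x u)))"
        using fe x by (intro prod.cong) auto
      also have "\<dots> = c ^ (k - 1) * exp (- (\<Sum>u\<in>e - {v}. ln (c / x u)))"
        using fe e by (simp add: prod.distrib exp_sum sum_negf[symmetric])
      finally show ?thesis .
    qed
    ultimately show "ln (c / x v) = z / real (max_deg V E) *
        (\<Sum>e\<in>{e\<in>E. v \<in> e}. c ^ (k - 1) * exp (- (\<Sum>u\<in>e - {v}. ln (c / x u))))"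
      unfolding m_def by simp
  qed
qed

subsection \<open>Asymptotically tree-like sequences\<close>

text \<open>The formulation \<open>f - g\<close> in \<open>o(g)\<close> needs no division and
  tolerates zeros of \<open>g\<close>, which occur for edges when
  \<open>\<zeta> n = 1\<close>.\<close>

lemma asymp_equivI_relative:
  fixes f g :: "nat \<Rightarrow> real"
  assumes "\<And>\<delta>. 0 < \<delta> \<Longrightarrow> \<delta> \<le> 1 \<Longrightarrow> eventually (\<lambda>n. \<bar>f n - g n\<bar> \<le> \<delta> * \<bar>g n\<bar>) sequentially"
  shows "f \<sim>[sequentially] g"
  unfolding asymp_equiv_altdef
proof (rule landau_o.smallI)
  fix d :: real assume d: "0 < d"
  have "eventually (\<lambda>n. \<bar>f n - g n\<bar> \<le> min d 1 * \<bar>g n\<bar>) sequentially" using d by (intro assms) auto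
  then show "eventually (\<lambda>n. norm (f n - g n) \<le> d * norm (g n)) sequentially"
  proof eventually_elim
    case (elim n)
    have "min d 1 * \<bar>g n\<bar> \<le> d * \<bar>g n\<bar>" by (intro mult_right_mono) auto
    then show ?case using elim by simp
  qed
qed

locale tree_like_sequence =
  fixes k :: nat and c :: real and V :: "nat \<Rightarrow> 'a set" and E :: "nat \<Rightarrow> 'a set set" and lam :: "nat \<Rightarrow> real"
  assumes k_ge_2: "2 \<le> k" and c_pos: "0 < c" and tree: "asymp_tree_like k V E"
    and lam_asymp: "lam \<sim>[sequentially] (\<lambda>n. c * real (max_deg (V n) (E n)) powr (- 1 / (real k - 1)))"
begin

lemma uniform_n: "k_uniform k (V n) (E n)"
  using tree unfolding asymp_tree_like_def by simp

lemma D_at_top: "filterlim (\<lambda>n. real (max_deg (V n) (E n))) at_top sequentially"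
  using tree unfolding asymp_tree_like_def by simp

lemma D_pos: "eventually (\<lambda>n. 0 < real (max_deg (V n) (E n))) sequentially"
  using D_at_top filterlim_at_top_dense by fastforce

lemma lam_scaled_tendsto: "(\<lambda>n. lam n * real (max_deg (V n) (E n)) powr (1 / (real k - 1))) \<longlonglongrightarrow> c"
proof -
  have "eventually (\<lambda>n. c * real (max_deg (V n) (E n)) powr (- 1 / (real k - 1)) \<noteq> 0) sequentially"
    using D_pos by eventually_elim (use c_pos in auto)
  then have "(\<lambda>n. lam n / (c * real (max_deg (V n) (E n)) powr (- 1 / (real k - 1)))) \<longlonglongrightarrow> 1"
    by (intro asymp_equivD_strong[OF lam_asymp]) (auto elim: eventually_mono)
  then have "(\<lambda>n. c * (lam n / (c * real (max_deg (V n) (E n)) powr (- 1 / (real k - 1))))) \<longlonglongrightarrow> c * 1"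
    by (intro tendsto_mult tendsto_const)
  then have "(\<lambda>n. c * (lam n / (c * real (max_deg (V n) (E n)) powr (- 1 / (real k - 1))))) \<longlonglongrightarrow> c" by simp
  then show ?thesis
  proof (rule Lim_transform_eventually)
    show "eventually (\<lambda>n. c * (lam n / (c * real (max_deg (V n) (E n)) powr (- 1 / (real k - 1))))
        = lam n * real (max_deg (V n) (E n)) powr (1 / (real k - 1))) sequentially"
      using D_pos by eventually_elim (use c_pos in \<open>simp add: powr_minus field_simps\<close>)
  qed
qed

lemma D_powr_neg_tendsto_0: "(\<lambda>n. real (max_deg (V n) (E n)) powr (- 1 / (real k - 1))) \<longlonglongrightarrow> 0"
  using k_ge_2 by (intro tendsto_neg_powr D_at_top) (simp add: divide_less_0_iff)

lemma lam_eq: "eventually (\<lambda>n. lam n = (lam n * real (max_deg (V n) (E n)) powr (1 / (real k - 1)))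
     * real (max_deg (V n) (E n)) powr (- 1 / (real k - 1))) sequentially"
  using D_pos by eventually_elim (simp add: powr_minus)

lemma lam_pos_eventually: "eventually (\<lambda>n. 0 < lam n) sequentially"
proof -
  have "eventually (\<lambda>n. 0 < lam n * real (max_deg (V n) (E n)) powr (1 / (real k - 1))) sequentially"
    by (rule order_tendstoD(1)[OF lam_scaled_tendsto c_pos])
  then show ?thesis by eventually_elim (auto simp: zero_less_mult_iff)
qed

lemma lam_tendsto_0: "lam \<longlonglongrightarrow> 0"
proof (rule Lim_transform_eventually)
  show "(\<lambda>n. (lam n * real (max_deg (V n) (E n)) powr (1 / (real k - 1)))
     * real (max_deg (V n) (E n)) powr (- 1 / (real k - 1))) \<longlonglongrightarrow> 0"
    using tendsto_mult[OF lam_scaled_tendsto D_powr_neg_tendsto_0] by simp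
  show "eventually (\<lambda>n. (lam n * real (max_deg (V n) (E n)) powr (1 / (real k - 1)))
     * real (max_deg (V n) (E n)) powr (- 1 / (real k - 1)) = lam n) sequentially"
    using lam_eq by eventually_elim simp
qed

lemma lam_power_D_tendsto: "(\<lambda>n. lam n ^ (k - 1) * real (max_deg (V n) (E n))) \<longlonglongrightarrow> c ^ (k - 1)"
proof (rule Lim_transform_eventually)
  show "(\<lambda>n. (lam n * real (max_deg (V n) (E n)) powr (1 / (real k - 1))) ^ (k - 1)) \<longlonglongrightarrow> c ^ (k - 1)"
    by (intro tendsto_power lam_scaled_tendsto)
  show "eventually (\<lambda>n. (lam n * real (max_deg (V n) (E n)) powr (1 / (real k - 1))) ^ (k - 1)
      = lam n ^ (k - 1) * real (max_deg (V n) (E n))) sequentially"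
    using D_pos
  proof eventually_elim
    case (elim n)
    have "real (k - 1) = real k - 1" using k_ge_2 by simp
    then have "(real (max_deg (V n) (E n)) powr (1 / (real k - 1))) ^ (k - 1) = real (max_deg (V n) (E n))"
      using elim k_ge_2 by (simp add: powr_realpow[symmetric] powr_powr)
    then show ?case by (simp add: power_mult_distrib)
  qed
qed

lemma Delta_l_ratio_tendsto:
  assumes "l \<in> {2..k-1}"
  shows "(\<lambda>n. real (Delta_l (V n) (E n) l) / real (max_deg (V n) (E n)) powr ((real k - real l) / (real k - 1))) \<longlonglongrightarrow> 0"
  using tree assms unfolding asymp_tree_like_def by (intro smalloD_tendsto) auto

lemma Delta_l_lam_tendsto:
  assumes l: "l \<in> {2..k-1}"
  shows "(\<lambda>n. real (Delta_l (V n) (E n) l) * lam n ^ (k - l)) \<longlonglongrightarrow> 0"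
proof (rule Lim_transform_eventually)
  show "(\<lambda>n. real (Delta_l (V n) (E n) l) / real (max_deg (V n) (E n)) powr ((real k - real l) / (real k - 1))
      * (lam n * real (max_deg (V n) (E n)) powr (1 / (real k - 1))) ^ (k - l)) \<longlonglongrightarrow> 0"
    using tendsto_mult[OF Delta_l_ratio_tendsto[OF l] tendsto_power[OF lam_scaled_tendsto, of "k - l"]] by simp
  show "eventually (\<lambda>n. real (Delta_l (V n) (E n) l) / real (max_deg (V n) (E n)) powr ((real k - real l) / (real k - 1))
      * (lam n * real (max_deg (V n) (E n)) powr (1 / (real k - 1))) ^ (k - l)
      = real (Delta_l (V n) (E n) l) * lam n ^ (k - l)) sequentially"
    using D_pos
  proof eventually_elim
    case (elim n)
    have "real (k - l) = real k - real l" using l by auto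
    then have "(real (max_deg (V n) (E n)) powr (1 / (real k - 1))) ^ (k - l) = real (max_deg (V n) (E n)) powr ((real k - real l) / (real k - 1))"
      using elim by (simp add: powr_realpow[symmetric] powr_powr)
    then show ?case using elim by (simp add: power_mult_distrib)
  qed
qed

lemma Delta_l_product_tendsto:
  assumes l: "l \<in> {2..k-1}"
  shows "(\<lambda>n. real (Delta_l (V n) (E n) l) * real (Delta_l (V n) (E n) (k + 1 - l)) / real (max_deg (V n) (E n))) \<longlonglongrightarrow> 0"
proof (rule Lim_transform_eventually)
  have l': "k + 1 - l \<in> {2..k-1}" using l by auto
  show "(\<lambda>n. real (Delta_l (V n) (E n) l) / real (max_deg (V n) (E n)) powr ((real k - real l) / (real k - 1))
     * (real (Delta_l (V n) (E n) (k + 1 - l)) / real (max_deg (V n) (E n)) powr ((real k - real (k + 1 - l)) / (real k - 1)))) \<longlonglongrightarrow> 0"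
    using tendsto_mult[OF Delta_l_ratio_tendsto[OF l] Delta_l_ratio_tendsto[OF l']] by simp
  show "eventually (\<lambda>n. real (Delta_l (V n) (E n) l) / real (max_deg (V n) (E n)) powr ((real k - real l) / (real k - 1))
     * (real (Delta_l (V n) (E n) (k + 1 - l)) / real (max_deg (V n) (E n)) powr ((real k - real (k + 1 - l)) / (real k - 1)))
      = real (Delta_l (V n) (E n) l) * real (Delta_l (V n) (E n) (k + 1 - l)) / real (max_deg (V n) (E n))) sequentially"
    using D_pos
  proof eventually_elim
    case (elim n)
    have "(real k - real l) / (real k - 1) + (real k - real (k + 1 - l)) / (real k - 1) = 1"
    proof -
      have "real (k + 1 - l) = real k + 1 - real l" "real k - 1 \<noteq> 0" using l by auto
      then show ?thesis by (simp add: add_divide_distrib[symmetric])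
    qed
    then have "real (max_deg (V n) (E n)) powr ((real k - real l) / (real k - 1))
        * real (max_deg (V n) (E n)) powr ((real k - real (k + 1 - l)) / (real k - 1)) = real (max_deg (V n) (E n))"
      using elim by (simp flip: powr_add)
    then show ?case by (metis times_divide_times_eq)
  qed
qed

lemma inverse_D_tendsto: "(\<lambda>n. 1 / real (max_deg (V n) (E n))) \<longlonglongrightarrow> 0"
  by (intro tendsto_divide_0[OF tendsto_const] filterlim_at_top_imp_at_infinity D_at_top)

text \<open>For \<open>k = 2\<close> the range of the codegree condition is empty, but two vertices
  determine an edge, so \<open>Delta_l\<close> at 2 is at most 1. For larger \<open>k\<close> the
  exponent \<open>(k - 2) / (k - 1)\<close> falls short of 1 by \<open>1 / (k - 1)\<close>.\<close>

lemma Delta_2_tendsto: "(\<lambda>n. real (Delta_l (V n) (E n) 2) / real (max_deg (V n) (E n))) \<longlonglongrightarrow> 0"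
proof (cases "k = 2")
  case True
  have "Delta_l (V n) (E n) 2 \<le> 1" for n
  proof -
    have fin: "finite (V n)" using uniform_n[of n] unfolding k_uniform_def by simp
    have "hdeg (E n) S \<le> 1" if S: "S \<subseteq> V n" "card S = 2" for S
    proof -
      have "{e \<in> E n. S \<subseteq> e} \<subseteq> {S}"
      proof
        fix e assume "e \<in> {e \<in> E n. S \<subseteq> e}"
        then have "S \<subseteq> e" "card e = 2" using uniform_n[of n] True unfolding k_uniform_def by auto
        moreover from this have "finite e" using card_ge_0_finite[of e] by simp
        ultimately show "e \<in> {S}" using S card_subset_eq[of e S] by auto
      qed
      then have "card {e \<in> E n. S \<subseteq> e} \<le> card {S}" by (intro card_mono) auto
      then show ?thesis unfolding hdeg_def by simp
    qed
    moreover have "finite {S. S \<subseteq> V n \<and> card S = 2}" using fin by (auto intro: finite_subset[of _ "Pow (V n)"])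
    ultimately show ?thesis unfolding Delta_l_def by (subst Max_le_iff) auto
  qed
  then have "norm (real (Delta_l (V n) (E n) 2) / real (max_deg (V n) (E n))) \<le> 1 / real (max_deg (V n) (E n))" for n
    by (simp add: divide_right_mono)
  then show ?thesis by (intro Lim_null_comparison[OF _ inverse_D_tendsto]) auto
next
  case False
  then have l: "2 \<in> {2..k-1}" using k_ge_2 by auto
  show ?thesis
  proof (rule Lim_transform_eventually)
    show "(\<lambda>n. real (Delta_l (V n) (E n) 2) / real (max_deg (V n) (E n)) powr ((real k - real 2) / (real k - 1))
       * real (max_deg (V n) (E n)) powr (- 1 / (real k - 1))) \<longlonglongrightarrow> 0"
      using tendsto_mult[OF Delta_l_ratio_tendsto[OF l] D_powr_neg_tendsto_0] by simp
    show "eventually (\<lambda>n. real (Delta_l (V n) (E n) 2) / real (max_deg (V n) (E n)) powr ((real k - real 2) / (real k - 1))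
       * real (max_deg (V n) (E n)) powr (- 1 / (real k - 1)) = real (Delta_l (V n) (E n) 2) / real (max_deg (V n) (E n))) sequentially"
      using D_pos
    proof eventually_elim
      case (elim n)
      have "(real k - real 2) / (real k - 1) + 1 / (real k - 1) = 1"
        using k_ge_2 by (simp add: add_divide_distrib[symmetric])
      then have "real (max_deg (V n) (E n)) powr ((real k - real 2) / (real k - 1))
        * real (max_deg (V n) (E n)) powr (1 / (real k - 1)) = real (max_deg (V n) (E n))"
        using elim by (simp flip: powr_add)
      then show ?case by (simp add: powr_minus divide_inverse) (metis inverse_mult_distrib)
    qed
  qed
qed

lemma Gamma_tendsto: "(\<lambda>n. real (Gamma k (V n) (E n)) / real (max_deg (V n) (E n))) \<longlonglongrightarrow> 0"
  using tree unfolding asymp_tree_like_def by (intro smalloD_tendsto) auto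

lemma near_tree_eventually:
  assumes \<epsilon>: "0 < \<epsilon>"
  shows "eventually (\<lambda>n. near_tree k (V n) (E n) (lam n) c \<epsilon>) sequentially"
proof -
  have le: "eventually (\<lambda>n. f n \<le> \<epsilon>) sequentially" if "f \<longlonglongrightarrow> 0" for f :: "nat \<Rightarrow> real"
    using order_tendstoD(2)[OF that \<epsilon>] by (auto elim: eventually_mono)
  have "(\<lambda>n. \<bar>lam n ^ (k - 1) * real (max_deg (V n) (E n)) - c ^ (k - 1)\<bar>) \<longlonglongrightarrow> 0"
    using lam_power_D_tendsto by (simp add: LIM_zero tendsto_rabs_zero)
  note e1 = le[OF this]
  have e2: "eventually (\<lambda>n. \<forall>l\<in>{2..k-1}. real (Delta_l (V n) (E n) l) * lam n ^ (k - l) \<le> \<epsilon>) sequentially"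
    by (intro eventually_ball_finite ballI le Delta_l_lam_tendsto) auto
  have e3: "eventually (\<lambda>n. \<forall>l\<in>{2..k-1}. real (Delta_l (V n) (E n) l) * real (Delta_l (V n) (E n) (k + 1 - l))
      / real (max_deg (V n) (E n)) \<le> \<epsilon>) sequentially"
    by (intro eventually_ball_finite ballI le Delta_l_product_tendsto) auto
  show ?thesis
    using D_pos le[OF lam_tendsto_0] e1 e2 e3 le[OF Delta_2_tendsto] le[OF Gamma_tendsto] le[OF inverse_D_tendsto]
    unfolding near_tree_def
    by eventually_elim (simp add: pos_divide_le_eq)
qed

section \<open>Growth of the number of vertices relative to the maximum degree\<close>

lemma max_deg_le_Delta_2:
  "real (max_deg (V n) (E n)) \<le> real (card (V n)) * real (Delta_l (V n) (E n) 2)"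
proof -
  \<comment> \<open>The values 1 and 0 are placeholders for the model parameters; only combinatorial
    facts of the locale are drawn on.\<close>
  interpret penalty_hypergraph "V n" "E n" k 1 0
    by unfold_locales (use uniform_n k_ge_2 in auto)
  have "max_deg (V n) (E n) \<le> card (V n) * Delta_l (V n) (E n) 2"
    unfolding max_deg_def Delta_l_def[of _ _ 1]
  proof (subst Max_le_iff)
    have "finite {S. S \<subseteq> V n \<and> card S = 1}" using finite_V by (auto intro: finite_subset[of _ "Pow (V n)"])
    then show "finite (insert 0 (hdeg (E n) ` {S. S \<subseteq> V n \<and> card S = 1}))" by simp
    show "\<forall>a\<in>insert 0 (hdeg (E n) ` {S. S \<subseteq> V n \<and> card S = 1}). a \<le> card (V n) * Delta_l (V n) (E n) 2"
    proof
      fix a assume "a \<in> insert 0 (hdeg (E n) ` {S. S \<subseteq> V n \<and> card S = 1})"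
      then consider "a = 0" | v where "v \<in> V n" "a = hdeg (E n) {v}" by (auto simp: card_1_singleton_iff)
      then show "a \<le> card (V n) * Delta_l (V n) (E n) 2"
      proof cases
        case (2 v)
        have "e \<inter> (V n - {v}) \<noteq> {}" if "e \<in> E n" "v \<in> e" for e
        proof
          assume "e \<inter> (V n - {v}) = {}"
          then have "e \<subseteq> {v}" using edge_subset[OF that(1)] by auto
          then show False using edge_card[OF that(1)] card_mono[of "{v}" e] k_ge_2 by auto
        qed
        then have "{e\<in>E n. {v} \<subseteq> e} = {e\<in>E n. v \<in> e \<and> e \<inter> (V n - {v}) \<noteq> {}}" by auto
        then have "a \<le> card (V n - {v}) * Delta_l (V n) (E n) 2"
          using card_edges_meeting[of v "V n - {v}"] 2 unfolding hdeg_def by auto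
        also have "\<dots> \<le> card (V n) * Delta_l (V n) (E n) 2"
          using finite_V by (intro mult_right_mono card_mono) auto
        finally show ?thesis .
      qed simp
    qed
  qed simp
  from of_nat_mono[OF this, where ?'a = real] show ?thesis by simp
qed

end

text \<open>Cauchy-Schwarz bounds the square by \<open>card V\<close> times the sum of squared
  degrees, which counts triples \<open>(v, a, b)\<close> with \<open>a\<close> and \<open>b\<close>
  adjacent to \<open>v\<close>. For distinct \<open>a\<close> and \<open>b\<close> the number of
  \<open>v\<close> is at most \<open>Gamma\<close>, for \<open>a = b\<close> at most the maximum
  degree.\<close>

lemma card_edges_sq_le:
  fixes V :: "'a set"
  assumes "k_uniform 2 V E"
  shows "(real (card E))\<^sup>2 \<le> real (card V) * (real (card V) * real (max_deg V E) + (real (card V))\<^sup>2 * real (Gamma 2 V E))"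
proof -
  interpret penalty_hypergraph V E 2 1 0
    by unfold_locales (use assms in auto)
  define nb where "nb = (\<lambda>v. {u\<in>V. {v,u} \<in> E})"
  have fnb: "finite (nb v)" for v unfolding nb_def using finite_V by simp
  have "E \<subseteq> (\<Union>v\<in>V. (\<lambda>u. {v,u}) ` nb v)"
  proof
    fix e assume e: "e \<in> E"
    obtain a b where ab: "e = {a, b}" using edge_card[OF e] by (auto simp: card_2_iff)
    then have "a \<in> V" "b \<in> nb a" using e edge_subset[OF e] unfolding nb_def by auto
    then show "e \<in> (\<Union>v\<in>V. (\<lambda>u. {v,u}) ` nb v)" using ab by auto
  qed
  then have "card E \<le> card (\<Union>v\<in>V. (\<lambda>u. {v,u}) ` nb v)" using finite_V fnb by (intro card_mono) auto
  also have "\<dots> \<le> (\<Sum>v\<in>V. card ((\<lambda>u. {v,u}) ` nb v))" by (rule card_UN_le[OF finite_V])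
  also have "\<dots> \<le> (\<Sum>v\<in>V. card (nb v))" using fnb by (intro sum_mono card_image_le)
  finally have "card E \<le> (\<Sum>v\<in>V. card (nb v))" .
  from of_nat_mono[OF this, where ?'a = real] have "real (card E) \<le> (\<Sum>v\<in>V. real (card (nb v)))" by simp
  then have "(real (card E))\<^sup>2 \<le> (\<Sum>v\<in>V. 1 * real (card (nb v)))\<^sup>2" by (intro power_mono) auto
  also have "\<dots> \<le> (\<Sum>v\<in>V. 1\<^sup>2) * (\<Sum>v\<in>V. (real (card (nb v)))\<^sup>2)" by (rule Cauchy_Schwarz_ineq_sum)
  also have "\<dots> = real (card V) * (\<Sum>v\<in>V. (real (card (nb v)))\<^sup>2)" by simp
  also have "(\<Sum>v\<in>V. (real (card (nb v)))\<^sup>2) = (\<Sum>v\<in>V. \<Sum>a\<in>V. \<Sum>b\<in>V. of_bool (a \<in> nb v \<and> b \<in> nb v))"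
  proof (rule sum.cong[OF refl])
    fix v
    have "real (card (nb v)) = (\<Sum>a\<in>V. of_bool (a \<in> nb v))"
      using finite_V by (simp add: sum_of_bool_eq Int_def nb_def conj_commute)
    then show "(real (card (nb v)))\<^sup>2 = (\<Sum>a\<in>V. \<Sum>b\<in>V. of_bool (a \<in> nb v \<and> b \<in> nb v))"
      by (simp add: power2_eq_square sum_product of_bool_conj)
  qed
  also have "\<dots> = (\<Sum>a\<in>V. \<Sum>b\<in>V. \<Sum>v\<in>V. of_bool (a \<in> nb v \<and> b \<in> nb v))"
  proof -
    have "(\<Sum>v\<in>V. \<Sum>a\<in>V. \<Sum>b\<in>V. of_bool (a \<in> nb v \<and> b \<in> nb v)) = (\<Sum>a\<in>V. \<Sum>v\<in>V. \<Sum>b\<in>V. (of_bool (a \<in> nb v \<and> b \<in> nb v) :: real))"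
      by (rule sum.swap)
    also have "\<dots> = (\<Sum>a\<in>V. \<Sum>b\<in>V. \<Sum>v\<in>V. of_bool (a \<in> nb v \<and> b \<in> nb v))"
      by (intro sum.cong refl sum.swap)
    finally show ?thesis .
  qed
  also have "\<dots> \<le> (\<Sum>a\<in>V. \<Sum>b\<in>V. real (Gamma 2 V E) + (if a = b then Dmax else 0))"
  proof (intro sum_mono)
    fix a b assume a: "a \<in> V" and b: "b \<in> V"
    have cnt: "(\<Sum>v\<in>V. of_bool (a \<in> nb v \<and> b \<in> nb v)) = real (card {v\<in>V. {v,a} \<in> E \<and> {v,b} \<in> E})"
      using finite_V a b by (simp add: sum_of_bool_eq Int_def nb_def)
    show "(\<Sum>v\<in>V. of_bool (a \<in> nb v \<and> b \<in> nb v)) \<le> real (Gamma 2 V E) + (if a = b then Dmax else 0)"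
    proof (cases "a = b")
      case True
      have "card {v\<in>V. {v,a} \<in> E \<and> {v,b} \<in> E} \<le> card {e\<in>E. a \<in> e}"
      proof (rule card_inj_on_le[of "\<lambda>v. {v,a}"])
        show "inj_on (\<lambda>v. {v, a}) {v\<in>V. {v,a} \<in> E \<and> {v,b} \<in> E}"
        proof (rule inj_onI)
          fix x y assume "x \<in> {v\<in>V. {v,a} \<in> E \<and> {v,b} \<in> E}" "y \<in> {v\<in>V. {v,a} \<in> E \<and> {v,b} \<in> E}" "{x,a} = {y,a}"
          then show "x = y" by (auto simp: doubleton_eq_iff)
        qed
      qed (use finite_E in auto)
      also have "\<dots> \<le> max_deg V E" by (rule degree_le_max_deg[OF a])
      finally show ?thesis unfolding cnt using True by simp
    next
      case False
      have "card {v\<in>V. {v,a} \<in> E \<and> {v,b} \<in> E} \<le> card {S. card S = 2 - 1 \<and> insert a S \<in> E \<and> insert b S \<in> E}"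
      proof (rule card_inj_on_le[of "\<lambda>v. {v}"])
        have "{S. card S = 2 - 1 \<and> insert a S \<in> E \<and> insert b S \<in> E} \<subseteq> Pow V" using edge_subset by auto
        then show "finite {S. card S = 2 - 1 \<and> insert a S \<in> E \<and> insert b S \<in> E}"
          using finite_V finite_subset by blast
      qed (auto simp: insert_commute)
      also have "\<dots> \<le> Gamma 2 V E" by (rule codegree_le_Gamma[OF a b False])
      finally show ?thesis unfolding cnt using False by simp
    qed
  qed
  also have "\<dots> = (\<Sum>a\<in>V. real (card V) * real (Gamma 2 V E) + Dmax)"
    using finite_V by (simp add: sum.distrib)
  also have "\<dots> = real (card V) * Dmax + (real (card V))\<^sup>2 * real (Gamma 2 V E)"
    by (simp add: power2_eq_square algebra_simps)
  finally show ?thesis by (simp add: mult_left_mono)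
qed

context tree_like_sequence
begin

text \<open>For \<open>k\<close> at least 3, each edge at a vertex has a second vertex, so the
  maximum degree is at most \<open>card V\<close> times \<open>Delta_l\<close> at 2, and the latter
  is of smaller order than the power \<open>(k - 2) / (k - 1)\<close>. For \<open>k = 2\<close> this
  argument only gives that the degree is at most \<open>card V\<close>; there the density of edges,
  \<open>card_edges_sq_le\<close> and the smallness of \<open>Gamma\<close> give the extra
  factor.\<close>

lemma card_V_growth:
  assumes K: "0 < K"
  shows "eventually (\<lambda>n. K * real (max_deg (V n) (E n)) powr (1 / (real k - 1)) \<le> real (card (V n))) sequentially"
proof (cases "k = 2")
  case True
  let ?D = "\<lambda>n. real (max_deg (V n) (E n))" and ?N = "\<lambda>n. real (card (V n))"
  have "(\<lambda>n. real (card (E n)) / ?N n) \<in> \<Omega>(?D)" using tree unfolding asymp_tree_like_def by simp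
  then obtain \<kappa> where \<kappa>: "0 < \<kappa>" and dens: "eventually (\<lambda>n. \<kappa> * norm (?D n) \<le> norm (real (card (E n)) / ?N n)) sequentially"
    by (elim landau_omega.bigE)
  \<comment> \<open>The thresholds fit \<open>\<kappa>\<^sup>2 * D \<le> 1 + N * (\<kappa>\<^sup>2 /
    (2 * K))\<close>, derived below: the lower bound on the degree makes the summand 1 at most half
    of the left side, and what remains is \<open>K * D \<le> N\<close>.\<close>
  have "eventually (\<lambda>n. real (Gamma k (V n) (E n)) / ?D n < \<kappa>\<^sup>2 / (2 * K)) sequentially"
    using \<kappa> K by (intro order_tendstoD(2)[OF Gamma_tendsto]) auto
  moreover have "eventually (\<lambda>n. 2 / \<kappa>\<^sup>2 \<le> ?D n) sequentially"
    using D_at_top by (simp add: filterlim_at_top)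
  ultimately show ?thesis using dens D_pos
  proof eventually_elim
    case (elim n)
    define D where "D = ?D n"
    define N where "N = ?N n"
    define G where "G = real (Gamma 2 (V n) (E n))"
    have D0: "0 < D" using elim unfolding D_def by simp
    have "0 < \<kappa> * D" using D0 \<kappa> by simp
    also have "\<dots> \<le> real (card (E n)) / N" using elim D0 unfolding D_def N_def by simp
    finally have N0: "0 < N" unfolding N_def by (metis divide_eq_0_iff less_irrefl of_nat_0_le_iff order_le_less)
    have "\<kappa> * D * N \<le> real (card (E n))"
      using elim D0 N0 unfolding D_def N_def by (simp add: pos_le_divide_eq)
    then have "(\<kappa> * D * N)\<^sup>2 \<le> (real (card (E n)))\<^sup>2" using \<kappa> D0 N0 by (intro power_mono) auto
    also have "\<dots> \<le> N * (N * D + N\<^sup>2 * G)"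
      unfolding N_def D_def G_def using card_edges_sq_le[of "V n" "E n"] uniform_n[of n] True by simp
    also have "\<dots> = N\<^sup>2 * (D + N * G)" by (simp add: power2_eq_square algebra_simps)
    finally have "N\<^sup>2 * (\<kappa> * D)\<^sup>2 \<le> N\<^sup>2 * (D + N * G)" by (simp add: power_mult_distrib mult_ac)
    then have "(\<kappa> * D)\<^sup>2 \<le> D + N * G" using N0 by simp
    also have "N * G \<le> N * (\<kappa>\<^sup>2 / (2 * K) * D)"
    proof -
      have "G / D < \<kappa>\<^sup>2 / (2 * K)" using elim(1) True unfolding G_def D_def by simp
      then have "G \<le> \<kappa>\<^sup>2 / (2 * K) * D" using D0 by (simp add: pos_divide_less_eq)
      then show ?thesis using N0 by (intro mult_left_mono) auto
    qed
    finally have "D * (\<kappa>\<^sup>2 * D) \<le> D * (1 + N * (\<kappa>\<^sup>2 / (2 * K)))" by (simp add: power2_eq_square algebra_simps)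
    then have "\<kappa>\<^sup>2 * D \<le> 1 + N * (\<kappa>\<^sup>2 / (2 * K))" using D0 by simp
    moreover have "2 \<le> \<kappa>\<^sup>2 * D" using elim(2) \<kappa> unfolding D_def by (simp add: divide_le_eq mult.commute)
    ultimately have "\<kappa>\<^sup>2 * D \<le> 2 * (N * (\<kappa>\<^sup>2 / (2 * K)))" by linarith
    also have "\<dots> = \<kappa>\<^sup>2 * (N / K)" using K by simp
    finally have "D \<le> N / K" using \<kappa> by (simp only: mult_le_cancel_left_pos zero_less_power)
    then have "K * D \<le> N" using K by (simp add: pos_le_divide_eq mult.commute)
    then show ?case using True D0 unfolding D_def N_def by simp
  qed
next
  case False
  let ?D = "\<lambda>n. real (max_deg (V n) (E n))" and ?N = "\<lambda>n. real (card (V n))"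
  have l: "2 \<in> {2..k-1}" using False k_ge_2 by auto
  have "eventually (\<lambda>n. real (Delta_l (V n) (E n) 2) / ?D n powr ((real k - real 2) / (real k - 1)) < 1 / K) sequentially"
    using K by (intro order_tendstoD(2)[OF Delta_l_ratio_tendsto[OF l]]) auto
  then show ?thesis using D_pos
  proof eventually_elim
    case (elim n)
    define P where "P = ?D n powr ((real k - real 2) / (real k - 1))"
    have P0: "0 < P" using elim unfolding P_def by simp
    have "(real k - real 2) / (real k - 1) + 1 / (real k - 1) = 1"
      using k_ge_2 by (simp add: add_divide_distrib[symmetric])
    then have "P * ?D n powr (1 / (real k - 1)) = ?D n"
      using elim unfolding P_def by (simp flip: powr_add)
    then have "P * ?D n powr (1 / (real k - 1)) \<le> ?N n * real (Delta_l (V n) (E n) 2)"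
      using max_deg_le_Delta_2[of n] by (simp only:)
    also have "\<dots> \<le> ?N n * (P / K)"
    proof (rule mult_left_mono)
      have "real (Delta_l (V n) (E n) 2) < 1 / K * P" using elim(1) P0 unfolding P_def[symmetric] by (simp add: pos_divide_less_eq)
      then show "real (Delta_l (V n) (E n) 2) \<le> P / K" by simp
    qed simp
    finally have "P * ?D n powr (1 / (real k - 1)) \<le> P * (?N n / K)" by (simp add: mult.commute)
    then have "?D n powr (1 / (real k - 1)) \<le> ?N n / K" using P0 by (simp only: mult_le_cancel_left_pos)
    then show ?case using K by (simp add: pos_le_divide_eq mult.commute)
  qed
qed

end

theorem mainTheorem16:
  fixes k :: nat and c :: real and \<zeta> :: "nat \<Rightarrow> real"
    and V :: "nat \<Rightarrow> 'a set" and E :: "nat \<Rightarrow> 'a set set"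
    and lam :: "nat \<Rightarrow> real"
    and xs :: "nat \<Rightarrow> 'a \<Rightarrow> real" and xt :: "nat \<Rightarrow> real \<Rightarrow> 'a \<Rightarrow> real"
  defines "\<Delta> \<equiv> \<lambda>n. real (max_deg (V n) (E n))"
      and "N \<equiv> \<lambda>n. real (card (V n))"
  assumes k2: "k \<ge> 2" and cpos: "c > 0"
    and zeta: "\<And>n. 0 < \<zeta> n \<and> \<zeta> n \<le> 1"
    and zeta_lim: "limsup (\<lambda>n. ereal (\<zeta> n * (real k - 1) * c ^ (k - 1))) < ereal (exp 1)"
    and tree: "asymp_tree_like k V E"
    and lam: "lam \<sim>[sequentially] (\<lambda>n. c * \<Delta> n powr (- 1 / (real k - 1)))"
    and xs: "\<And>n. is_unique_fixpoint (V n) (E n) c (\<zeta> n) (xs n)"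
    and xt: "\<And>n t. t \<in> {0<..c} \<Longrightarrow> is_unique_fixpoint (V n) (E n) t (\<zeta> n) (xt n t)"
  shows
    "(\<forall>vs. (\<forall>n. vs n \<in> V n) \<longrightarrow>
        (\<lambda>n. ep_prob (V n) (E n) (lam n) (\<zeta> n) (\<lambda>S. vs n \<in> S))
          \<sim>[sequentially] (\<lambda>n. xs n (vs n) * \<Delta> n powr (- 1 / (real k - 1))))
     \<and> (\<forall>es. (\<forall>n. es n \<in> E n) \<longrightarrow>
        (\<lambda>n. ep_prob (V n) (E n) (lam n) (\<zeta> n) (\<lambda>S. es n \<subseteq> S))
          \<sim>[sequentially] (\<lambda>n. (1 - \<zeta> n) * (\<Prod>v\<in>es n. xs n v * \<Delta> n powr (- 1 / (real k - 1)))))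
     \<and> (\<lambda>n. \<Delta> n powr (1 / (real k - 1)) * ln (part_fun (V n) (E n) (lam n) (\<zeta> n)))
          \<sim>[sequentially] (\<lambda>n. \<Sum>v\<in>V n. integral {0..c} (\<lambda>t. xt n t v / t))
     \<and> (\<lambda>n. \<Delta> n powr (1 / (real k - 1)) * ln (part_fun (V n) (E n) (lam n) (\<zeta> n)) / N n
            - bethe_fun (V n) (E n) c (\<zeta> n) (xs n) / N n) \<longlonglongrightarrow> 0
     \<and> (\<lambda>n. ep_var (V n) (E n) (lam n) (\<zeta> n) (\<lambda>S. real (card S)))
          \<in> o(\<lambda>n. (N n)\<^sup>2 * \<Delta> n powr (- 2 / (real k - 1)))
     \<and> (\<lambda>n. ep_var (V n) (E n) (lam n) (\<zeta> n) (\<lambda>S. real (card (edges_in (E n) S))))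
          \<in> o(\<lambda>n. (N n)\<^sup>2 * \<Delta> n powr (- 2 / (real k - 1)))"
proof -
  interpret tree_like_sequence k c V E lam
    by unfold_locales (use k2 cpos tree lam in \<open>auto simp: \<Delta>_def\<close>)
  have \<Delta>pos: "eventually (\<lambda>n. 0 < \<Delta> n) sequentially" unfolding \<Delta>_def by (rule D_pos)
  have lampos: "eventually (\<lambda>n. 0 < lam n) sequentially" by (rule lam_pos_eventually)
  have scaled: "(\<lambda>n. lam n * \<Delta> n powr (1 / (real k - 1))) \<longlonglongrightarrow> c"
    unfolding \<Delta>_def by (rule lam_scaled_tendsto)
  \<comment> \<open>A number \<open>r\<close> strictly between the upper limit and \<open>e\<close>
    exists; taking \<open>max r 1\<close> keeps \<open>B\<close> positive and still below
    \<open>e\<close>.\<close>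
  obtain B where B: "0 < B" "B < exp 1" and zB: "eventually (\<lambda>n. \<zeta> n * (real k - 1) * c ^ (k - 1) \<le> B) sequentially"
  proof -
    obtain r where r: "limsup (\<lambda>n. ereal (\<zeta> n * (real k - 1) * c ^ (k - 1))) < ereal r" "ereal r < ereal (exp 1)"
      using ereal_dense2[OF zeta_lim] by auto
    have "eventually (\<lambda>n. ereal (\<zeta> n * (real k - 1) * c ^ (k - 1)) < ereal r) sequentially"
      by (rule Limsup_lessD[OF r(1)])
    then have "eventually (\<lambda>n. \<zeta> n * (real k - 1) * c ^ (k - 1) \<le> max r 1) sequentially"
      by eventually_elim simp
    moreover have "max r 1 < exp 1" using r(2) exp_gt_one[of 1] by simp
    ultimately show thesis using that[of "max r 1"] by simp
  qed
  \<comment> \<open>At \<open>t = 0\<close> the value 0 solves the logarithmic equation because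
    \<open>k - 1\<close> is positive; this closes the curve at its left end.\<close>
  define s where "s = (\<lambda>n t v. if t = 0 then 0 else ln (t / xt n t v))"
  have lfp: "log_fixpoint (V n) (E n) k t (\<zeta> n) (s n t)" if t: "t \<in> {0..c}" for n t
  proof (cases "t = 0")
    case True
    then show ?thesis unfolding log_fixpoint_def s_def using k2 by (simp add: zero_power)
  next
    case False
    then have "is_fixpoint (V n) (E n) t (\<zeta> n) (xt n t)"
      using xt[of t n] t unfolding is_unique_fixpoint_def by auto
    from fixpoint_imp_log_fixpoint(1)[OF uniform_n _ this] show ?thesis using False t unfolding s_def by simp
  qed
  have xt_eq: "xt n t v = t * exp (- s n t v)" if t: "t \<in> {0<..c}" and v: "v \<in> V n" for n t v
  proof -
    have "is_fixpoint (V n) (E n) t (\<zeta> n) (xt n t)" using xt[OF t, of n] unfolding is_unique_fixpoint_def by auto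
    from fixpoint_imp_log_fixpoint(2)[OF uniform_n _ this v] show ?thesis using t unfolding s_def by simp
  qed
  have xs_eq: "xs n v = c * exp (- s n c v)" if v: "v \<in> V n" for n v
  proof -
    have "is_fixpoint (V n) (E n) c (\<zeta> n) (xt n c)"
      using xt[of c n] cpos unfolding is_unique_fixpoint_def by auto
    then have "xt n c v = xs n v" using xs[of n] v unfolding is_unique_fixpoint_def by blast
    then show ?thesis using xt_eq[of c v n] v cpos by simp
  qed
  have hyp: "penalty_hypergraph (V n) (E n) k x (\<zeta> n)" if "0 < x" for n x
    by unfold_locales (use uniform_n k2 that zeta[of n] in auto)
  \<comment> \<open>A single threshold in \<open>n\<close> serves all \<open>t\<close> in
    \<open>(0, c]\<close> and all sets of size up to \<open>2 * k\<close>: the range of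
    \<open>t\<close> feeds the integration, that of \<open>A\<close> the variances.\<close>
  have core: "eventually (\<lambda>n. near_tree k (V n) (E n) (lam n) c (1/2) \<and> (\<forall>t A. 0 < t \<longrightarrow> t \<le> c \<longrightarrow> A \<subseteq> V n \<longrightarrow> card A \<le> 2 * k \<longrightarrow>
      \<bar>penalty_hypergraph.incl_prob (V n) (E n) (t * lam n / c) (\<zeta> n) A - incl_approx (E n) (t * lam n / c) (\<zeta> n) (s n t) A\<bar>
        \<le> \<delta> * incl_approx (E n) (t * lam n / c) (\<zeta> n) (s n t) A)) sequentially"
    if \<delta>: "0 < \<delta>" "\<delta> \<le> 1" for \<delta>
  proof -
    have C0: "0 \<le> c ^ (k - 1)" using cpos by simp
    obtain \<epsilon> where \<epsilon>: "0 < \<epsilon>" "\<epsilon> \<le> 1/2" and close: "\<forall>(V::'a set) E lam z c' s A.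
       penalty_hypergraph V E k lam z \<longrightarrow> near_tree k V E lam c' \<epsilon> \<longrightarrow> 0 \<le> c' \<longrightarrow> c' ^ (k - 1) \<le> c ^ (k - 1) \<longrightarrow>
       z * (real k - 1) * c' ^ (k - 1) \<le> B \<longrightarrow> log_fixpoint V E k c' z s \<longrightarrow>
       A \<subseteq> V \<longrightarrow> card A \<le> 2 * k \<longrightarrow>
       \<bar>penalty_hypergraph.incl_prob V E lam z A - incl_approx E lam z s A\<bar> \<le> \<delta> * incl_approx E lam z s A"
      using incl_prob_close[OF k2 B C0 \<delta>, where 'a = 'a] by (elim exE conjE) (rule that)
    show ?thesis
      using near_tree_eventually[OF \<epsilon>(1)] lampos zB
    proof eventually_elim
      case (elim n)
      show ?case
      proof (intro conjI allI impI)
        show "near_tree k (V n) (E n) (lam n) c (1/2)" by (rule near_tree_mono[OF elim(1) \<epsilon>(2)])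
        fix t A assume t: "0 < t" "t \<le> c" and A: "A \<subseteq> V n" "card A \<le> 2 * k"
        have tc: "t ^ (k - 1) \<le> c ^ (k - 1)" using t by (intro power_mono) auto
        have "\<zeta> n * (real k - 1) * t ^ (k - 1) \<le> \<zeta> n * (real k - 1) * c ^ (k - 1)"
          using tc zeta[of n] k2 by (intro mult_left_mono) auto
        then have zt: "\<zeta> n * (real k - 1) * t ^ (k - 1) \<le> B" using elim(3) by simp
        show "\<bar>penalty_hypergraph.incl_prob (V n) (E n) (t * lam n / c) (\<zeta> n) A - incl_approx (E n) (t * lam n / c) (\<zeta> n) (s n t) A\<bar>
          \<le> \<delta> * incl_approx (E n) (t * lam n / c) (\<zeta> n) (s n t) A"
          by (rule close[rule_format, OF hyp near_tree_scale[OF elim(1) t elim(2)] _ tc zt lfp A])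
            (use t elim(2) cpos in auto)
      qed
    qed
  qed
  \<comment> \<open>Vertices are the case \<open>a = 1\<close>, where no edge fits inside the set;
    edges are the case \<open>a = k\<close>, where exactly one does.\<close>
  have sets: "(\<lambda>n. ep_prob (V n) (E n) (lam n) (\<zeta> n) (\<lambda>S. As n \<subseteq> S)) \<sim>[sequentially]
      (\<lambda>n. (1 - \<zeta> n) ^ card {g\<in>E n. g \<subseteq> As n} * (\<Prod>v\<in>As n. xs n v * \<Delta> n powr (- 1 / (real k - 1))))"
    if As: "\<And>n. As n \<subseteq> V n" "\<And>n. card (As n) = a" "a \<le> 2 * k" for As a
  proof -
    define g where "g = (\<lambda>n. incl_approx (E n) (lam n) (\<zeta> n) (s n c) (As n))"
    have "(\<lambda>n. ep_prob (V n) (E n) (lam n) (\<zeta> n) (\<lambda>S. As n \<subseteq> S)) \<sim>[sequentially] g"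
    proof (rule asymp_equivI_relative)
      fix \<delta> :: real assume \<delta>: "0 < \<delta>" "\<delta> \<le> 1"
      show "eventually (\<lambda>n. \<bar>ep_prob (V n) (E n) (lam n) (\<zeta> n) (\<lambda>S. As n \<subseteq> S) - g n\<bar> \<le> \<delta> * \<bar>g n\<bar>) sequentially"
        using core[OF \<delta>] lampos
      proof eventually_elim
        case (elim n)
        have g0: "0 \<le> g n" unfolding g_def incl_approx_def using zeta[of n] elim(2) by simp
        have "\<bar>penalty_hypergraph.incl_prob (V n) (E n) (lam n) (\<zeta> n) (As n) - g n\<bar> \<le> \<delta> * g n"
          using elim(1)[THEN conjunct2, rule_format, of c "As n"] As cpos unfolding g_def by simp
        then show ?case
          unfolding penalty_hypergraph.ep_prob_superset[OF hyp[OF elim(2)] As(1)] using g0 by simp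
      qed
    qed
    also have "g \<sim>[sequentially] (\<lambda>n. (1 - \<zeta> n) ^ card {g\<in>E n. g \<subseteq> As n} * (c * \<Delta> n powr (- 1 / (real k - 1))) ^ a
        * exp (- (\<Sum>v\<in>As n. s n c v)))"
      unfolding g_def incl_approx_def As(2) by (intro asymp_equiv_intros lam)
    also have "(\<lambda>n. (1 - \<zeta> n) ^ card {g\<in>E n. g \<subseteq> As n} * (c * \<Delta> n powr (- 1 / (real k - 1))) ^ a
        * exp (- (\<Sum>v\<in>As n. s n c v)))
        = (\<lambda>n. (1 - \<zeta> n) ^ card {g\<in>E n. g \<subseteq> As n} * (\<Prod>v\<in>As n. xs n v * \<Delta> n powr (- 1 / (real k - 1))))"
    proof
      fix n
      have fin: "finite (As n)" using As(1)[of n] uniform_n[of n] finite_subset unfolding k_uniform_def by blast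
      have "(\<Prod>v\<in>As n. xs n v * \<Delta> n powr (- 1 / (real k - 1)))
          = (\<Prod>v\<in>As n. (c * \<Delta> n powr (- 1 / (real k - 1))) * exp (- s n c v))"
        using xs_eq As(1)[of n] by (intro prod.cong) auto
      also have "\<dots> = (c * \<Delta> n powr (- 1 / (real k - 1))) ^ a * exp (- (\<Sum>v\<in>As n. s n c v))"
        using As(2)[of n] fin by (simp only: prod.distrib prod_constant power_mult_distrib sum_negf[symmetric] exp_sum)
      finally show "(1 - \<zeta> n) ^ card {g\<in>E n. g \<subseteq> As n} * (c * \<Delta> n powr (- 1 / (real k - 1))) ^ a
        * exp (- (\<Sum>v\<in>As n. s n c v))
        = (1 - \<zeta> n) ^ card {g\<in>E n. g \<subseteq> As n} * (\<Prod>v\<in>As n. xs n v * \<Delta> n powr (- 1 / (real k - 1)))"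
        by simp
    qed
    finally show ?thesis .
  qed
  have edge: "finite e \<and> card e = k \<and> e \<subseteq> V n" if "e \<in> E n" for e n
    using uniform_n[of n] that finite_subset unfolding k_uniform_def by blast
  have no_edge: "{g\<in>E n. g \<subseteq> {v}} = {}" for n v
  proof -
    have "\<not> g \<subseteq> {v}" if "g \<in> E n" for g
      using edge[OF that] k2 card_mono[of "{v}" g] by auto
    then show ?thesis by auto
  qed
  have i: "(\<lambda>n. ep_prob (V n) (E n) (lam n) (\<zeta> n) (\<lambda>S. vs n \<in> S))
          \<sim>[sequentially] (\<lambda>n. xs n (vs n) * \<Delta> n powr (- 1 / (real k - 1)))"
    if vs: "\<forall>n. vs n \<in> V n" for vs
  proof -
    show ?thesis using sets[of "\<lambda>n. {vs n}" 1] vs k2 by (simp add: no_edge)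
  qed
  have ii: "(\<lambda>n. ep_prob (V n) (E n) (lam n) (\<zeta> n) (\<lambda>S. es n \<subseteq> S))
          \<sim>[sequentially] (\<lambda>n. (1 - \<zeta> n) * (\<Prod>v\<in>es n. xs n v * \<Delta> n powr (- 1 / (real k - 1))))"
    if es: "\<forall>n. es n \<in> E n" for es
  proof -
    have one_edge: "{g\<in>E n. g \<subseteq> es n} = {es n}" for n
    proof -
      have "g = es n" if "g \<in> E n" "g \<subseteq> es n" for g
        using edge[OF that(1)] edge[OF es[rule_format, of n]] that(2) by (intro card_subset_eq) auto
      then show ?thesis using es by auto
    qed
    have "es n \<subseteq> V n" "card (es n) = k" for n using edge[OF es[rule_format, of n]] by auto
    from sets[OF this] show ?thesis by (simp add: one_edge)
  qed
  have curve: "fixpoint_curve (V n) (E n) k (lam n) (\<zeta> n) c B (s n)"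
    if "0 < lam n" "\<zeta> n * (real k - 1) * c ^ (k - 1) \<le> B" for n
    using hyp[OF that(1)] cpos that(2) B lfp by (simp add: fixpoint_curve_def fixpoint_curve_axioms_def)
  define L where "L = (\<lambda>n. \<Delta> n powr (1 / (real k - 1)) * ln (part_fun (V n) (E n) (lam n) (\<zeta> n)))"
  have bethe: "eventually (\<lambda>n. \<bar>L n - bethe_fun (V n) (E n) c (\<zeta> n) (xs n)\<bar> \<le> \<eta> * N n) sequentially" if \<eta>: "0 < \<eta>" for \<eta>
  proof -
    \<comment> \<open>The error is \<open>c * q * (1 + \<delta>) + c * \<delta>\<close> per vertex;
      making \<open>c * q\<close> and \<open>c * \<delta>\<close> at most a third of
      \<open>\<eta>\<close> and \<open>\<delta>\<close> at most 1 keeps it within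
      \<open>\<eta>\<close>.\<close>
    define \<delta> where "\<delta> = min 1 (\<eta> / (3 * c))"
    have \<delta>: "0 < \<delta>" "\<delta> \<le> 1" "c * \<delta> \<le> \<eta> / 3" unfolding \<delta>_def using \<eta> cpos
      by (auto simp: min_def field_simps)
    have "(\<lambda>n. \<bar>lam n * \<Delta> n powr (1 / (real k - 1)) / c - 1\<bar>) \<longlonglongrightarrow> \<bar>c / c - 1\<bar>"
      using cpos by (intro tendsto_intros scaled) auto
    then have "eventually (\<lambda>n. \<bar>lam n * \<Delta> n powr (1 / (real k - 1)) / c - 1\<bar> < \<eta> / (3 * c)) sequentially"
      using \<eta> cpos by (intro order_tendstoD(2)) auto
    then show ?thesis using core[OF \<delta>(1,2)] lampos zB
    proof eventually_elim
      case (elim n)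
      interpret fixpoint_curve "V n" "E n" k "lam n" "\<zeta> n" c B "s n" by (rule curve[OF elim(3,4)])
      define q where "q = \<bar>\<Delta> n powr (1 / (real k - 1)) * lam n / c - 1\<bar>"
      have q: "0 \<le> q" "c * q \<le> \<eta> / 3"
      proof -
        show "0 \<le> q" unfolding q_def by simp
        have "q \<le> \<eta> / (3 * c)" using elim(1) unfolding q_def by (simp only: mult.commute less_imp_le)
        then have "c * q \<le> c * (\<eta> / (3 * c))" using cpos by (intro mult_left_mono) auto
        then show "c * q \<le> \<eta> / 3" using cpos by simp
      qed
      have "\<bar>L n - bethe c\<bar> \<le> c * (real (card (V n)) * (q * (1 + \<delta>) + \<delta>))"
        unfolding L_def q_def
      proof (rule ln_part_fun_close)
        fix t v assume t: "0 < t" "t < c" and v: "v \<in> V n"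
        have "incl_approx (E n) (t * lam n / c) (\<zeta> n) (s n t) {v} = t * lam n / c * exp (- s n t v)"
          unfolding incl_approx_def no_edge by simp
        then show "\<bar>penalty_hypergraph.incl_prob (V n) (E n) (t * lam n / c) (\<zeta> n) {v} - t * lam n / c * exp (- s n t v)\<bar>
            \<le> \<delta> * (t * lam n / c * exp (- s n t v))"
          using elim(2)[THEN conjunct2, rule_format, of t "{v}"] t v k2 by simp
      qed (use \<delta> in simp)
      also have "\<dots> = real (card (V n)) * (c * q * (1 + \<delta>) + c * \<delta>)" by (simp add: algebra_simps)
      also have "\<dots> \<le> real (card (V n)) * (\<eta> / 3 * 2 + \<eta> / 3)"
        using q \<delta> cpos \<eta> by (intro mult_left_mono add_mono mult_mono) auto
      also have "\<dots> = \<eta> * N n" unfolding N_def by simp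
      finally show ?case using bethe_fun_eq[of "xs n"] xs_eq by simp
    qed
  qed
  have int_eq: "integral {0..c} (\<lambda>t. xt n t v / t) = integral {0..c} (\<lambda>t. exp (- s n t v))" if v: "v \<in> V n" for n v
  proof (rule integral_spike[where S = "{0}"])
    fix t assume "t \<in> {0..c} - {0}"
    then show "exp (- s n t v) = xt n t v / t" using xt_eq[of t v n] v by auto
  qed simp
  have iii: "L \<sim>[sequentially] (\<lambda>n. \<Sum>v\<in>V n. integral {0..c} (\<lambda>t. xt n t v / t))"
  proof (rule asymp_equivI_relative)
    fix \<delta> :: real assume \<delta>: "0 < \<delta>" "\<delta> \<le> 1"
    \<comment> \<open>The lower bound per vertex from \<open>bethe_lower\<close>, made independent
      of \<open>n\<close> by \<open>\<zeta> n \<le> 1\<close>.\<close>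
    define m where "m = c * exp (- (c ^ (k - 1)))"
    have m0: "0 < m" unfolding m_def using cpos by simp
    have "0 < \<delta> * m" using \<delta> m0 by simp
    from bethe[OF this] lampos zB
    show "eventually (\<lambda>n. \<bar>L n - (\<Sum>v\<in>V n. integral {0..c} (\<lambda>t. xt n t v / t))\<bar>
        \<le> \<delta> * \<bar>\<Sum>v\<in>V n. integral {0..c} (\<lambda>t. xt n t v / t)\<bar>) sequentially"
    proof eventually_elim
      case (elim n)
      interpret fixpoint_curve "V n" "E n" k "lam n" "\<zeta> n" c B "s n" by (rule curve[OF elim(2,3)])
      have eq: "(\<Sum>v\<in>V n. integral {0..c} (\<lambda>t. xt n t v / t)) = bethe c"
        unfolding bethe_eq_integral using int_eq by (intro sum.cong) auto
      have "\<zeta> n * c ^ (k - 1) \<le> 1 * c ^ (k - 1)" using z_le_1 cpos by (intro mult_right_mono) auto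
      then have "m \<le> c * exp (- (\<zeta> n * c ^ (k - 1)))" unfolding m_def using cpos by simp
      then have "N n * m \<le> N n * (c * exp (- (\<zeta> n * c ^ (k - 1))))" unfolding N_def by (intro mult_left_mono) auto
      then have low: "N n * m \<le> bethe c" using bethe_lower unfolding N_def by linarith
      have "\<bar>L n - bethe c\<bar> \<le> \<delta> * m * N n" using elim(1) bethe_fun_eq[of "xs n"] xs_eq by simp
      also have "\<dots> = \<delta> * (N n * m)" by simp
      also have "\<dots> \<le> \<delta> * \<bar>bethe c\<bar>" using low \<delta> by (intro mult_left_mono) auto
      finally show ?case unfolding eq .
    qed
  qed
  have iv: "(\<lambda>n. L n / N n - bethe_fun (V n) (E n) c (\<zeta> n) (xs n) / N n) \<longlonglongrightarrow> 0"
  proof (rule tendstoI)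
    fix e :: real assume e: "0 < e"
    have "0 < e / 2" using e by simp
    from bethe[OF this]
    show "eventually (\<lambda>n. dist (L n / N n - bethe_fun (V n) (E n) c (\<zeta> n) (xs n) / N n) 0 < e) sequentially"
    proof eventually_elim
      case (elim n)
      have N0: "0 \<le> N n" unfolding N_def by simp
      have "\<bar>L n / N n - bethe_fun (V n) (E n) c (\<zeta> n) (xs n) / N n\<bar> = \<bar>L n - bethe_fun (V n) (E n) c (\<zeta> n) (xs n)\<bar> / N n"
        using N0 by (simp add: diff_divide_distrib[symmetric])
      also have "\<dots> \<le> (e / 2 * N n) / N n" using elim N0 by (intro divide_right_mono) auto
      also have "\<dots> \<le> e / 2" using e by simp
      finally show ?case using e by (simp add: dist_real_def)
    qed
  qed
  \<comment> \<open>Common last step for both variances. The quadratic term is small through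
    \<open>\<delta>\<close>; the linear one is of smaller order because \<open>N * lam\<close> tends
    to infinity by \<open>card_V_growth\<close>.\<close>
  have v: "(\<lambda>n. ep_var (V n) (E n) (lam n) (\<zeta> n) (f n)) \<in> o(\<lambda>n. (N n)\<^sup>2 * \<Delta> n powr (- 2 / (real k - 1)))"
    if K: "0 \<le> K" and f: "\<And>\<delta>. 0 < \<delta> \<Longrightarrow> \<delta> \<le> 1 \<Longrightarrow> eventually (\<lambda>n. ep_var (V n) (E n) (lam n) (\<zeta> n) (f n)
        \<le> K * (N n * lam n) + \<delta> * K * (N n * lam n)\<^sup>2) sequentially" for f K
  proof (rule landau_o.smallI)
    fix d :: real assume d: "0 < d"
    \<comment> \<open>Absorbs the square of \<open>lam n \<le> 2 * (c + 1) * y\<close>, where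
      \<open>y\<close> is the exact power of the maximum degree; \<open>K + 1\<close> in place of
      \<open>K\<close> keeps it positive.\<close>
    define K' where "K' = (K + 1) * 4 * (c + 1)\<^sup>2"
    have K': "1 \<le> K'"
    proof -
      have "1 \<le> (c + 1)\<^sup>2" using cpos by simp
      then have "1 * 1 \<le> ((K + 1) * 4) * (c + 1)\<^sup>2" using K by (intro mult_mono) auto
      then show ?thesis unfolding K'_def by simp
    qed
    define \<delta> where "\<delta> = min 1 (d / (2 * K'))"
    have \<delta>: "0 < \<delta>" "\<delta> \<le> 1" "K' * \<delta> \<le> d / 2"
    proof -
      show "0 < \<delta>" "\<delta> \<le> 1" unfolding \<delta>_def using d K' by auto
      have "K' * \<delta> \<le> K' * (d / (2 * K'))" unfolding \<delta>_def using K' by (intro mult_left_mono) auto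
      then show "K' * \<delta> \<le> d / 2" using K' by simp
    qed
    have "eventually (\<lambda>n. lam n * \<Delta> n powr (1 / (real k - 1)) < 2 * c) sequentially"
      using cpos by (intro order_tendstoD(2)[OF scaled]) auto
    moreover have "eventually (\<lambda>n. 2 * K' / d * \<Delta> n powr (1 / (real k - 1)) \<le> N n) sequentially"
      unfolding \<Delta>_def N_def using K' d by (intro card_V_growth) auto
    ultimately show "eventually (\<lambda>n. norm (ep_var (V n) (E n) (lam n) (\<zeta> n) (f n))
        \<le> d * norm ((N n)\<^sup>2 * \<Delta> n powr (- 2 / (real k - 1)))) sequentially"
      using f[OF \<delta>(1,2)] lampos \<Delta>pos
    proof eventually_elim
      case (elim n)
      define y where "y = \<Delta> n powr (- 1 / (real k - 1))"
      have inv: "y * \<Delta> n powr (1 / (real k - 1)) = 1" "0 < y"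
        unfolding y_def using elim(5) by (auto simp: powr_minus)
      have y2: "\<Delta> n powr (- 2 / (real k - 1)) = y\<^sup>2"
        unfolding y_def power2_eq_square using elim(5) by (simp flip: powr_add)
      have N0: "0 \<le> N n" unfolding N_def by simp
      have "lam n = lam n * \<Delta> n powr (1 / (real k - 1)) * y" using inv by (simp add: mult.commute mult.left_commute)
      also have "\<dots> \<le> 2 * c * y" using elim(1) inv(2) by (intro mult_right_mono) auto
      also have "\<dots> \<le> 2 * (c + 1) * y" using inv(2) by simp
      finally have lamy: "lam n \<le> 2 * (c + 1) * y" .
      have Nl: "N n * lam n \<le> 2 * (c + 1) * (N n * y)" using mult_left_mono[OF lamy N0] by (simp add: mult_ac)
      have Ny: "2 * K' / d \<le> N n * y"
      proof -
        have "2 * K' / d * \<Delta> n powr (1 / (real k - 1)) * y \<le> N n * y" using elim(2) inv(2) by (intro mult_right_mono) auto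
        moreover have "2 * K' / d * \<Delta> n powr (1 / (real k - 1)) * y = 2 * K' / d * (y * \<Delta> n powr (1 / (real k - 1)))"
          by (simp only: mult_ac)
        ultimately show ?thesis using inv(1) by (simp only: mult_1_right)
      qed
      have Ny0: "0 \<le> N n * y" using N0 inv(2) by simp
      have "K * (N n * lam n) \<le> K' * (N n * y)"
      proof -
        have "K * (N n * lam n) \<le> K * (2 * (c + 1) * (N n * y))" using Nl K by (rule mult_left_mono)
        also have "\<dots> = (K * (2 * (c + 1))) * (N n * y)" by simp
        also have "\<dots> \<le> K' * (N n * y)"
        proof (rule mult_right_mono[OF _ Ny0])
          have "(K * 2) * ((c + 1) * 1) \<le> ((K + 1) * 4) * ((c + 1) * (c + 1))"
            using K cpos by (intro mult_mono) auto
          then show "K * (2 * (c + 1)) \<le> K'" unfolding K'_def power2_eq_square by (simp add: mult_ac)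
        qed
        finally show ?thesis .
      qed
      also have "K' * (N n * y) \<le> d / 2 * (N n * y)\<^sup>2"
      proof -
        have "K' \<le> d / 2 * (N n * y)" using Ny d by (simp add: divide_le_eq mult.commute)
        then have "K' * (N n * y) \<le> (d / 2 * (N n * y)) * (N n * y)" using Ny0 by (rule mult_right_mono)
        then show ?thesis by (simp add: power2_eq_square)
      qed
      finally have t1: "K * (N n * lam n) \<le> d / 2 * (N n * y)\<^sup>2" .
      have t2: "\<delta> * K * (N n * lam n)\<^sup>2 \<le> d / 2 * (N n * y)\<^sup>2"
      proof -
        have "(N n * lam n)\<^sup>2 \<le> (2 * (c + 1) * (N n * y))\<^sup>2" using Nl N0 elim(4) by (intro power_mono) auto
        then have "\<delta> * K * (N n * lam n)\<^sup>2 \<le> \<delta> * (K + 1) * (2 * (c + 1) * (N n * y))\<^sup>2"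
          using \<delta> K by (intro mult_mono) auto
        also have "\<dots> = (K' * \<delta>) * (N n * y)\<^sup>2" unfolding K'_def power2_eq_square by algebra
        also have "\<dots> \<le> d / 2 * (N n * y)\<^sup>2" using \<delta>(3) by (intro mult_right_mono) auto
        finally show ?thesis .
      qed
      have "ep_var (V n) (E n) (lam n) (\<zeta> n) (f n) \<le> d * (N n * y)\<^sup>2" using elim(3) t1 t2 by linarith
      then show ?case
        unfolding y2 using penalty_hypergraph.ep_var_nonneg[OF hyp[OF elim(4)]] by (simp add: power_mult_distrib)
    qed
  qed
  define Cv where "Cv = 2 ^ k * (c ^ (k - 1) + 1)\<^sup>2"
  have Cv: "1 \<le> Cv" "(c ^ (k - 1) + 1)\<^sup>2 \<le> Cv"
  proof -
    have 1: "1 \<le> (c ^ (k - 1) + 1)\<^sup>2" using cpos by simp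
    then have "1 * (c ^ (k - 1) + 1)\<^sup>2 \<le> 2 ^ k * (c ^ (k - 1) + 1)\<^sup>2" by (intro mult_right_mono) auto
    then show "(c ^ (k - 1) + 1)\<^sup>2 \<le> Cv" unfolding Cv_def by simp
    then show "1 \<le> Cv" using 1 by linarith
  qed
  have at_c: "\<bar>penalty_hypergraph.incl_prob (V n) (E n) (lam n) (\<zeta> n) A - incl_approx (E n) (lam n) (\<zeta> n) (s n c) A\<bar>
        \<le> \<delta> * incl_approx (E n) (lam n) (\<zeta> n) (s n c) A"
    if "\<forall>t A. 0 < t \<longrightarrow> t \<le> c \<longrightarrow> A \<subseteq> V n \<longrightarrow> card A \<le> 2 * k \<longrightarrow>
      \<bar>penalty_hypergraph.incl_prob (V n) (E n) (t * lam n / c) (\<zeta> n) A - incl_approx (E n) (t * lam n / c) (\<zeta> n) (s n t) A\<bar>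
        \<le> \<delta> * incl_approx (E n) (t * lam n / c) (\<zeta> n) (s n t) A" "A \<subseteq> V n" "card A \<le> 2 * k" for n \<delta> A
    using that(1)[rule_format, of c A] that(2,3) cpos by simp
  have s0: "0 \<le> s n c v" if "v \<in> V n" for n v
    using penalty_hypergraph.log_fixpoint_bounds(1)[OF hyp[of 1] lfp[of c] _ that] cpos by simp
  have v1: "(\<lambda>n. ep_var (V n) (E n) (lam n) (\<zeta> n) (\<lambda>S. real (card S))) \<in> o(\<lambda>n. (N n)\<^sup>2 * \<Delta> n powr (- 2 / (real k - 1)))"
  proof (rule v[where K = 3])
    fix \<delta> :: real assume \<delta>: "0 < \<delta>" "\<delta> \<le> 1"
    show "eventually (\<lambda>n. ep_var (V n) (E n) (lam n) (\<zeta> n) (\<lambda>S. real (card S))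
        \<le> 3 * (N n * lam n) + \<delta> * 3 * (N n * lam n)\<^sup>2) sequentially"
      using core[OF \<delta>] lampos
    proof eventually_elim
      case (elim n)
      have "ep_var (V n) (E n) (lam n) (\<zeta> n) (\<lambda>S. real (card S)) \<le> N n * lam n + 3 * \<delta> * (N n * lam n)\<^sup>2"
        unfolding N_def
        by (rule penalty_hypergraph.ep_var_vertices_le[OF hyp[OF elim(2)], where s = "s n c"])
          (use \<delta> s0 at_c[OF elim(1)[THEN conjunct2]] in auto)
      moreover have "0 \<le> N n * lam n" using elim(2) unfolding N_def by simp
      ultimately show ?case by (simp add: mult.commute)
    qed
  qed simp
  have v2: "(\<lambda>n. ep_var (V n) (E n) (lam n) (\<zeta> n) (\<lambda>S. real (card (edges_in (E n) S))))
      \<in> o(\<lambda>n. (N n)\<^sup>2 * \<Delta> n powr (- 2 / (real k - 1)))"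
  proof (rule v[where K = "3 * Cv"])
    fix \<delta> :: real assume \<delta>: "0 < \<delta>" "\<delta> \<le> 1"
    show "eventually (\<lambda>n. ep_var (V n) (E n) (lam n) (\<zeta> n) (\<lambda>S. real (card (edges_in (E n) S)))
        \<le> 3 * Cv * (N n * lam n) + \<delta> * (3 * Cv) * (N n * lam n)\<^sup>2) sequentially"
      using core[OF \<delta>] lampos
    proof eventually_elim
      case (elim n)
      have "ep_var (V n) (E n) (lam n) (\<zeta> n) (\<lambda>S. real (card (edges_in (E n) S)))
          \<le> Cv * (N n * lam n) + 3 * \<delta> * (c ^ (k - 1) + 1)\<^sup>2 * (N n * lam n)\<^sup>2"
        unfolding N_def Cv_def
        by (rule penalty_hypergraph.ep_var_edges_le[OF hyp[OF elim(2)] elim(1)[THEN conjunct1] order_refl, where s = "s n c"])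
          (use \<delta> cpos s0 at_c[OF elim(1)[THEN conjunct2]] in auto)
      moreover have "Cv * (N n * lam n) \<le> 3 * Cv * (N n * lam n)"
        using Cv(1) elim(2) unfolding N_def by (intro mult_right_mono) auto
      moreover have "3 * \<delta> * (c ^ (k - 1) + 1)\<^sup>2 * (N n * lam n)\<^sup>2 \<le> 3 * \<delta> * Cv * (N n * lam n)\<^sup>2"
        using Cv(2) \<delta> by (intro mult_right_mono mult_left_mono) auto
      ultimately show ?case by (simp add: mult_ac)
    qed
  qed (use Cv in simp)
  show ?thesis using i ii iii iv v1 v2 unfolding L_def by blast
qed

end
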